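(* Suppose $|\theta|^2/|\theta_s|^2=2$, where $\theta$ is the highest root and $\theta_s$ the highest short root. Then the number of short antichains of $\Delta^+$ is \[\prod_{i=1}^p\frac{g+e_i+1}{e_i+1},\] where $e_1,\dots,e_p$ are the exponents of $W$ and $g=\sum_{i:\alpha_i\in\Pi_s}c_i$ with $\theta=\sum_i c_i\alpha_i$.
   Context: $\Delta$ is an irreducible reduced crystallographic root system with roots of two different lengths, $W$ its Weyl group, $\Delta^+$ a positive system with simple roots $\Pi=\{\alpha_1,\dots,\alpha_p\}$, and $\Pi_s$ the short simple roots. On $\Delta^+$, $\mu\preccurlyeq\gamma$ iff $\gamma-\mu$ is a nonnegative integer combination of simple roots. An antichain is a subset of $\Delta^+$ of pairwise incomparable elements (the empty set included); it is short if all its elements are short roots. *)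

theory Defs
  imports "HOL-Analysis.Analysis" "Jordan_Normal_Form.Char_Poly"
begin

subsection \<open>Root systems\<close>

definition reflection :: "'a::euclidean_space \<Rightarrow> 'a \<Rightarrow> 'a" where
  "reflection a v = v - (2 * inner v a / inner a a) *\<^sub>R a"

text \<open>The ambient Euclidean space is the whole type; its dimension is arbitrary.\<close>

definition root_system :: "'a::euclidean_space set \<Rightarrow> bool" where
  "root_system \<Delta> \<longleftrightarrow> finite \<Delta> \<and> 0 \<notin> \<Delta> \<and> span \<Delta> = UNIV \<and> (\<forall>a\<in>\<Delta>. reflection a ` \<Delta> = \<Delta>)"

definition reduced_roots :: "'a::euclidean_space set \<Rightarrow> bool" where
  "reduced_roots \<Delta> \<longleftrightarrow> (\<forall>a\<in>\<Delta>. \<forall>r. r *\<^sub>R a \<in> \<Delta> \<longrightarrow> r = 1 \<or> r = -1)"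

definition crystallographic :: "'a::euclidean_space set \<Rightarrow> bool" where
  "crystallographic \<Delta> \<longleftrightarrow> (\<forall>a\<in>\<Delta>. \<forall>b\<in>\<Delta>. 2 * inner a b / inner b b \<in> \<int>)"

definition irreducible_roots :: "'a::euclidean_space set \<Rightarrow> bool" where
  "irreducible_roots \<Delta> \<longleftrightarrow> \<Delta> \<noteq> {} \<and>
     \<not> (\<exists>S T. S \<noteq> {} \<and> T \<noteq> {} \<and> S \<union> T = \<Delta> \<and> (\<forall>a\<in>S. \<forall>b\<in>T. inner a b = 0))"

definition two_root_lengths :: "'a::euclidean_space set \<Rightarrow> bool" where
  "two_root_lengths \<Delta> \<longleftrightarrow> card (norm ` \<Delta>) = 2"

text \<open>Intended for root systems with two root lengths (in general these are the roots not of
  maximal length; with a single root length the set is empty).\<close>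

definition short_roots :: "'a::euclidean_space set \<Rightarrow> 'a set" where
  "short_roots \<Delta> = {a\<in>\<Delta>. \<exists>b\<in>\<Delta>. norm a < norm b}"

subsection \<open>Simple roots, positive roots and the root order\<close>

definition root_le :: "'a::euclidean_space set \<Rightarrow> 'a \<Rightarrow> 'a \<Rightarrow> bool" where
  "root_le B \<mu> \<gamma> \<longleftrightarrow> (\<exists>k :: 'a \<Rightarrow> nat. \<gamma> - \<mu> = (\<Sum>a\<in>B. real (k a) *\<^sub>R a))"

definition simple_roots :: "'a::euclidean_space set \<Rightarrow> 'a set \<Rightarrow> bool" where
  "simple_roots \<Delta> B \<longleftrightarrow> B \<subseteq> \<Delta> \<and> independent B \<and> span B = UNIV \<and>
     (\<forall>\<gamma>\<in>\<Delta>. root_le B 0 \<gamma> \<or> root_le B \<gamma> 0)"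

definition positive_roots :: "'a::euclidean_space set \<Rightarrow> 'a set \<Rightarrow> 'a set" where
  "positive_roots \<Delta> B = {\<gamma>\<in>\<Delta>. root_le B 0 \<gamma>}"

definition highest_root :: "'a::euclidean_space set \<Rightarrow> 'a set \<Rightarrow> 'a \<Rightarrow> bool" where
  "highest_root \<Delta> B \<theta> \<longleftrightarrow> \<theta> \<in> positive_roots \<Delta> B \<and>
     (\<forall>\<mu>\<in>positive_roots \<Delta> B. root_le B \<mu> \<theta>)"

definition highest_short_root :: "'a::euclidean_space set \<Rightarrow> 'a set \<Rightarrow> 'a \<Rightarrow> bool" where
  "highest_short_root \<Delta> B \<theta> \<longleftrightarrow> \<theta> \<in> positive_roots \<Delta> B \<inter> short_roots \<Delta> \<and>
     (\<forall>\<mu>\<in>positive_roots \<Delta> B \<inter> short_roots \<Delta>. root_le B \<mu> \<theta>)"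

definition root_antichain :: "'a::euclidean_space set \<Rightarrow> 'a set \<Rightarrow> 'a set \<Rightarrow> bool" where
  "root_antichain \<Delta> B A \<longleftrightarrow> A \<subseteq> positive_roots \<Delta> B \<and>
     (\<forall>\<mu>\<in>A. \<forall>\<gamma>\<in>A. \<mu> \<noteq> \<gamma> \<longrightarrow> \<not> root_le B \<mu> \<gamma>)"

definition short_antichains :: "'a::euclidean_space set \<Rightarrow> 'a set \<Rightarrow> 'a set set" where
  "short_antichains \<Delta> B = {A. root_antichain \<Delta> B A \<and> A \<subseteq> short_roots \<Delta>}"

subsection \<open>Exponents of the Weyl group\<close>

text \<open>The simple roots are listed as \<open>\<alpha> 0, \<dots>, \<alpha> (p - 1)\<close>. The Coxeter element is the product of
  the simple reflections in this order, the Coxeter number is its order in the Weyl group.\<close>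

definition coxeter_element :: "(nat \<Rightarrow> 'a::euclidean_space) \<Rightarrow> nat \<Rightarrow> 'a \<Rightarrow> 'a" where
  "coxeter_element \<alpha> p = foldr (\<circ>) (map (\<lambda>i. reflection (\<alpha> i)) [0..<p]) id"

definition coxeter_number :: "(nat \<Rightarrow> 'a::euclidean_space) \<Rightarrow> nat \<Rightarrow> nat" where
  "coxeter_number \<alpha> p = (LEAST n. 0 < n \<and> (coxeter_element \<alpha> p ^^ n) = id)"

text \<open>The matrix of the Coxeter element in the basis of simple roots: column \<open>j\<close> holds the
  coordinates of the image of \<open>\<alpha> j\<close>.\<close>

definition coxeter_mat :: "(nat \<Rightarrow> 'a::euclidean_space) \<Rightarrow> nat \<Rightarrow> real Matrix.mat" where
  "coxeter_mat \<alpha> p = Matrix.mat p p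
     (\<lambda>(i, j). representation (\<alpha> ` {..<p}) (coxeter_element \<alpha> p (\<alpha> j)) (\<alpha> i))"

text \<open>Exponents in the sense of Bourbaki and Humphreys: with \<open>h\<close> the Coxeter number, the
  eigenvalues of a Coxeter element, with multiplicity, are \<open>exp (2 \<pi> \<i> e\<^sub>j / h)\<close> with
  \<open>0 \<le> e\<^sub>j < h\<close>. As all Coxeter elements are conjugate in the Weyl group, the multiset of
  exponents does not depend on the choice or the ordering of the simple roots.\<close>

definition weyl_exponents :: "(nat \<Rightarrow> 'a::euclidean_space) \<Rightarrow> nat \<Rightarrow> (nat \<Rightarrow> nat) \<Rightarrow> bool" where
  "weyl_exponents \<alpha> p e \<longleftrightarrow>
     (\<forall>j<p. e j < coxeter_number \<alpha> p) \<and>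
     map_poly complex_of_real (char_poly (coxeter_mat \<alpha> p)) =
       (\<Prod>j<p. [:- cis (2 * pi * real (e j) / real (coxeter_number \<alpha> p)), 1:])"

end

theory Submission
  imports Defs "Jordan_Normal_Form.Jordan_Normal_Form_Existence"
begin

text \<open>The hypothesis on the lengths forces the Dynkin diagram to be a path with one double bond, so
  the root system has type B, C or \<open>F\<^sub>4\<close>; any other connected diagram contains an affine one, whose
  null vector contradicts the independence of the simple roots. In type B the short positive roots
  form a chain, in type C they form a staircase whose antichains are counted by a reflection argument, in type
  \<open>F\<^sub>4\<close> there are 12 of them, with 21 antichains. The exponents come from the characteristic
  polynomial of the Coxeter element, which is a tridiagonal determinant independent of the order of
  the simple reflections: \<open>x\<^sup>p + 1\<close> for types B and C and \<open>x\<^sup>4 - x\<^sup>2 + 1\<close> for \<open>F\<^sub>4\<close>.\<close>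

subsection \<open>Simple roots and induction over roots\<close>

text \<open>The classification rests on positivity of the form alone. Until chords are excluded,
  inner products of simple roots are known only up to sign, so the null-vector arguments use upper
  bounds: unknown terms are nonpositive and are dropped, and the remaining bounds already add up to
  0. In each type the short roots are found by a closure argument: a set that contains the short
  simple roots and is stable under simple reflections contains all short roots, so an explicit set
  of candidates and their negatives suffices. The Coxeter number is a least period, so knowing the
  eigenvalues does not give it at once. Distinct eigenvalues make the Coxeter element
  diagonalisable, which bounds the period from above; an eigenvalue that is a primitive root of
  unity bounds it from below. For types B and C the exponents are 1, 3, ..., 2n - 1 and
  \<open>g = 2 * m\<close>, so the product collapses to the binomial coefficient of m + n over n,
  with m = 1 in type B and m = n - 1 in type C. For F4, \<open>g = 6\<close> and the exponents are
  1, 5, 7, 11.\<close>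

lemma reflection_self: "a \<noteq> 0 \<Longrightarrow> reflection a a = - a"
  by (simp add: reflection_def scaleR_2)

lemma reflection_uminus: "reflection a (- v) = - reflection a v"
  by (simp add: reflection_def)

lemma reflection_add: "reflection a (v + w) = reflection a v + reflection a w"
  by (simp add: reflection_def inner_add_left add_divide_distrib distrib_left scaleR_add_left)

lemma reflection_diff: "reflection a (v - w) = reflection a v - reflection a w"
  using reflection_add[of a v "- w"] by (simp add: reflection_uminus)

lemma reflection_scaleR: "reflection a (r *\<^sub>R v) = r *\<^sub>R reflection a v"
  by (simp add: reflection_def scaleR_diff_right)

lemma linear_reflection: "linear (reflection a)"
  by (rule linearI) (simp_all add: reflection_add reflection_scaleR)

lemma reflection_reflection: "a \<noteq> 0 \<Longrightarrow> reflection a (reflection a v) = v"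
  by (simp add: reflection_def inner_diff_left algebra_simps)

lemma inner_reflection: "a \<noteq> 0 \<Longrightarrow> inner (reflection a v) (reflection a w) = inner v w"
  by (simp add: reflection_def inner_diff_left inner_diff_right inner_commute field_simps)

locale root_base =
  fixes \<Delta> B :: "'a::euclidean_space set"
  assumes root_system: "root_system \<Delta>" and reduced: "reduced_roots \<Delta>"
    and crystallographic: "crystallographic \<Delta>" and irreducible: "irreducible_roots \<Delta>"
    and simple_roots: "simple_roots \<Delta> B"
begin

lemma
  shows finite_roots: "finite \<Delta>"
    and zero_not_root: "0 \<notin> \<Delta>"
    and base_subset: "B \<subseteq> \<Delta>"
    and independent_base: "independent B"
    and span_base: "span B = UNIV"
  using root_system simple_roots by (auto simp: root_system_def simple_roots_def)

lemma finite_base: "finite B"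
  using finite_subset[OF base_subset finite_roots] .

lemma base_nonzero: "a \<in> B \<Longrightarrow> a \<noteq> 0"
  using base_subset zero_not_root by auto

lemma reflection_root: "a \<in> \<Delta> \<Longrightarrow> b \<in> \<Delta> \<Longrightarrow> reflection a b \<in> \<Delta>"
  using root_system by (auto simp: root_system_def)

lemma uminus_root: "a \<in> \<Delta> \<Longrightarrow> - a \<in> \<Delta>"
  using reflection_root[of a a] reflection_self[of a] zero_not_root by metis

lemma sum_base_eqD:
  assumes "(\<Sum>a\<in>B. x a *\<^sub>R a) = (\<Sum>a\<in>B. y a *\<^sub>R a)" and "a \<in> B"
  shows "x a = y a"
proof -
  have "(\<Sum>a\<in>B. (x a - y a) *\<^sub>R a) = 0"
    using assms(1) by (simp add: scaleR_left_diff_distrib sum_subtractf)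
  then show ?thesis
    using independentD[OF independent_base finite_base order_refl _ assms(2), of "\<lambda>a. x a - y a"]
    by simp
qed

text \<open>Stated for real coefficients, so that it applies to a reflected root whose coefficients
  are not yet known to be integers.\<close>

lemma coefficients_same_sign:
  assumes "(\<Sum>a\<in>B. x a *\<^sub>R a) \<in> \<Delta>"
  shows "(\<forall>a\<in>B. x a \<ge> 0) \<or> (\<forall>a\<in>B. x a \<le> 0)"
proof -
  have "root_le B 0 (\<Sum>a\<in>B. x a *\<^sub>R a) \<or> root_le B (\<Sum>a\<in>B. x a *\<^sub>R a) 0"
    using assms simple_roots by (auto simp: simple_roots_def)
  then show ?thesis
  proof
    assume "root_le B 0 (\<Sum>a\<in>B. x a *\<^sub>R a)"
    then obtain k :: "'a \<Rightarrow> nat" where "(\<Sum>a\<in>B. x a *\<^sub>R a) = (\<Sum>a\<in>B. real (k a) *\<^sub>R a)"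
      by (auto simp: root_le_def)
    from sum_base_eqD[OF this] show ?thesis
      by simp
  next
    assume "root_le B (\<Sum>a\<in>B. x a *\<^sub>R a) 0"
    then obtain k :: "'a \<Rightarrow> nat" where "0 - (\<Sum>a\<in>B. x a *\<^sub>R a) = (\<Sum>a\<in>B. real (k a) *\<^sub>R a)"
      by (auto simp: root_le_def)
    then have "(\<Sum>a\<in>B. x a *\<^sub>R a) = (\<Sum>a\<in>B. (- real (k a)) *\<^sub>R a)"
      by (simp add: sum_negf minus_equation_iff[symmetric] eq_neg_iff_add_eq_0 add.commute)
        (metis add.left_inverse add.commute)
    from sum_base_eqD[OF this] show ?thesis
      by simp
  qed
qed

text \<open>Reflecting \<open>a\<close> in \<open>b\<close> gives a root with coefficient 1 at
  \<open>a\<close> and \<open>- r\<close> at \<open>b\<close>; since signs cannot be mixed,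
  \<open>r\<close> is not positive.\<close>

lemma inner_base_le_0:
  assumes "a \<in> B" "b \<in> B" "a \<noteq> b"
  shows "inner a b \<le> 0"
proof -
  define r where "r = 2 * inner a b / inner b b"
  define x where "x = (\<lambda>c. if c = a then 1 else if c = b then - r else 0)"
  have "(\<Sum>c\<in>B. x c *\<^sub>R c) = (\<Sum>c\<in>B. (if c = a then c else 0) + (if c = b then - r *\<^sub>R c else 0))"
    using assms(3) by (intro sum.cong) (auto simp: x_def)
  also have "\<dots> = a - r *\<^sub>R b"
    using assms finite_base by (simp add: sum.distrib)
  also have "\<dots> = reflection b a"
    by (simp add: reflection_def r_def)
  finally have "(\<Sum>c\<in>B. x c *\<^sub>R c) \<in> \<Delta>"
    using reflection_root assms base_subset by auto
  then have "x b \<ge> 0 \<or> x a \<le> 0"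
    using coefficients_same_sign assms by blast
  then have "r \<le> 0"
    using assms by (auto simp: x_def)
  then show ?thesis
    using base_nonzero[OF assms(2)] by (auto simp: r_def divide_le_0_iff mult_le_0_iff)
      (metis inner_gt_zero_iff not_less)
qed

lemma positive_root_cases: "a \<in> \<Delta> \<Longrightarrow> a \<in> positive_roots \<Delta> B \<or> - a \<in> positive_roots \<Delta> B"
  using simple_roots uminus_root by (auto simp: simple_roots_def positive_roots_def root_le_def)

text \<open>Descent on the height. As \<open>inner \<gamma> \<gamma>\<close> is positive, some
  simple \<open>a\<close> with positive coefficient has positive inner product with the root, and
  reflecting in it lowers the height; \<open>step\<close> leads back up because reflections are
  involutions.\<close>

lemma positive_root_induct:
  assumes "\<gamma> \<in> positive_roots \<Delta> B"
    and base: "\<And>a. a \<in> B \<Longrightarrow> P a"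
    and step: "\<And>a \<gamma>. a \<in> B \<Longrightarrow> \<gamma> \<in> \<Delta> \<Longrightarrow> P \<gamma> \<Longrightarrow> P (reflection a \<gamma>)"
  shows "P \<gamma>"
proof -
  have "P (\<Sum>a\<in>B. real (k a) *\<^sub>R a)" if "(\<Sum>a\<in>B. real (k a) *\<^sub>R a) \<in> \<Delta>" for k :: "'a \<Rightarrow> nat"
    using that
  proof (induction "\<Sum>a\<in>B. k a" arbitrary: k rule: less_induct)
    case less
    define \<gamma> where "\<gamma> = (\<Sum>a\<in>B. real (k a) *\<^sub>R a)"
    have \<gamma>: "\<gamma> \<in> \<Delta>" "\<gamma> \<noteq> 0"
      using less.prems zero_not_root by (auto simp: \<gamma>_def)
    have "0 < inner \<gamma> \<gamma>"
      using \<gamma> by simp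
    also have "inner \<gamma> \<gamma> = (\<Sum>a\<in>B. real (k a) * inner \<gamma> a)"
      by (subst (2) \<gamma>_def) (simp add: inner_sum_right)
    finally have "\<not> (\<forall>a\<in>B. real (k a) * inner \<gamma> a \<le> 0)"
      using sum_nonpos[of B "\<lambda>a. real (k a) * inner \<gamma> a"] by force
    then obtain a where a: "a \<in> B" "real (k a) * inner \<gamma> a > 0"
      by force
    then have ka: "k a > 0" and pos: "inner \<gamma> a > 0"
      by (auto simp: zero_less_mult_iff)
    define r where "r = 2 * inner \<gamma> a / inner a a"
    have "r \<in> \<int>"
      using crystallographic a(1) base_subset \<gamma>(1) by (auto simp: crystallographic_def r_def)
    then obtain m where m: "r = of_int m"
      by (elim Ints_cases)
    have "r > 0"
      using pos base_nonzero[OF a(1)] by (simp add: r_def)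
    then have m1: "m \<ge> 1"
      using m by simp
    have refl: "reflection a \<gamma> = \<gamma> - r *\<^sub>R a"
      by (simp add: reflection_def r_def)
    define x where "x = (\<lambda>b. real (k b) - (if b = a then r else 0))"
    have xsum: "(\<Sum>b\<in>B. x b *\<^sub>R b) = reflection a \<gamma>"
      using a(1) finite_base
      by (simp add: x_def scaleR_left_diff_distrib sum_subtractf refl[unfolded \<gamma>_def] \<gamma>_def
          if_distrib[of "\<lambda>x. x *\<^sub>R _"] cong: if_cong)
    have refl_root: "reflection a \<gamma> \<in> \<Delta>"
      using reflection_root a(1) base_subset \<gamma>(1) by auto
    show ?case
    proof (cases "\<exists>b\<in>B. b \<noteq> a \<and> k b > 0")
      case True
      then obtain b where b: "b \<in> B" "b \<noteq> a" "k b > 0" by auto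
      \<comment> \<open>Only the coefficient at \<open>a\<close> changes; the positive one at
        \<open>b\<close> fixes the sign of all of them.\<close>
      have nonneg: "\<forall>b\<in>B. x b \<ge> 0"
        using coefficients_same_sign[of x] xsum refl_root b by (auto simp: x_def)
      define k' where "k' = (\<lambda>b. if b = a then nat (int (k a) - m) else k b)"
      have "x a \<ge> 0"
        using nonneg a(1) by auto
      then have "real (k' b) = x b" for b
        using m m1 by (auto simp: k'_def x_def of_nat_nat)
      then have k'_sum: "(\<Sum>b\<in>B. real (k' b) *\<^sub>R b) = reflection a \<gamma>"
        using xsum by simp
      have "k' a < k a" 
        using m1 ka by (simp add: k'_def)
      moreover have "\<And>b. k' b \<le> k b"
        using m1 by (auto simp: k'_def)
      ultimately have "(\<Sum>b\<in>B. k' b) < (\<Sum>b\<in>B. k b)"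
        using a(1) finite_base by (intro sum_strict_mono_ex1) auto
      then have "P (reflection a \<gamma>)"
        using less.hyps[of k'] k'_sum refl_root by simp
      then have "P (reflection a (reflection a \<gamma>))"
        using step a(1) refl_root by blast
      then have "P \<gamma>"
        using reflection_reflection base_nonzero a(1) by metis
      then show ?thesis
        by (simp only: \<gamma>_def)
    next
      case False
      \<comment> \<open>The root is a multiple of \<open>a\<close>, hence \<open>a\<close> itself by
        reducedness.\<close>
      then have "\<gamma> = (\<Sum>b\<in>B. if b = a then real (k a) *\<^sub>R a else 0)"
        unfolding \<gamma>_def by (intro sum.cong) auto
      then have "\<gamma> = real (k a) *\<^sub>R a"
        using a(1) finite_base by simp
      then have "\<gamma> = a"
        using reduced a(1) base_subset \<gamma>(1) unfolding reduced_roots_def by fastforce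
      then show ?thesis
        using base a(1) by (simp add: \<gamma>_def)
    qed
  qed
  then show ?thesis
    using assms(1) by (auto simp: positive_roots_def root_le_def)
qed

text \<open>Negative roots are reached by proving the property for a root and its negative together;
  \<open>- a\<close> is the reflection of \<open>a\<close> in itself.\<close>

lemma root_induct:
  assumes "\<gamma> \<in> \<Delta>"
    and base: "\<And>a. a \<in> B \<Longrightarrow> P a"
    and step: "\<And>a \<gamma>. a \<in> B \<Longrightarrow> \<gamma> \<in> \<Delta> \<Longrightarrow> P \<gamma> \<Longrightarrow> P (reflection a \<gamma>)"
  shows "P \<gamma>"
proof -
  have *: "P \<delta> \<and> P (- \<delta>)" if "\<delta> \<in> positive_roots \<Delta> B" for \<delta>
  proof (rule positive_root_induct[OF that])
    fix a assume "a \<in> B"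
    then show "P a \<and> P (- a)"
      using base[of a] step[of a a] reflection_self[of a] base_nonzero[of a] base_subset by auto
  next
    fix a \<gamma> assume "a \<in> B" "\<gamma> \<in> \<Delta>" "P \<gamma> \<and> P (- \<gamma>)"
    then show "P (reflection a \<gamma>) \<and> P (- reflection a \<gamma>)"
      using step uminus_root by (metis reflection_uminus)
  qed
  show ?thesis
    using positive_root_cases[OF assms(1)] *[of \<gamma>] *[of "- \<gamma>"] by auto
qed

text \<open>Reflections preserve length, so each root length already occurs on a simple
  root.\<close>

lemma root_norm_in_base:
  assumes "\<gamma> \<in> \<Delta>"
  shows "\<exists>a\<in>B. inner a a = inner \<gamma> \<gamma>"
  using assms
proof (rule root_induct)
  fix a \<delta> :: 'a assume "a \<in> B" "\<exists>b\<in>B. inner b b = inner \<delta> \<delta>"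
  then show "\<exists>b\<in>B. inner b b = inner (reflection a \<delta>) (reflection a \<delta>)"
    by (simp add: inner_reflection base_nonzero)
qed auto

text \<open>If \<open>S\<close> were proper, the spans of \<open>S\<close> and \<open>B - S\<close>
  would be orthogonal and every root would lie in one of them, because a simple reflection acts
  within one span and fixes the other. This splits the roots against irreducibility.\<close>

lemma base_connected:
  assumes "S \<subseteq> B" "S \<noteq> {}" "\<And>a b. a \<in> S \<Longrightarrow> b \<in> B - S \<Longrightarrow> inner a b = 0"
  shows "S = B"
proof (rule ccontr)
  assume neq: "S \<noteq> B"
  define T where "T = B - S"
  have T: "T \<noteq> {}" "T \<subseteq> B"
    using assms(1) neq by (auto simp: T_def)
  have orth: "inner v w = 0" if "v \<in> span S" "w \<in> span T" for v w
  proof -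
    have "inner a w = 0" if "a \<in> S" for a
      using \<open>w \<in> span T\<close> assms(3)[OF that]
      by (induction rule: span_induct_alt) (auto simp: inner_add_right T_def)
    with \<open>v \<in> span S\<close> show ?thesis
      by (induction rule: span_induct_alt) (auto simp: inner_add_left)
  qed
  have split: "\<gamma> \<in> span S \<or> \<gamma> \<in> span T" if "\<gamma> \<in> \<Delta>" for \<gamma>
    using that
  proof (rule root_induct)
    fix a assume "a \<in> B"
    then show "a \<in> span S \<or> a \<in> span T"
      by (auto simp: T_def intro: Real_Vector_Spaces.span_base)
  next
    fix a \<delta> assume a: "a \<in> B" and \<delta>: "\<delta> \<in> span S \<or> \<delta> \<in> span T"
    have "a \<in> span S \<or> a \<in> span T"
      using a by (auto simp: T_def intro: Real_Vector_Spaces.span_base)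
    then consider "a \<in> span S" "\<delta> \<in> span S" | "a \<in> span T" "\<delta> \<in> span T" | "inner \<delta> a = 0"
      using \<delta> orth inner_commute by metis
    then show "reflection a \<delta> \<in> span S \<or> reflection a \<delta> \<in> span T"
      by cases (use \<delta> in \<open>auto simp: reflection_def intro: span_diff span_scale\<close>)
  qed
  have "\<Delta> \<inter> span S \<noteq> {}" "\<Delta> \<inter> span T \<noteq> {}"
    using T assms(1,2) base_subset Real_Vector_Spaces.span_base by blast+
  moreover have "(\<Delta> \<inter> span S) \<union> (\<Delta> \<inter> span T) = \<Delta>"
    using split by auto
  ultimately show False
    using irreducible orth unfolding irreducible_roots_def by (metis IntD2)
qed

end

subsection \<open>Classification of the Dynkin diagram\<close>

lemma inner_add_self:
  fixes x y :: "'a::real_inner"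
  shows "inner (x + y) (x + y) = inner x x + inner y y + 2 * inner x y"
  by (simp add: inner_add_left inner_add_right inner_commute)

text \<open>Turns incomplete knowledge into a usable bound: one inner product is known, the others
  only up to sign.\<close>

lemma inner_sum_le_single:
  fixes f :: "'b \<Rightarrow> 'a::real_inner"
  assumes "finite I" "t \<in> I" "\<And>i. i \<in> I \<Longrightarrow> inner (f i) y \<le> 0"
  shows "inner (sum f I) y \<le> inner (f t) y"
proof -
  have "inner (sum f I) y = inner (f t) y + (\<Sum>i\<in>I - {t}. inner (f i) y)"
    using assms(1,2) by (simp add: sum.remove inner_add_left inner_sum_left)
  also have "\<dots> \<le> inner (f t) y"
    using assms(3) by (auto intro: sum_nonpos)
  finally show ?thesis .
qed

locale doubly_laced_base = root_base +
  fixes s :: real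
  assumes s_pos: "s > 0"
    and root_norm: "a \<in> \<Delta> \<Longrightarrow> inner a a = s \<or> inner a a = 2 * s"
    and ex_short: "\<exists>a\<in>\<Delta>. inner a a = s"
    and ex_long: "\<exists>a\<in>\<Delta>. inner a a = 2 * s"
begin

lemma base_norm: "a \<in> B \<Longrightarrow> inner a a = s \<or> inner a a = 2 * s"
  using root_norm base_subset by auto

lemma base_norm_le: "a \<in> B \<Longrightarrow> inner a a \<le> 2 * s"
  using base_norm[of a] s_pos by auto

text \<open>Linear independence as strict positivity of the form; a null vector with nonzero
  coefficient at \<open>y\<close> contradicts it.\<close>

lemma base_combination_pos:
  assumes "y \<in> B" "w \<in> span (B - {y})" "r \<noteq> 0"
  shows "inner (r *\<^sub>R y + w) (r *\<^sub>R y + w) > 0"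
proof -
  have "r *\<^sub>R y + w \<noteq> 0"
  proof
    assume "r *\<^sub>R y + w = 0"
    then have "r *\<^sub>R y \<in> span (B - {y})"
      using assms(2) span_neg[OF assms(2)] by (metis add_eq_0_iff2)
    then have "y \<in> span (B - {y})"
      using span_scale[of "r *\<^sub>R y" "B - {y}" "1 / r"] assms(3) by simp
    then show False
      using independent_base assms(1) by (auto simp: dependent_def)
  qed
  then show ?thesis by simp
qed

lemma crystallographic_inner:
  assumes "a \<in> B" "b \<in> B"
  obtains m :: int where "2 * inner a b = of_int m * inner b b"
proof -
  have "2 * inner a b / inner b b \<in> \<int>"
    using assms base_subset crystallographic by (auto simp: crystallographic_def)
  then obtain m :: int where m: "2 * inner a b / inner b b = of_int m"
    by (elim Ints_cases)
  have "inner b b \<noteq> 0"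
    using base_nonzero[OF assms(2)] by simp
  then show ?thesis
    using that[of m] m by (simp add: field_simps)
qed

lemma base_pair_pos:
  assumes "a \<in> B" "b \<in> B" "a \<noteq> b"
  shows "inner a a + inner b b + 2 * inner a b > 0"
  using base_combination_pos[of a b 1] assms Real_Vector_Spaces.span_base[of b "B - {a}"]
  by (simp add: inner_add_self)

text \<open>The Cartan integer is negative, and positivity of the squared length of
  \<open>a + b\<close> rules out values below -1. The root \<open>a\<close> may have either
  length.\<close>

lemma inner_base_long:
  assumes "a \<in> B" "b \<in> B" "a \<noteq> b" "inner b b = 2 * s" "inner a b \<noteq> 0"
  shows "inner a b = - s"
proof -
  obtain m :: int where m: "2 * inner a b = of_int m * inner b b"
    using crystallographic_inner assms(1,2) by blast
  then have ab: "inner a b = of_int m * s"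
    using assms(4) by simp
  have "m < 0"
    using inner_base_le_0[OF assms(1-3)] assms(5) s_pos ab
    by (smt (verit) mult_nonneg_nonneg of_int_0_le_iff)
  have "s * (4 + 2 * of_int m) > 0"
    using base_pair_pos[OF assms(1-3)] base_norm_le[OF assms(1)] assms(4) ab
    by (simp add: algebra_simps)
  then have "m > -2"
    using s_pos by (simp add: zero_less_mult_iff)
  then have "m = -1"
    using \<open>m < 0\<close> by simp
  then show ?thesis
    using ab by simp
qed

lemma inner_base_short:
  assumes "a \<in> B" "b \<in> B" "a \<noteq> b" "inner a a = s" "inner b b = s" "inner a b \<noteq> 0"
  shows "inner a b = - (s / 2)"
proof -
  obtain m :: int where m: "2 * inner a b = of_int m * inner b b"
    using crystallographic_inner assms(1,2) by blast
  then have ab: "2 * inner a b = of_int m * s"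
    using assms(5) by simp
  have "m < 0"
    using inner_base_le_0[OF assms(1-3)] assms(6) s_pos ab
    by (smt (verit) mult_nonneg_nonneg of_int_0_le_iff)
  have "s * (2 + of_int m) > 0"
    using base_pair_pos[OF assms(1-3)] assms(4,5) ab by (simp add: algebra_simps)
  then have "m > -2"
    using s_pos by (simp add: zero_less_mult_iff)
  then have "m = -1"
    using \<open>m < 0\<close> by simp
  then show ?thesis
    using ab by simp
qed

lemma inner_base_eq:
  assumes "a \<in> B" "b \<in> B" "a \<noteq> b" "inner a b \<noteq> 0"
  shows "inner a b = (if inner a a = s \<and> inner b b = s then - (s / 2) else - s)"
  using assms inner_base_long[of a b] inner_base_long[of b a] inner_base_short[of a b]
    base_norm[of a] base_norm[of b] by (auto simp: inner_commute)

text \<open>\<open>k\<close> counts the long roots, which come first, so the double bond joins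
  \<open>f (k - 1)\<close> and \<open>f k\<close>. Nothing is asked of non-consecutive roots, which
  keeps paths easy to extend; their orthogonality is derived in
  \<open>path_nonadjacent\<close>.\<close>

definition dynkin_path :: "(nat \<Rightarrow> 'a) \<Rightarrow> nat \<Rightarrow> nat \<Rightarrow> bool" where
  "dynkin_path f k n \<longleftrightarrow> inj_on f {..<n} \<and> f ` {..<n} \<subseteq> B \<and> 0 < k \<and> k < n \<and>
     (\<forall>i<k. inner (f i) (f i) = 2 * s) \<and> (\<forall>i. k \<le> i \<and> i < n \<longrightarrow> inner (f i) (f i) = s) \<and>
     (\<forall>i. Suc i < n \<longrightarrow> inner (f i) (f (Suc i)) \<noteq> 0)"

section \<open>Forbidden configurations around a Dynkin path\<close>

context
  fixes f k n
  assumes path: "dynkin_path f k n"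
begin

lemma path_base: "i < n \<Longrightarrow> f i \<in> B"
  and path_eq_iff: "i < n \<Longrightarrow> j < n \<Longrightarrow> f i = f j \<longleftrightarrow> i = j"
  and path_k: "0 < k" "k < n" "k - 1 < n"
  and path_long: "i < k \<Longrightarrow> inner (f i) (f i) = 2 * s"
  and path_short: "k \<le> i \<Longrightarrow> i < n \<Longrightarrow> inner (f i) (f i) = s"
  using path unfolding dynkin_path_def inj_on_def by auto

lemma path_adjacent:
  assumes "Suc i < n"
  shows "inner (f i) (f (Suc i)) = (if i < k then - s else - (s / 2))"
proof -
  have "inner (f i) (f (Suc i)) \<noteq> 0"
    using path assms by (auto simp: dynkin_path_def)
  moreover have "f i \<in> B" "f (Suc i) \<in> B" "f i \<noteq> f (Suc i)"
    using assms path_base path_eq_iff[of i "Suc i"] by auto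
  ultimately show ?thesis
    using inner_base_eq[of "f i" "f (Suc i)"] assms path_long[of i] path_short[of i] path_short[of "Suc i"] s_pos
    by auto
qed

lemma segment_inner_le:
  assumes "i \<le> t" "t < j" "j \<le> n" "y \<in> B" "\<And>u. i \<le> u \<Longrightarrow> u < j \<Longrightarrow> y \<noteq> f u"
  shows "inner (sum f {i..<j}) y \<le> inner (f t) y"
  using assms path_base by (intro inner_sum_le_single) (auto intro!: inner_base_le_0)

lemma segment_span:
  assumes "j \<le> n" "\<And>u. i \<le> u \<Longrightarrow> u < j \<Longrightarrow> y \<noteq> f u"
  shows "sum f {i..<j} \<in> span (B - {y})"
  using assms path_base by (intro span_sum Real_Vector_Spaces.span_base) auto

lemma path_span: "j < n \<Longrightarrow> y \<noteq> f j \<Longrightarrow> f j \<in> span (B - {y})"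
  using path_base by (intro Real_Vector_Spaces.span_base) auto

text \<open>Each new long root adds \<open>2 * s\<close>, and its bond with the previous one removes
  at least as much. Only an upper bound is available, as chords are not yet excluded.\<close>

lemma segment_long:
  assumes "i < j" "j \<le> k"
  shows "inner (sum f {i..<j}) (sum f {i..<j}) \<le> 2 * s"
  using assms
proof (induction j)
  case (Suc j)
  show ?case
  proof (cases "i = j")
    case False
    then have ij: "i < j" "j < n" "j < k"
      using Suc.prems path_k by auto
    obtain m where m: "j = Suc m"
      using ij by (cases j) auto
    have "inner (sum f {i..<j}) (f j) \<le> inner (f m) (f j)"
      using ij m path_base path_eq_iff by (intro segment_inner_le) auto
    also have "\<dots> = - s"
      using path_adjacent[of m] ij m by simp
    finally show ?thesis
      using Suc.IH ij path_long[of j] by (simp add: inner_add_self)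
  qed (use Suc.prems path_long in simp)
qed simp

lemma segment_short:
  assumes "k \<le> i" "i < j" "j \<le> n"
  shows "inner (sum f {i..<j}) (sum f {i..<j}) \<le> s"
  using assms
proof (induction j)
  case (Suc j)
  show ?case
  proof (cases "i = j")
    case False
    then have ij: "i < j" "j < n"
      using Suc.prems by auto
    obtain m where m: "j = Suc m"
      using ij by (cases j) auto
    have "inner (sum f {i..<j}) (f j) \<le> inner (f m) (f j)"
      using ij m path_base path_eq_iff by (intro segment_inner_le) auto
    also have "\<dots> = - (s / 2)"
      using path_adjacent[of m] ij m Suc.prems by simp
    finally show ?thesis
      using Suc.IH ij path_short[of j] Suc.prems by (simp add: inner_add_self)
  qed (use Suc.prems path_short in simp)
qed simp

text \<open>The vectors below are the null vectors of the (possibly twisted) affine diagrams that the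
  forbidden configurations would contain.\<close>

lemma path_no_branch_long:
  assumes x: "x \<in> B" "x \<notin> f ` {..<n}" and t: "0 < t" "t < k"
  shows "inner x (f t) = 0"
proof (rule ccontr)
  assume nz: "inner x (f t) \<noteq> 0"
  have tn: "t < n" using t path_k by simp
  have xf: "\<And>u. u < n \<Longrightarrow> x \<noteq> f u" using x by auto
  define Z where "Z = sum f {t..<k}"
  have "inner x (f t) = - s"
    using inner_base_long[of x "f t"] x path_base[OF tn] xf[OF tn] path_long t nz by auto
  then have 1: "inner Z x \<le> - s"
    unfolding Z_def using segment_inner_le[of t t k x] t path_k x xf by (simp add: inner_commute)
  have "f (t - 1) \<noteq> f u" if "t \<le> u" "u < k" for u
    using that t path_k path_eq_iff[of "t - 1" u] by simp
  moreover have "t - 1 < k" "t - 1 < n"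
    using t path_k by auto
  ultimately have 2: "inner Z (f (t - 1)) \<le> - s"
    unfolding Z_def using segment_inner_le[of t t k "f (t - 1)"] t path_k path_base
      path_adjacent[of "t - 1"] by (simp add: inner_commute)
  have 3: "inner Z (f k) \<le> - s"
    unfolding Z_def using segment_inner_le[of t "k - 1" k "f k"] t path_k path_base path_eq_iff
      path_adjacent[of "k - 1"] by simp
  have 4: "inner x (f (t - 1)) \<le> 0" "inner x (f k) \<le> 0" "inner (f (t - 1)) (f k) \<le> 0"
    using t path_k path_base path_eq_iff x xf[of "t - 1"] xf[of k] by (auto intro!: inner_base_le_0)
  have 5: "inner x x \<le> 2 * s" "inner (f (t - 1)) (f (t - 1)) = 2 * s" "inner Z Z \<le> 2 * s"
    "inner (f k) (f k) = s"
    using base_norm_le x path_long t path_short path_k segment_long unfolding Z_def by auto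
  \<comment> \<open>For a long \<open>x\<close> these are the marks of affine type B: 1 on the two
    long roots of the fork, then 2 up to the short end. A short \<open>x\<close> only lowers the
    squared length.\<close>
  define w where "w = f (t - 1) + 2 *\<^sub>R Z + 2 *\<^sub>R f k"
  have "w \<in> span (B - {x})"
    unfolding w_def Z_def using t path_k
    by (intro span_add span_scale segment_span path_span xf) auto
  then have "inner (x + w) (x + w) > 0"
    using base_combination_pos[of x w 1] x by simp
  moreover have "inner (x + w) (x + w) =
      inner x x + inner (f (t - 1)) (f (t - 1)) + 4 * inner Z Z + 4 * inner (f k) (f k)
      + 2 * inner x (f (t - 1)) + 4 * inner Z x + 4 * inner x (f k)
      + 4 * inner Z (f (t - 1)) + 4 * inner (f (t - 1)) (f k) + 8 * inner Z (f k)"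
    unfolding w_def by (simp add: inner_add_left inner_add_right inner_commute)
  ultimately show False
    using 1 2 3 4 5 by linarith
qed

lemma path_no_branch_first:
  assumes x: "x \<in> B" "x \<notin> f ` {..<n}" "inner x x = s"
  shows "inner x (f 0) = 0"
proof (rule ccontr)
  assume nz: "inner x (f 0) \<noteq> 0"
  have tn: "0 < n" using path_k by simp
  have xf: "\<And>u. u < n \<Longrightarrow> x \<noteq> f u" using x by auto
  define Z where "Z = sum f {0..<k}"
  have "inner x (f 0) = - s"
    using inner_base_long[of x "f 0"] x path_base[OF tn] xf[OF tn] path_long path_k nz by auto
  then have 1: "inner Z x \<le> - s"
    unfolding Z_def using segment_inner_le[of 0 0 k x] path_k x xf by (simp add: inner_commute)
  have 3: "inner Z (f k) \<le> - s"
    unfolding Z_def using segment_inner_le[of 0 "k - 1" k "f k"] path_k path_base path_eq_iff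
      path_adjacent[of "k - 1"] by simp
  have 4: "inner x (f k) \<le> 0"
    using path_k path_base path_eq_iff x xf by (auto intro!: inner_base_le_0)
  have 5: "inner Z Z \<le> 2 * s" "inner (f k) (f k) = s"
    using path_short path_k segment_long unfolding Z_def by auto
  \<comment> \<open>A path of long roots with a short root at either end, a twisted affine diagram
    of type D whose marks are all 1.\<close>
  define w where "w = Z + f k"
  have "w \<in> span (B - {x})"
    unfolding w_def Z_def using path_k path_base xf
    by (intro span_add segment_span Real_Vector_Spaces.span_base) auto
  then have "inner (x + w) (x + w) > 0"
    using base_combination_pos[of x w 1] x by simp
  moreover have "inner (x + w) (x + w) =
      inner x x + inner Z Z + inner (f k) (f k)
      + 2 * inner Z x + 2 * inner x (f k) + 2 * inner Z (f k)"
    unfolding w_def by (simp add: inner_add_left inner_add_right inner_commute)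
  ultimately show False
    using 1 3 4 5 x(3) by linarith
qed

lemma path_no_branch_short:
  assumes x: "x \<in> B" "x \<notin> f ` {..<n}" and t: "k \<le> t" "Suc t < n"
  shows "inner x (f t) = 0"
proof (rule ccontr)
  assume nz: "inner x (f t) \<noteq> 0"
  have tn: "t < n" using t by simp
  have xf: "\<And>u. u < n \<Longrightarrow> x \<noteq> f u" using x by auto
  define Z where "Z = sum f {k..<Suc t}"
  \<comment> \<open>A long \<open>x\<close> is halved; then its squared length and its bond with
    \<open>f t\<close> stay within the bounds for a short root.\<close>
  define r :: real where "r = (if inner x x = s then 1 else 1 / 2)"
  have r: "r > 0" "r\<^sup>2 * inner x x \<le> s"
    using base_norm[OF x(1)] s_pos by (auto simp: r_def power2_eq_square)
  have "r * inner x (f t) = - (s / 2)"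
    using inner_base_eq[of x "f t"] x path_base[OF tn] xf[OF tn] path_short t nz by (auto simp: r_def)
  moreover have "inner Z x \<le> inner x (f t)"
    unfolding Z_def using segment_inner_le[of k t "Suc t" x] t path_k x xf by (simp add: inner_commute)
  ultimately have 1: "r * inner Z x \<le> - (s / 2)"
    using r by (metis mult_left_mono less_imp_le)
  have 2: "inner Z (f (Suc t)) \<le> - (s / 2)"
    unfolding Z_def using segment_inner_le[of k t "Suc t" "f (Suc t)"] t path_k path_base path_eq_iff
      path_adjacent[of t] by simp
  have 3: "inner Z (f (k - 1)) \<le> - s"
    unfolding Z_def using segment_inner_le[of k k "Suc t" "f (k - 1)"] t path_k path_base path_eq_iff
      path_adjacent[of "k - 1"] by (simp add: inner_commute)
  have 4: "r * inner x (f (Suc t)) \<le> 0" "r * inner x (f (k - 1)) \<le> 0" "inner (f (Suc t)) (f (k - 1)) \<le> 0"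
    using t path_k path_base path_eq_iff x xf[of "k - 1"] xf[of "Suc t"] r
    by (auto intro!: inner_base_le_0 mult_nonneg_nonpos)
  have 5: "inner (f (Suc t)) (f (Suc t)) = s" "inner Z Z \<le> s" "inner (f (k - 1)) (f (k - 1)) = 2 * s"
    using path_long t path_short path_k segment_short[of k "Suc t"] unfolding Z_def by auto
  \<comment> \<open>Marks of a twisted affine diagram of type A: 1 on the short fork, 2 along the
    short path, 1 on the long end.\<close>
  define w where "w = f (Suc t) + 2 *\<^sub>R Z + f (k - 1)"
  have "w \<in> span (B - {x})"
    unfolding w_def Z_def using t path_k path_base xf
    by (intro span_add span_scale segment_span Real_Vector_Spaces.span_base) auto
  then have "inner (r *\<^sub>R x + w) (r *\<^sub>R x + w) > 0"
    using base_combination_pos[of x w r] x r by simp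
  moreover have "inner (r *\<^sub>R x + w) (r *\<^sub>R x + w) =
      r\<^sup>2 * inner x x + inner (f (Suc t)) (f (Suc t)) + 4 * inner Z Z + inner (f (k - 1)) (f (k - 1))
      + 2 * (r * inner x (f (Suc t))) + 4 * (r * inner Z x) + 2 * (r * inner x (f (k - 1)))
      + 4 * inner Z (f (Suc t)) + 2 * inner (f (Suc t)) (f (k - 1)) + 4 * inner Z (f (k - 1))"
    unfolding w_def by (simp add: inner_add_left inner_add_right inner_commute power2_eq_square algebra_simps)
  ultimately show False
    using 1 2 3 4 5 r by linarith
qed

lemma path_no_branch_last:
  assumes x: "x \<in> B" "x \<notin> f ` {..<n}" "inner x x = 2 * s"
  shows "inner x (f (n - 1)) = 0"
proof (rule ccontr)
  assume nz: "inner x (f (n - 1)) \<noteq> 0"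
  have tn: "n - 1 < n" using path_k by simp
  have xf: "\<And>u. u < n \<Longrightarrow> x \<noteq> f u" using x by auto
  define Z where "Z = sum f {k..<n}"
  have "inner x (f (n - 1)) = - s"
    using inner_base_long[of "f (n - 1)" x] x path_base[OF tn] xf[OF tn] nz
    by (auto simp: inner_commute)
  then have 1: "inner Z x \<le> - s"
    unfolding Z_def using segment_inner_le[of k "n - 1" n x] path_k x xf by (simp add: inner_commute)
  have 3: "inner Z (f (k - 1)) \<le> - s"
    unfolding Z_def using segment_inner_le[of k k n "f (k - 1)"] path_k path_base path_eq_iff
      path_adjacent[of "k - 1"] by (simp add: inner_commute)
  have 4: "inner x (f (k - 1)) \<le> 0"
    using path_k path_base x xf[of "k - 1"] by (intro inner_base_le_0) auto
  have 5: "inner Z Z \<le> s" "inner (f (k - 1)) (f (k - 1)) = 2 * s"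
    using path_long path_k segment_short unfolding Z_def by auto
  \<comment> \<open>Marks of affine type C: 1 on the long roots at both ends, 2 on the short path
    between them.\<close>
  define w where "w = 2 *\<^sub>R Z + f (k - 1)"
  have "w \<in> span (B - {x})"
    unfolding w_def Z_def using path_k path_base xf
    by (intro span_add span_scale segment_span Real_Vector_Spaces.span_base) auto
  then have "inner (x + w) (x + w) > 0"
    using base_combination_pos[of x w 1] x by simp
  moreover have "inner (x + w) (x + w) =
      inner x x + 4 * inner Z Z + inner (f (k - 1)) (f (k - 1))
      + 4 * inner Z x + 2 * inner x (f (k - 1)) + 4 * inner Z (f (k - 1))"
    unfolding w_def by (simp add: inner_add_left inner_add_right inner_commute)
  ultimately show False
    using 1 3 4 5 x(3) by linarith
qed

text \<open>A chord closes a cycle. If its roots have one length, their sum has squared length at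
  most 0, as in affine type A; if both lengths occur, the cycle crosses between them at two bonds of
  value \<open>- s\<close>, which makes the squared length negative.\<close>

lemma path_nonadjacent:
  assumes tu: "Suc t < u" "u < n"
  shows "inner (f t) (f u) = 0"
proof (rule ccontr)
  assume nz: "inner (f t) (f u) \<noteq> 0"
  have tB: "f t \<in> B" "f u \<in> B" "f t \<noteq> f u"
    using tu path_base path_eq_iff by auto
  define Z where "Z = sum f {Suc t..<u}"
  have sums: "sum f {t..<u} = f t + Z"
    using tu by (simp add: Z_def sum.atLeast_Suc_lessThan)
  have Zu: "inner Z (f u) \<le> inner (f (u - 1)) (f u)"
    unfolding Z_def using tu path_base path_eq_iff by (intro segment_inner_le) auto
  have span: "sum f {t..<u} \<in> span (B - {f u})"
    using tu path_eq_iff by (intro segment_span) auto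
  have pos: "inner (f u + (f t + Z)) (f u + (f t + Z)) > 0"
    using base_combination_pos[OF tB(2) span, of 1] sums by simp
  have expand: "inner (f u + (f t + Z)) (f u + (f t + Z)) =
    inner (f u) (f u) + inner (f t + Z) (f t + Z) + 2 * inner (f t) (f u) + 2 * inner Z (f u)"
    by (simp add: inner_add_left inner_add_right inner_commute)
  consider "u < k" | "k \<le> t" | "t < k" "k \<le> u" by linarith
  then show False
  proof cases
    case 1
    then have "inner (f t + Z) (f t + Z) \<le> 2 * s" "inner (f u) (f u) = 2 * s"
      using segment_long[of t u] tu sums path_long by auto
    moreover have "inner (f t) (f u) = - s" "inner (f (u - 1)) (f u) = - s"
      using inner_base_long[OF tB] nz path_long 1 path_adjacent[of "u - 1"] tu by auto
    ultimately show False
      using pos expand Zu by linarith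
  next
    case 2
    then have "inner (f t + Z) (f t + Z) \<le> s" "inner (f u) (f u) = s"
      using segment_short[of t u] tu sums path_short by auto
    moreover have "inner (f t) (f u) = - (s / 2)" "inner (f (u - 1)) (f u) = - (s / 2)"
      using inner_base_short[OF tB] nz path_short 2 path_adjacent[of "u - 1"] tu by auto
    ultimately show False
      using pos expand Zu by linarith
  next
    case 3
    have tu_s: "inner (f t) (f u) = - s"
      using inner_base_eq[OF tB] nz path_long 3 s_pos by auto
    define X where "X = sum f {t..<k}"
    define Y where "Y = sum f {k..<Suc u}"
    have X: "inner X X \<le> 2 * s" and Y: "inner Y Y \<le> s"
      using segment_long[of t k] segment_short[of k "Suc u"] 3 tu by (auto simp: X_def Y_def)
    have Xj: "inner X (f j) \<le> inner (f i) (f j)" if "t \<le> i" "i < k" "k \<le> j" "j \<le> u" for i j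
      unfolding X_def using that tu path_base path_eq_iff path_k by (intro segment_inner_le) auto
    have kk: "inner (f (k - 1)) (f k) = - s"
      using path_adjacent[of "k - 1"] path_k by simp
    \<comment> \<open>The two crossing bonds are the double bond of the path and the chord; if
      \<open>u = k\<close>, both end in \<open>f k\<close>.\<close>
    have "inner X Y = (\<Sum>j\<in>{k..<Suc u}. inner X (f j))"
      unfolding Y_def by (rule inner_sum_right)
    also have "\<dots> \<le> - (2 * s)"
    proof (cases "u = k")
      case True
      then have "t < k - 1"
        using tu by simp
      then have "X = f t + sum f {Suc t..<k}"
        by (simp add: X_def sum.atLeast_Suc_lessThan)
      moreover have "inner (sum f {Suc t..<k}) (f k) \<le> inner (f (k - 1)) (f k)"
        using \<open>t < k - 1\<close> path_k path_base path_eq_iff by (intro segment_inner_le) auto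
      ultimately show ?thesis
        using True tu_s kk by (simp add: inner_add_left)
    next
      case False
      then have ku: "k < u"
        using 3 by simp
      have "(\<Sum>j\<in>{k..<Suc u}. inner X (f j)) =
          inner X (f k) + (inner X (f u) + (\<Sum>j\<in>{Suc k..<u}. inner X (f j)))"
        using ku by (subst sum.atLeast_Suc_lessThan) auto
      also have "\<dots> \<le> - s + (- s + 0)"
      proof (intro add_mono sum_nonpos)
        show "inner X (f k) \<le> - s"
          using Xj[of "k - 1" k] kk 3 by auto
        show "inner X (f u) \<le> - s"
          using Xj[of t u] tu_s 3 ku by auto
        fix j assume j: "j \<in> {Suc k..<u}"
        have "inner (f t) (f j) \<le> 0"
          using j 3 tu path_base path_eq_iff by (intro inner_base_le_0) auto
        then show "inner X (f j) \<le> 0"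
          using Xj[of t j] j 3 by auto
      qed
      finally show ?thesis by simp
    qed
    finally have "inner (X + Y) (X + Y) \<le> - s"
      using X Y by (simp add: inner_add_self)
    moreover have "X + Y = sum f {t..<Suc u}"
      unfolding X_def Y_def using 3 by (intro sum.atLeastLessThan_concat) auto
    then have "X + Y = f u + sum f {t..<u}"
      using tu by (simp add: add.commute)
    ultimately show False
      using pos sums s_pos by simp
  qed
qed

lemma path_inner:
  assumes "i < n" "j < n"
  shows "inner (f i) (f j) = (if i = j then if i < k then 2 * s else s
    else if j = Suc i then if i < k then - s else - (s / 2)
    else if i = Suc j then if j < k then - s else - (s / 2) else 0)"
proof -
  consider "i = j" | "j = Suc i" | "i = Suc j" | "Suc i < j" | "Suc j < i" by linarith
  then show ?thesis
    by cases (use assms path_long[of i] path_short[of i] path_adjacent[of i] path_adjacent[of j]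
      path_nonadjacent[of i j] path_nonadjacent[of j i] inner_commute[of "f i" "f j"] in auto)
qed

text \<open>Three long and two short roots would form affine F4, with marks 1, 2, 3, 4, 2; two long
  and three short ones would form twisted affine E6, with marks 1, 2, 3, 2, 1. The marks are the
  coefficients of a null vector.\<close>

lemma path_lengths: "k = 1 \<or> k = n - 1 \<or> k = 2 \<and> n = 4"
proof (rule ccontr)
  assume "\<not> ?thesis"
  then consider "k \<ge> 3" "k + 2 \<le> n" | "k \<ge> 2" "k + 3 \<le> n"
    using path_k by linarith
  then show False
  proof cases
    case 1
    obtain m where m: "k = m + 3"
      using 1 by (metis add.commute le_Suc_ex)
    define u where "u = (\<lambda>i. f (m + i))"
    have u: "inner (u i) (u j) = (if i = j then if i < 3 then 2 * s else s
      else if j = Suc i then if i < 3 then - s else - (s / 2)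
      else if i = Suc j then if j < 3 then - s else - (s / 2) else 0)" if "i < 5" "j < 5" for i j
      using that 1 path_inner[of "m + i" "m + j"] by (simp add: u_def m)
    have uB: "u i \<in> B" "i \<noteq> 0 \<Longrightarrow> u i \<noteq> u 0" if "i < 5" for i
      using that 1 path_base[of "m + i"] path_eq_iff[of "m + i" "m + 0"] by (simp_all add: u_def m)
    define w where "w = 2 *\<^sub>R u 1 + 3 *\<^sub>R u 2 + 4 *\<^sub>R u 3 + 2 *\<^sub>R u 4"
    have "w \<in> span (B - {u 0})"
      unfolding w_def using uB by (intro span_add span_scale Real_Vector_Spaces.span_base) auto
    then have "inner (u 0 + w) (u 0 + w) > 0"
      using base_combination_pos[of "u 0" w 1] uB by simp
    moreover have "inner (u 0 + w) (u 0 + w) = 0"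
      unfolding w_def by (simp add: inner_add_left inner_add_right u)
    ultimately show False by simp
  next
    case 2
    obtain m where m: "k = m + 2"
      using 2 by (metis add.commute le_Suc_ex)
    define u where "u = (\<lambda>i. f (m + i))"
    have u: "inner (u i) (u j) = (if i = j then if i < 2 then 2 * s else s
      else if j = Suc i then if i < 2 then - s else - (s / 2)
      else if i = Suc j then if j < 2 then - s else - (s / 2) else 0)" if "i < 5" "j < 5" for i j
      using that 2 path_inner[of "m + i" "m + j"] by (simp add: u_def m)
    have uB: "u i \<in> B" "i \<noteq> 0 \<Longrightarrow> u i \<noteq> u 0" if "i < 5" for i
      using that 2 path_base[of "m + i"] path_eq_iff[of "m + i" "m + 0"] by (simp_all add: u_def m)
    define w where "w = 2 *\<^sub>R u 1 + 3 *\<^sub>R u 2 + 2 *\<^sub>R u 3 + u 4"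
    have "w \<in> span (B - {u 0})"
      unfolding w_def using uB by (intro span_add span_scale Real_Vector_Spaces.span_base) auto
    then have "inner (u 0 + w) (u 0 + w) > 0"
      using base_combination_pos[of "u 0" w 1] uB by simp
    moreover have "inner (u 0 + w) (u 0 + w) = 0"
      unfolding w_def by (simp add: inner_add_left inner_add_right u)
    ultimately show False by simp
  qed
qed

end

section \<open>A longest path exhausts the base\<close>

lemma dynkin_path_le: "dynkin_path f k n \<Longrightarrow> n \<le> card B"
  using card_mono[OF finite_base, of "f ` {..<n}"] by (auto simp: dynkin_path_def card_image)

text \<open>The long simple roots form a nonempty proper part of the base, so connectedness yields
  an adjacent long and short root.\<close>

lemma ex_dynkin_path: "\<exists>f. dynkin_path f 1 2"
proof -
  define S where "S = {a \<in> B. inner a a = 2 * s}"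
  obtain b where b: "b \<in> B" "inner b b = s"
    using ex_short root_norm_in_base by metis
  have "S \<noteq> {}"
    using ex_long root_norm_in_base by (fastforce simp: S_def)
  moreover have "b \<notin> S"
    using b s_pos by (auto simp: S_def)
  then have "S \<noteq> B"
    using b by auto
  moreover have "S \<subseteq> B"
    by (auto simp: S_def)
  ultimately obtain x y where "x \<in> S" "y \<in> B - S" "inner x y \<noteq> 0"
    using base_connected by blast
  then have "x \<in> B" "y \<in> B" "inner x x = 2 * s" "inner y y = s" "inner x y \<noteq> 0"
    using base_norm by (auto simp: S_def)
  moreover from this have "x \<noteq> y"
    using s_pos by auto
  ultimately have "dynkin_path (\<lambda>i. if i = 0 then x else y) 1 2"
    by (auto simp: dynkin_path_def inj_on_def)
  then show ?thesis by blast
qed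

text \<open>Take a longest path. The branch lemmas allow an outside simple root to meet it only as a
  long root at the long end or a short root at the short end, and either would lengthen the path. So
  nothing outside meets it, and connectedness finishes.\<close>

theorem classification:
  obtains f k n where "dynkin_path f k n" "bij_betw f {..<n} B"
proof -
  have "\<exists>n. (\<exists>f k. dynkin_path f k n) \<and> (\<forall>m. (\<exists>f k. dynkin_path f k m) \<longrightarrow> m \<le> n)"
    using ex_dynkin_path dynkin_path_le
    by (intro ex_has_greatest_nat[of _ 2 _ "Suc (card B)"]) (auto simp: less_Suc_eq_le)
  then obtain n f k where path: "dynkin_path f k n"
    and max: "\<And>m g l. dynkin_path g l m \<Longrightarrow> m \<le> n" by blast
  note p = path_base[OF path] path_k[OF path] path_long[OF path] path_short[OF path]
    path_eq_iff[OF path] path_inner[OF path]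
  have "f ` {..<n} = B"
  proof (rule base_connected)
    show "f ` {..<n} \<subseteq> B" "f ` {..<n} \<noteq> {}"
      using p by auto
    fix y x assume "y \<in> f ` {..<n}" and x: "x \<in> B - f ` {..<n}"
    then obtain t where t: "t < n" "y = f t" by auto
    have "inner x (f t) = 0"
    proof (rule ccontr)
      assume nz: "inner x (f t) \<noteq> 0"
      have "t = 0 \<and> inner x x = 2 * s \<or> t = n - 1 \<and> inner x x = s"
      proof (cases "t < k")
        case True
        then show ?thesis
          using path_no_branch_long[OF path, of x t] path_no_branch_first[OF path, of x] x nz
            base_norm[of x] by auto
      next
        case False
        then show ?thesis
          using path_no_branch_short[OF path, of x t] path_no_branch_last[OF path, of x] x nz t
            base_norm[of x] by (cases "Suc t = n") auto
      qed
      then show False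
      proof
        assume *: "t = 0 \<and> inner x x = 2 * s"
        have "dynkin_path (case_nat x f) (Suc k) (Suc n)"
          using path x * nz p(1)
          by (auto simp: dynkin_path_def inj_on_def less_Suc_eq_0_disj split: nat.split)
        then show False
          using max by fastforce
      next
        assume *: "t = n - 1 \<and> inner x x = s"
        have "inj_on (f(n := x)) {..<Suc n}" "(f(n := x)) ` {..<Suc n} \<subseteq> B"
          using path x by (auto simp: dynkin_path_def inj_on_def less_Suc_eq)
        moreover have "inner ((f(n := x)) i) ((f(n := x)) (Suc i)) \<noteq> 0" if "Suc i < Suc n" for i
          using path * nz that by (cases "Suc i = n") (auto simp: dynkin_path_def inner_commute)
        ultimately have "dynkin_path (f(n := x)) k (Suc n)"
          using path * by (simp add: dynkin_path_def less_Suc_eq)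
        then show False
          using max by fastforce
      qed
    qed
    then show "inner y x = 0"
      using t by (simp add: inner_commute)
  qed
  then have "bij_betw f {..<n} B"
    using path by (auto simp: bij_betw_def dynkin_path_def)
  then show ?thesis
    using that path by blast
qed

end

subsection \<open>Coordinates along the Dynkin path and type B\<close>

locale laced_path = doubly_laced_base +
  fixes f :: "nat \<Rightarrow> 'a" and k n :: nat
  assumes path: "dynkin_path f k n" and bij: "bij_betw f {..<n} B"
begin

lemmas f_base = path_base[OF path] and k_bounds = path_k[OF path] and f_inner = path_inner[OF path]

lemma f_root: "i < n \<Longrightarrow> f i \<in> \<Delta>"
  using f_base base_subset by auto

text \<open>Integer coordinates along the path turn the root order into a coordinatewise comparison
  (\<open>root_le_comb\<close>) and leave room for negative roots.\<close>

definition comb :: "(nat \<Rightarrow> int) \<Rightarrow> 'a" where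
  "comb x = (\<Sum>i<n. real_of_int (x i) *\<^sub>R f i)"

lemma sum_path_eqD:
  assumes "(\<Sum>i<n. u i *\<^sub>R f i) = (\<Sum>i<n. v i *\<^sub>R f i)" "i < n"
  shows "u i = v i"
proof -
  let ?g = "the_inv_into {..<n} f"
  have g: "?g (f i) = i" if "i < n" for i
    using bij that by (auto simp: bij_betw_def the_inv_into_f_f)
  have "(\<Sum>a\<in>B. w (?g a) *\<^sub>R a) = (\<Sum>i<n. w i *\<^sub>R f i)" for w :: "nat \<Rightarrow> real"
    using sum.reindex_bij_betw[OF bij, of "\<lambda>a. w (?g a) *\<^sub>R a"] g by simp
  then have "u (?g (f i)) = v (?g (f i))"
    using assms sum_base_eqD[of "\<lambda>a. u (?g a)" "\<lambda>a. v (?g a)" "f i"] f_base by simp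
  then show ?thesis
    using g assms(2) by simp
qed

lemma comb_eqD: "comb x = comb y \<Longrightarrow> i < n \<Longrightarrow> x i = y i"
  unfolding comb_def using sum_path_eqD[of "\<lambda>i. real_of_int (x i)" "\<lambda>i. real_of_int (y i)" i] by simp

lemma root_le_comb: "root_le B (comb x) (comb y) \<longleftrightarrow> (\<forall>i<n. x i \<le> y i)"
proof
  assume "root_le B (comb x) (comb y)"
  then obtain m :: "'a \<Rightarrow> nat" where "comb y - comb x = (\<Sum>a\<in>B. real (m a) *\<^sub>R a)"
    by (auto simp: root_le_def)
  also have "\<dots> = (\<Sum>i<n. real (m (f i)) *\<^sub>R f i)"
    using sum.reindex_bij_betw[OF bij, of "\<lambda>a. real (m a) *\<^sub>R a"] by simp
  finally have "(\<Sum>i<n. (real_of_int (y i) - real_of_int (x i)) *\<^sub>R f i) = (\<Sum>i<n. real (m (f i)) *\<^sub>R f i)"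
    by (simp add: comb_def scaleR_left_diff_distrib sum_subtractf)
  from sum_path_eqD[OF this] have "real_of_int (y i) - real_of_int (x i) \<ge> 0" if "i < n" for i
    using that by simp
  then show "\<forall>i<n. x i \<le> y i"
    by simp
next
  assume le: "\<forall>i<n. x i \<le> y i"
  let ?g = "the_inv_into {..<n} f"
  have g: "?g (f i) = i" if "i < n" for i
    using bij that by (auto simp: bij_betw_def the_inv_into_f_f)
  have "(\<Sum>a\<in>B. real (nat (y (?g a) - x (?g a))) *\<^sub>R a) = (\<Sum>i<n. real (nat (y i - x i)) *\<^sub>R f i)"
    using sum.reindex_bij_betw[OF bij, of "\<lambda>a. real (nat (y (?g a) - x (?g a))) *\<^sub>R a"] g by simp
  also have "\<dots> = comb y - comb x"
    using le unfolding comb_def sum_subtractf[symmetric]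
    by (intro sum.cong) (auto simp: scaleR_left_diff_distrib)
  finally show "root_le B (comb x) (comb y)"
    unfolding root_le_def by (intro exI[of _ "\<lambda>a. nat (y (?g a) - x (?g a))"]) simp
qed

lemma comb_positive_iff: "comb x \<in> positive_roots \<Delta> B \<longleftrightarrow> comb x \<in> \<Delta> \<and> (\<forall>i<n. 0 \<le> x i)"
  using root_le_comb[of "\<lambda>_. 0" x] by (simp add: positive_roots_def comb_def)

lemma comb_add: "comb x + comb y = comb (\<lambda>i. x i + y i)"
  by (simp add: comb_def scaleR_left_distrib sum.distrib)

lemma comb_uminus: "- comb x = comb (\<lambda>i. - x i)"
  by (simp add: comb_def sum_negf)

lemma comb_unit: "j < n \<Longrightarrow> f j = comb (\<lambda>i. if i = j then 1 else 0)"
  by (simp add: comb_def if_distrib[of "\<lambda>x. x *\<^sub>R _"] if_distrib[of real_of_int] cong: if_cong)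

lemma short_roots_eq: "short_roots \<Delta> = {a \<in> \<Delta>. inner a a = s}"
proof (intro Set.set_eqI iffI)
  fix a assume "a \<in> short_roots \<Delta>"
  then obtain b where "a \<in> \<Delta>" "b \<in> \<Delta>" "inner a a < inner b b"
    by (auto simp: short_roots_def norm_lt)
  then show "a \<in> {a \<in> \<Delta>. inner a a = s}"
    using root_norm[of a] root_norm[of b] s_pos by auto
next
  fix a assume "a \<in> {a \<in> \<Delta>. inner a a = s}"
  moreover obtain b where "b \<in> \<Delta>" "inner b b = 2 * s"
    using ex_long by auto
  ultimately show "a \<in> short_roots \<Delta>"
    using s_pos by (auto simp: short_roots_def norm_lt intro!: bexI[of _ b])
qed

text \<open>For a dominant root \<open>\<theta>'\<close> the difference
  \<open>\<theta> - \<theta>'\<close>, a nonnegative combination, has nonnegative inner product with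
  \<open>\<theta>'\<close>. As \<open>\<theta>'\<close> already has maximal length, the difference
  vanishes.\<close>

lemma highest_root_eqI:
  assumes \<theta>: "highest_root \<Delta> B \<theta>"
    and \<theta>': "\<theta>' \<in> positive_roots \<Delta> B" "inner \<theta>' \<theta>' = 2 * s" "\<And>i. i < n \<Longrightarrow> inner \<theta>' (f i) \<ge> 0"
  shows "\<theta> = \<theta>'"
proof -
  obtain m :: "'a \<Rightarrow> nat" where m: "\<theta> - \<theta>' = (\<Sum>a\<in>B. real (m a) *\<^sub>R a)"
    using \<theta> \<theta>'(1) by (auto simp: highest_root_def root_le_def)
  have "inner \<theta>' (\<theta> - \<theta>') = (\<Sum>a\<in>B. real (m a) * inner \<theta>' a)"
    by (simp add: m inner_sum_right)
  also have "\<dots> \<ge> 0"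
    using bij \<theta>'(3) by (intro sum_nonneg) (auto simp: bij_betw_def)
  finally have nonneg: "inner \<theta>' (\<theta> - \<theta>') \<ge> 0" .
  have "inner \<theta> \<theta> = inner \<theta>' \<theta>' + inner (\<theta> - \<theta>') (\<theta> - \<theta>') + 2 * inner \<theta>' (\<theta> - \<theta>')"
    using inner_add_self[of \<theta>' "\<theta> - \<theta>'"] by simp
  moreover have "inner \<theta> \<theta> \<le> 2 * s"
    using \<theta> root_norm[of \<theta>] s_pos by (auto simp: highest_root_def positive_roots_def)
  ultimately have "inner (\<theta> - \<theta>') (\<theta> - \<theta>') \<le> 0"
    using \<theta>'(2) nonneg by linarith
  then show ?thesis
    by (metis eq_iff_diff_eq_0 inner_ge_zero inner_eq_zero_iff order_antisym)
qed

text \<open>Every short root arises from a short simple root by simple reflections, since these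
  preserve length. Applied to explicit sets, this lists the short roots of each type.\<close>

lemma short_root_in:
  assumes "a \<in> \<Delta>" "inner a a = s"
    and "\<And>i. k \<le> i \<Longrightarrow> i < n \<Longrightarrow> f i \<in> X"
    and "\<And>i v. i < n \<Longrightarrow> v \<in> X \<Longrightarrow> reflection (f i) v \<in> X"
  shows "a \<in> X"
proof -
  have B: "\<exists>i<n. b = f i" if "b \<in> B" for b
    using bij that by (auto simp: bij_betw_def)
  have "inner a a = s \<longrightarrow> a \<in> X"
    using assms(1)
  proof (rule root_induct)
    fix b assume "b \<in> B"
    then obtain i where "i < n" "b = f i"
      using B by blast
    then show "inner b b = s \<longrightarrow> b \<in> X"
      using assms(3)[of i] path_long[OF path, of i] s_pos by (cases "k \<le> i") auto
  next
    fix b \<gamma> assume "b \<in> B" "inner \<gamma> \<gamma> = s \<longrightarrow> \<gamma> \<in> X"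
    then show "inner (reflection b \<gamma>) (reflection b \<gamma>) = s \<longrightarrow> reflection b \<gamma> \<in> X"
      using assms(4) B[of b] base_nonzero by (auto simp: inner_reflection)
  qed
  then show ?thesis
    using assms(2) by simp
qed

lemma card_short_antichains:
  assumes \<phi>: "bij_betw \<phi> X (positive_roots \<Delta> B \<inter> short_roots \<Delta>)"
    and R: "\<And>x y. x \<in> X \<Longrightarrow> y \<in> X \<Longrightarrow> root_le B (\<phi> x) (\<phi> y) \<longleftrightarrow> R x y"
  shows "card (short_antichains \<Delta> B) = card {A. A \<subseteq> X \<and> (\<forall>x\<in>A. \<forall>y\<in>A. x \<noteq> y \<longrightarrow> \<not> R x y)}"
proof -
  have inj: "inj_on \<phi> X" and im: "\<phi> ` X = positive_roots \<Delta> B \<inter> short_roots \<Delta>"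
    using \<phi> by (auto simp: bij_betw_def)
  have "(\<forall>\<mu>\<in>\<phi> ` A. \<forall>\<gamma>\<in>\<phi> ` A. \<mu> \<noteq> \<gamma> \<longrightarrow> \<not> root_le B \<mu> \<gamma>) \<longleftrightarrow>
      (\<forall>x\<in>A. \<forall>y\<in>A. x \<noteq> y \<longrightarrow> \<not> R x y)" if "A \<subseteq> X" for A
    using that R inj by (auto simp: inj_on_def subset_iff) blast+
  moreover have "short_antichains \<Delta> B = (`) \<phi> ` {A. A \<subseteq> X \<and>
      (\<forall>\<mu>\<in>\<phi> ` A. \<forall>\<gamma>\<in>\<phi> ` A. \<mu> \<noteq> \<gamma> \<longrightarrow> \<not> root_le B \<mu> \<gamma>)}"
  proof (intro Set.set_eqI iffI)
    fix C assume "C \<in> short_antichains \<Delta> B"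
    then have C: "C \<subseteq> \<phi> ` X" "\<forall>\<mu>\<in>C. \<forall>\<gamma>\<in>C. \<mu> \<noteq> \<gamma> \<longrightarrow> \<not> root_le B \<mu> \<gamma>"
      by (auto simp: short_antichains_def root_antichain_def im)
    then obtain A where "A \<subseteq> X" "C = \<phi> ` A"
      by (metis subset_imageE)
    then show "C \<in> (`) \<phi> ` {A. A \<subseteq> X \<and>
      (\<forall>\<mu>\<in>\<phi> ` A. \<forall>\<gamma>\<in>\<phi> ` A. \<mu> \<noteq> \<gamma> \<longrightarrow> \<not> root_le B \<mu> \<gamma>)}"
      using C by blast
  next
    fix C assume "C \<in> (`) \<phi> ` {A. A \<subseteq> X \<and>
      (\<forall>\<mu>\<in>\<phi> ` A. \<forall>\<gamma>\<in>\<phi> ` A. \<mu> \<noteq> \<gamma> \<longrightarrow> \<not> root_le B \<mu> \<gamma>)}"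
    then show "C \<in> short_antichains \<Delta> B"
      using im unfolding short_antichains_def root_antichain_def by blast
  qed
  ultimately have "short_antichains \<Delta> B = (`) \<phi> ` {A. A \<subseteq> X \<and> (\<forall>x\<in>A. \<forall>y\<in>A. x \<noteq> y \<longrightarrow> \<not> R x y)}"
    by (simp cong: conj_cong)
  moreover have "inj_on ((`) \<phi>) {A. A \<subseteq> X \<and> (\<forall>x\<in>A. \<forall>y\<in>A. x \<noteq> y \<longrightarrow> \<not> R x y)}"
    using inj_on_image_Pow[OF inj] by (rule inj_on_subset) auto
  ultimately show ?thesis
    by (simp add: card_image)
qed

text \<open>Translates \<open>g\<close> into path coordinates: coefficients over the base do not
  depend on its enumeration, and the short simple roots are \<open>f k\<close>, ...,
  \<open>f (n - 1)\<close>.\<close>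

lemma sum_short_coefficients:
  assumes \<alpha>: "bij_betw \<alpha> {..<p} B"
    and eq: "(\<Sum>i<p. real (c i) *\<^sub>R \<alpha> i) = comb (\<lambda>i. int (d i))"
  shows "(\<Sum>i | i < p \<and> \<alpha> i \<in> short_roots \<Delta>. c i) = (\<Sum>i=k..<n. d i)"
proof -
  let ?a = "the_inv_into {..<p} \<alpha>" and ?g = "the_inv_into {..<n} f"
  have a: "?a (\<alpha> i) = i" if "i < p" for i
    using \<alpha> that by (auto simp: bij_betw_def the_inv_into_f_f)
  have g: "?g (f i) = i" if "i < n" for i
    using bij that by (auto simp: bij_betw_def the_inv_into_f_f)
  have "(\<Sum>b\<in>B. real (c (?a b)) *\<^sub>R b) = (\<Sum>b\<in>B. real (d (?g b)) *\<^sub>R b)"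
    using sum.reindex_bij_betw[OF \<alpha>, of "\<lambda>b. real (c (?a b)) *\<^sub>R b"] a eq
      sum.reindex_bij_betw[OF bij, of "\<lambda>b. real (d (?g b)) *\<^sub>R b"] g
    by (simp add: comb_def)
  from sum_base_eqD[OF this] have cd: "c (?a b) = d (?g b)" if "b \<in> B" for b
    using that by simp
  let ?S = "B \<inter> short_roots \<Delta>"
  have "bij_betw \<alpha> {i. i < p \<and> \<alpha> i \<in> short_roots \<Delta>} ?S"
    using \<alpha> by (auto simp: bij_betw_def inj_on_def image_iff)
  from sum.reindex_bij_betw[OF this, of "\<lambda>b. c (?a b)"]
  have 1: "(\<Sum>i | i < p \<and> \<alpha> i \<in> short_roots \<Delta>. c i) = (\<Sum>b\<in>?S. c (?a b))"
    using a by (metis (no_types, lifting) mem_Collect_eq sum.cong)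
  have short: "f i \<in> short_roots \<Delta> \<longleftrightarrow> k \<le> i" if "i < n" for i
    using that f_root[OF that] f_inner[OF that that] s_pos by (auto simp: short_roots_eq)
  have "f ` {k..<n} = ?S"
  proof (intro Set.set_eqI iffI)
    fix b assume "b \<in> ?S"
    then obtain i where "i < n" "b = f i" "f i \<in> short_roots \<Delta>"
      using bij by (auto simp: bij_betw_def)
    then show "b \<in> f ` {k..<n}"
      using short by auto
  qed (use short f_base in auto)
  then have "bij_betw f {k..<n} ?S"
    using bij by (auto simp: bij_betw_def inj_on_def)
  from sum.reindex_bij_betw[OF this, of "\<lambda>b. d (?g b)"]
  have 2: "(\<Sum>b\<in>?S. d (?g b)) = (\<Sum>i=k..<n. d i)"
    using g by simp
  show ?thesis
    unfolding 1 2[symmetric] using cd by (intro sum.cong) auto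
qed

end

section \<open>Type B: coordinates, short antichains and highest root\<close>

locale type_B = laced_path +
  assumes k_B: "k = n - 1"
begin

text \<open>The standard orthogonal coordinates of type B: \<open>f i\<close> is the difference of
  consecutive ones, and the last simple root is the last coordinate.\<close>

definition \<epsilon> :: "nat \<Rightarrow> 'a" where
  "\<epsilon> i = (\<Sum>t=i..<n. f t)"

lemma \<epsilon>_rec: "i < n \<Longrightarrow> \<epsilon> i = f i + \<epsilon> (Suc i)"
  by (simp add: \<epsilon>_def sum.atLeast_Suc_lessThan)

lemma \<epsilon>_last: "\<epsilon> (n - 1) = f (n - 1)"
  using k_bounds \<epsilon>_rec[of "n - 1"] by (simp add: \<epsilon>_def)

lemma \<epsilon>_comb: "\<epsilon> i = comb (\<lambda>t. if i \<le> t then 1 else 0)"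
proof -
  have "{..<n} \<inter> {t. i \<le> t} = {i..<n}"
    by auto
  then show ?thesis
    by (simp add: \<epsilon>_def comb_def if_distrib[of "\<lambda>x. x *\<^sub>R _"] if_distrib[of real_of_int] sum.If_cases cong: if_cong)
qed

lemma \<epsilon>_inner:
  assumes "j \<le> n - 1" "i < n"
  shows "inner (\<epsilon> j) (f i) = (if i = j then s else if j = Suc i then - s else 0)"
  using assms(1)
proof (induction rule: inc_induct)
  case base
  then show ?case
    using assms(2) k_B k_bounds \<epsilon>_last f_inner[of "n - 1" i] by auto
next
  case (step j)
  then have "j < n" by simp
  then show ?case
    using step assms(2) k_B by (auto simp: \<epsilon>_rec inner_add_left f_inner)
qed

lemma \<epsilon>_norm:
  assumes "j < n"
  shows "inner (\<epsilon> j) (\<epsilon> j) = s"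
proof -
  have "inner (\<epsilon> j) (\<epsilon> j) = (\<Sum>t=j..<n. inner (\<epsilon> j) (f t))"
    by (subst (2) \<epsilon>_def) (rule inner_sum_right)
  also have "\<dots> = (\<Sum>t=j..<n. if t = j then s else 0)"
    using assms by (intro sum.cong) (auto simp: \<epsilon>_inner)
  finally show ?thesis
    using assms by simp
qed

text \<open>The simple reflections are signed permutations: adjacent transpositions, and a sign
  change for the last one.\<close>

lemma reflection_\<epsilon>:
  assumes "j < n" "i < n"
  shows "reflection (f i) (\<epsilon> j) = (if i = j then if j = n - 1 then - \<epsilon> j else \<epsilon> (Suc j)
    else if j = Suc i then \<epsilon> i else \<epsilon> j)"
proof -
  have "j \<le> n - 1" using assms by simp
  then have inner: "inner (\<epsilon> j) (f i) = (if i = j then s else if j = Suc i then - s else 0)"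
    using \<epsilon>_inner assms by simp
  consider "i = j" "j = n - 1" | "i = j" "j < n - 1" | "j = Suc i" | "i \<noteq> j" "j \<noteq> Suc i"
    using assms by linarith
  then show ?thesis
  proof cases
    case 1
    then show ?thesis
      using inner assms s_pos k_B f_inner[of j j] \<epsilon>_last by (simp add: reflection_def scaleR_2)
  next
    case 2
    then show ?thesis
      using inner assms s_pos k_B f_inner[of j j] \<epsilon>_rec[of j] by (simp add: reflection_def)
  next
    case 3
    then show ?thesis
      using inner assms s_pos k_B f_inner[of i i] \<epsilon>_rec[of i] by (simp add: reflection_def less_diff_conv)
  next
    case 4
    then show ?thesis
      using inner by (auto simp: reflection_def)
  qed
qed

lemma \<epsilon>_root:
  assumes "j \<le> n - 1"
  shows "\<epsilon> j \<in> \<Delta>"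
  using assms
proof (induction rule: inc_induct)
  case base
  then show ?case
    using f_root[of "n - 1"] k_bounds \<epsilon>_last by simp
next
  case (step j)
  then have "\<epsilon> j = reflection (f j) (\<epsilon> (Suc j))"
    by (simp add: reflection_\<epsilon>)
  then show ?case
    using step f_root reflection_root by simp
qed

lemma positive_short_roots: "bij_betw \<epsilon> {..<n} (positive_roots \<Delta> B \<inter> short_roots \<Delta>)"
  unfolding bij_betw_def
proof
  show "inj_on \<epsilon> {..<n}"
  proof (rule inj_onI)
    fix i j assume ij: "i \<in> {..<n}" "j \<in> {..<n}" "\<epsilon> i = \<epsilon> j"
    then have "(if i \<le> t then 1 else 0 :: int) = (if j \<le> t then 1 else 0)" if "t < n" for t
      using comb_eqD[of "\<lambda>t. if i \<le> t then 1 else 0" "\<lambda>t. if j \<le> t then 1 else 0" t] that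
      by (simp add: \<epsilon>_comb)
    from this[of i] this[of j] show "i = j"
      using ij by (auto split: if_splits)
  qed
  show "\<epsilon> ` {..<n} = positive_roots \<Delta> B \<inter> short_roots \<Delta>"
  proof (intro Set.set_eqI iffI)
    fix a assume "a \<in> \<epsilon> ` {..<n}"
    then obtain i where "i < n" "a = \<epsilon> i" by auto
    then show "a \<in> positive_roots \<Delta> B \<inter> short_roots \<Delta>"
      using \<epsilon>_root[of i] \<epsilon>_norm[of i] comb_positive_iff[of "\<lambda>t. if i \<le> t then 1 else 0"]
      by (simp add: short_roots_eq \<epsilon>_comb)
  next
    fix a assume a: "a \<in> positive_roots \<Delta> B \<inter> short_roots \<Delta>"
    define X where "X = \<epsilon> ` {..<n} \<union> uminus ` \<epsilon> ` {..<n}"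
    have "a \<in> X"
    proof (rule short_root_in)
      show "a \<in> \<Delta>" "inner a a = s"
        using a by (auto simp: short_roots_eq)
      fix i assume "k \<le> i" "i < n"
      then have "f i = \<epsilon> i"
        using k_B \<epsilon>_last by (metis Suc_diff_1 less_Suc_eq_le less_nat_zero_code not_gr0 order_antisym)
      then show "f i \<in> X"
        using \<open>i < n\<close> by (auto simp: X_def)
    next
      fix i v assume i: "i < n" "v \<in> X"
      then obtain j where "j < n" "v = \<epsilon> j \<or> v = - \<epsilon> j"
        by (auto simp: X_def)
      moreover from this have "reflection (f i) (\<epsilon> j) \<in> X" "- reflection (f i) (\<epsilon> j) \<in> X"
        using reflection_\<epsilon>[of j i] i(1) by (auto simp: X_def)
      ultimately show "reflection (f i) v \<in> X"
        by (auto simp: reflection_uminus)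
    qed
    moreover have "- \<epsilon> i \<notin> positive_roots \<Delta> B" if "i < n" for i
      using that comb_positive_iff[of "\<lambda>t. - (if i \<le> t then 1 else 0)"] unfolding \<epsilon>_comb comb_uminus
      by (auto intro!: exI[of _ i])
    ultimately show "a \<in> \<epsilon> ` {..<n}"
      using a by (auto simp: X_def)
  qed
qed

text \<open>A chain has only the empty antichain and its singletons. A larger index means a lower
  root, hence the reversed comparison.\<close>

lemma card_short_antichains_B: "card (short_antichains \<Delta> B) = n + 1"
proof -
  have "{A. A \<subseteq> {..<n} \<and> (\<forall>x\<in>A. \<forall>y\<in>A. x \<noteq> y \<longrightarrow> \<not> y \<le> x)} = insert {} ((\<lambda>i. {i}) ` {..<n})"
  proof (intro Set.set_eqI iffI)
    fix A assume "A \<in> {A. A \<subseteq> {..<n} \<and> (\<forall>x\<in>A. \<forall>y\<in>A. x \<noteq> y \<longrightarrow> \<not> y \<le> x)}"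
    then have A: "A \<subseteq> {..<n}" "\<And>x y. x \<in> A \<Longrightarrow> y \<in> A \<Longrightarrow> x = y"
      by (auto dest: le_cases) (metis nat_le_linear)
    then show "A \<in> insert {} ((\<lambda>i. {i}) ` {..<n})"
      by (cases "A = {}") blast+
  qed auto
  moreover have "root_le B (\<epsilon> i) (\<epsilon> j) \<longleftrightarrow> j \<le> i" if "i \<in> {..<n}" "j \<in> {..<n}" for i j
    using that unfolding \<epsilon>_comb root_le_comb by (auto dest: spec[of _ i])
  ultimately show ?thesis
    using card_short_antichains[OF positive_short_roots, of "\<lambda>i j. j \<le> i"]
    by (simp add: card_image inj_on_def image_iff)
qed

lemma highest_root_B:
  assumes "highest_root \<Delta> B \<theta>"
  shows "\<theta> = comb (\<lambda>t. int (if t = 0 then 1 else 2))"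
proof -
  have n2: "n \<ge> 2" "0 < n - 1"
    using k_bounds k_B by auto
  \<comment> \<open>This is \<open>\<epsilon> 0 + \<epsilon> 1\<close>, because \<open>f 0\<close>
    is \<open>\<epsilon> 0 - \<epsilon> 1\<close>; the reflection below exhibits it as a
    root.\<close>
  define \<theta>' where "\<theta>' = f 0 + 2 *\<^sub>R \<epsilon> 1"
  have refl: "\<theta>' = reflection (\<epsilon> 1) (f 0)"
    using \<epsilon>_inner[of 1 0] \<epsilon>_norm[of 1] n2 s_pos
    by (simp add: \<theta>'_def reflection_def inner_commute)
  have "2 *\<^sub>R comb x = comb (\<lambda>i. 2 * x i)" for x
    by (simp add: comb_def scaleR_sum_right)
  then have comb: "\<theta>' = comb (\<lambda>t. int (if t = 0 then 1 else 2))"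
    using n2 by (simp add: \<theta>'_def comb_unit \<epsilon>_comb comb_add)
      (auto simp: comb_def intro!: sum.cong)
  have root: "\<theta>' \<in> \<Delta>"
    unfolding refl using \<epsilon>_root[of 1] f_root[of 0] n2 by (intro reflection_root) auto
  have "\<theta> = \<theta>'"
  proof (rule highest_root_eqI[OF assms])
    show "\<theta>' \<in> positive_roots \<Delta> B"
      using root unfolding comb comb_positive_iff by simp
    have "1 \<le> n - 1"
      using n2 by simp
    then have "\<epsilon> 1 \<noteq> 0"
      using \<epsilon>_root[of 1] zero_not_root by metis
    then show "inner \<theta>' \<theta>' = 2 * s"
      unfolding refl using f_inner[of 0 0] k_bounds by (simp add: inner_reflection)
    fix i assume "i < n"
    then show "inner \<theta>' (f i) \<ge> 0"
      using n2 s_pos \<epsilon>_inner[of 1 i] f_inner[of 0 i] k_B by (auto simp: \<theta>'_def inner_add_left)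
  qed
  then show ?thesis
    using comb by simp
qed

end

subsection \<open>Type C\<close>

text \<open>The pair \<open>(i, j)\<close> will stand for the short root \<open>E i - E j\<close> of
  type C; a higher root has larger \<open>i\<close> and smaller \<open>j\<close>. The bound
  \<open>b\<close> serves the recursion over the last row: an element there in column
  \<open>j\<close> forces all others into columns below \<open>j\<close>.\<close>

definition staircase_antichains :: "nat \<Rightarrow> int \<Rightarrow> (nat \<times> int) set set" where
  "staircase_antichains n b = {A. A \<subseteq> {(i, j). 1 \<le> i \<and> i \<le> n \<and> - int i \<le> j \<and> j < int i \<and> j < b} \<and>
     (\<forall>x\<in>A. \<forall>y\<in>A. x \<noteq> y \<longrightarrow> \<not> (fst x \<le> fst y \<and> snd y \<le> snd x))}"

lemma finite_staircase_antichains: "finite (staircase_antichains n b)"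
proof -
  have "{(i, j). 1 \<le> i \<and> i \<le> n \<and> - int i \<le> j \<and> j < int i \<and> j < b} \<subseteq> {..n} \<times> {- int n..int n}"
    by auto
  then have "finite {(i, j). 1 \<le> i \<and> i \<le> n \<and> - int i \<le> j \<and> j < int i \<and> j < b}"
    by (rule finite_subset) auto
  then show ?thesis
    unfolding staircase_antichains_def by (rule finite_subset[rotated, OF finite_Pow_iff[THEN iffD2]]) auto
qed

lemma staircase_antichains_trivial: "b \<le> - int n \<Longrightarrow> staircase_antichains n b = {{}}"
  unfolding staircase_antichains_def by force

text \<open>Row \<open>n\<close> ends at column \<open>n - 1\<close>, so a larger bound has no
  effect.\<close>

lemma staircase_antichains_cap: "b \<ge> int n \<Longrightarrow> staircase_antichains n b = staircase_antichains n (int n)"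
  unfolding staircase_antichains_def by (intro Collect_cong conj_cong) force+

lemma staircase_antichains_subset:
  assumes "A \<in> staircase_antichains n b" "A' \<subseteq> A" "\<And>i j. (i, j) \<in> A' \<Longrightarrow> i \<le> m \<and> j < c"
  shows "A' \<in> staircase_antichains m c"
proof -
  have "A \<subseteq> {(i, j). 1 \<le> i \<and> i \<le> n \<and> - int i \<le> j \<and> j < int i \<and> j < b}"
    and anti: "\<forall>x\<in>A. \<forall>y\<in>A. x \<noteq> y \<longrightarrow> \<not> (fst x \<le> fst y \<and> snd y \<le> snd x)"
    using assms(1) unfolding staircase_antichains_def by auto
  then have "A' \<subseteq> {(i, j). 1 \<le> i \<and> i \<le> m \<and> - int i \<le> j \<and> j < int i \<and> j < c}"
    using assms(2,3) by auto
  moreover have "\<forall>x\<in>A'. \<forall>y\<in>A'. x \<noteq> y \<longrightarrow> \<not> (fst x \<le> fst y \<and> snd y \<le> snd x)"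
    using anti assms(2) by (meson subsetD)
  ultimately show ?thesis
    unfolding staircase_antichains_def by blast
qed

text \<open>The elements of an antichain move strictly to the right from row to row, so the last row
  holds at most one. The hypothesis on \<open>b\<close> keeps that element inside the
  staircase.\<close>

lemma staircase_antichains_Suc:
  assumes "b \<le> int (Suc n)"
  shows "staircase_antichains (Suc n) b = staircase_antichains n b \<union>
    (\<Union>j\<in>{- int (Suc n)..<b}. insert (Suc n, j) ` staircase_antichains n j)" (is "?L = ?R")
proof (intro Set.set_eqI iffI)
  fix A assume A: "A \<in> ?L"
  show "A \<in> ?R"
  proof (cases "\<exists>j. (Suc n, j) \<in> A")
    case False
    have "i \<le> n \<and> j < b" if "(i, j) \<in> A" for i j
    proof -
      have "i \<le> Suc n \<and> j < b"
        using A that unfolding staircase_antichains_def by auto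
      then show ?thesis
        using False that by (metis le_Suc_eq)
    qed
    then have "A \<in> staircase_antichains n b"
      using staircase_antichains_subset[OF A] by blast
    then show ?thesis by blast
  next
    case True
    then obtain j where j: "(Suc n, j) \<in> A" by blast
    have sub: "1 \<le> i" "i \<le> Suc n" "- int i \<le> l" "l < int i" "l < b" if "(i, l) \<in> A" for i l
      using A that unfolding staircase_antichains_def by auto
    have anti: "\<not> (i \<le> i' \<and> l' \<le> l)" if "(i, l) \<in> A" "(i', l') \<in> A" "(i, l) \<noteq> (i', l')" for i l i' l'
      using A that unfolding staircase_antichains_def by fastforce
    have "i \<le> n \<and> l < j" if "(i, l) \<in> A - {(Suc n, j)}" for i l
      using sub[of i l] anti[of i l "Suc n" j] anti[of "Suc n" j i l] that j by auto
    then have "A - {(Suc n, j)} \<in> staircase_antichains n j"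
      by (intro staircase_antichains_subset[OF A]) auto
    moreover have "A = insert (Suc n, j) (A - {(Suc n, j)})"
      using j by blast
    ultimately have "A \<in> insert (Suc n, j) ` staircase_antichains n j"
      by (rule rev_image_eqI)
    then show ?thesis
      using sub[OF j] by (intro UnI2 UN_I[of j]) auto
  qed
next
  fix A assume "A \<in> ?R"
  then consider "A \<in> staircase_antichains n b"
    | j A' where "- int (Suc n) \<le> j" "j < b" "A' \<in> staircase_antichains n j" "A = insert (Suc n, j) A'"
    by auto
  then show "A \<in> ?L"
  proof cases
    case 1
    have "i \<le> Suc n \<and> j < b" if "(i, j) \<in> A" for i j
      using 1 that unfolding staircase_antichains_def by auto
    then show ?thesis
      by (intro staircase_antichains_subset[OF 1]) auto
  next
    case 2
    then have sub: "1 \<le> i" "i \<le> n" "- int i \<le> l" "l < int i" "l < j" if "(i, l) \<in> A'" for i l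
      using that unfolding staircase_antichains_def by auto
    have anti: "\<not> (i \<le> i' \<and> l' \<le> l)" if "(i, l) \<in> A'" "(i', l') \<in> A'" "(i, l) \<noteq> (i', l')" for i l i' l'
    proof -
      have "\<forall>x\<in>A'. \<forall>y\<in>A'. x \<noteq> y \<longrightarrow> \<not> (fst x \<le> fst y \<and> snd y \<le> snd x)"
        using 2(3) unfolding staircase_antichains_def by blast
      from bspec[OF bspec[OF this that(1)] that(2)] show ?thesis
        using that(3) by simp
    qed
    have "\<not> (fst x \<le> fst y \<and> snd y \<le> snd x)" if "x \<in> A" "y \<in> A" "x \<noteq> y" for x y
    proof -
      obtain i l i' l' where "x = (i, l)" "y = (i', l')"
        by (cases x, cases y)
      then show ?thesis
        using that 2(4) sub[of i l] sub[of i' l'] anti[of i l i' l'] by auto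
    qed
    moreover have "1 \<le> i \<and> i \<le> Suc n \<and> - int i \<le> l \<and> l < int i \<and> l < b" if "(i, l) \<in> A" for i l
      using that 2(1,2,4) sub[of i l] assms by auto
    ultimately show ?thesis
      unfolding staircase_antichains_def by auto
  qed
qed

lemma card_staircase_antichains_Suc:
  assumes "b \<le> int (Suc n)"
  shows "card (staircase_antichains (Suc n) b) =
    card (staircase_antichains n b) + (\<Sum>j\<in>{- int (Suc n)..<b}. card (staircase_antichains n j))"
proof -
  have notin: "(Suc n, j) \<notin> A" if "A \<in> staircase_antichains n l" for A j l
    using that unfolding staircase_antichains_def by auto
  have "card (\<Union>j\<in>{- int (Suc n)..<b}. insert (Suc n, j) ` staircase_antichains n j) =
      (\<Sum>j\<in>{- int (Suc n)..<b}. card (insert (Suc n, j) ` staircase_antichains n j))"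
  proof (rule card_UN_disjoint)
    show "\<forall>i\<in>{- int (Suc n)..<b}. \<forall>j\<in>{- int (Suc n)..<b}. i \<noteq> j \<longrightarrow>
        insert (Suc n, i) ` staircase_antichains n i \<inter> insert (Suc n, j) ` staircase_antichains n j = {}"
      using notin by auto (metis Pair_inject insert_iff)+
  qed (auto intro: finite_staircase_antichains)
  also have "\<dots> = (\<Sum>j\<in>{- int (Suc n)..<b}. card (staircase_antichains n j))"
    using notin by (intro sum.cong refl card_image) (auto simp: inj_on_def insert_ident)
  finally show ?thesis
    unfolding staircase_antichains_Suc[OF assms] using notin
    by (subst card_Un_disjoint) (auto intro: finite_staircase_antichains)
qed

section \<open>Counting staircase antichains by truncated binomial sums\<close>

definition binomial_prefix :: "nat \<Rightarrow> nat \<Rightarrow> int" where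
  "binomial_prefix n c = (\<Sum>i\<le>n. int (c choose i))"

lemma binomial_prefix_Suc:
  "binomial_prefix (Suc n) (Suc c) = binomial_prefix (Suc n) c + binomial_prefix n c"
  unfolding binomial_prefix_def by (subst sum.atMost_Suc_shift) (simp add: sum.distrib sum.atMost_Suc_shift del: sum.atMost_Suc)

lemma binomial_prefix_odd: "binomial_prefix n (2 * n + 1) = 2 ^ (2 * n)"
  using binomial_r_part_sum[of n] unfolding binomial_prefix_def by (metis of_nat_numeral of_nat_power of_nat_sum)

text \<open>Obtained by the reflection principle: without the bound on the columns the number of
  antichains would be a partial row sum of Pascal's triangle.\<close>

definition staircase_count :: "nat \<Rightarrow> nat \<Rightarrow> int" where
  "staircase_count n c = binomial_prefix n c + binomial_prefix (Suc n) c - 2 ^ c"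

lemma staircase_count_Suc:
  "staircase_count (Suc n) (Suc c) = staircase_count (Suc n) c + staircase_count n c"
  by (simp add: staircase_count_def binomial_prefix_Suc)

lemma staircase_count_zero: "staircase_count n 0 = 1"
  by (simp add: staircase_count_def binomial_prefix_def sum.atMost_shift)

text \<open>The recursion of \<open>card_staircase_antichains_Suc\<close> in closed form; the term 1
  matches an element in the first column of the new row, which tolerates no other element.\<close>

lemma staircase_count_sum: "staircase_count (Suc n) c = 1 + (\<Sum>i<c. staircase_count n i)"
  by (induction c) (simp_all add: staircase_count_zero staircase_count_Suc)

lemma staircase_count_last: "staircase_count n (2 * n + 1) = int (2 * n + 1 choose n)"
proof -
  have "binomial_prefix (Suc n) (2 * n + 1) = binomial_prefix n (2 * n + 1) + int (2 * n + 1 choose Suc n)"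
    by (simp add: binomial_prefix_def)
  moreover have "2 * n + 1 choose Suc n = 2 * n + 1 choose n"
    using binomial_symmetric[of n "2 * n + 1"] by simp
  ultimately show ?thesis
    unfolding staircase_count_def binomial_prefix_odd by simp
qed

text \<open>The boundary condition of the reflection principle: by this zero the count for
  \<open>Suc n\<close> does not change from \<open>2 * n + 2\<close> to \<open>2 * n + 3\<close>, as
  the end of the staircase demands.\<close>

lemma staircase_count_reflection: "staircase_count n (2 * n + 2) = 0"
proof -
  have sym: "2 * n + 1 choose Suc n = 2 * n + 1 choose n"
    using binomial_symmetric[of n "2 * n + 1"] by simp
  have next1: "binomial_prefix (Suc n) (2 * n + 1) = 2 ^ (2 * n) + int (2 * n + 1 choose n)"
    using binomial_prefix_odd[of n] sym by (simp add: binomial_prefix_def)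
  have 1: "binomial_prefix (Suc n) (2 * n + 2) = 2 * 2 ^ (2 * n) + int (2 * n + 1 choose n)"
    using binomial_prefix_Suc[of n "2 * n + 1"] next1 binomial_prefix_odd[of n] by simp
  have "binomial_prefix (Suc n) (2 * n + 2) = binomial_prefix n (2 * n + 2) + int (2 * n + 2 choose Suc n)"
    by (simp add: binomial_prefix_def)
  moreover have "2 * n + 2 choose Suc n = 2 * (2 * n + 1 choose n)"
    using sym by simp
  ultimately show ?thesis
    unfolding staircase_count_def using 1 by simp
qed

text \<open>\<open>c\<close> counts the columns from \<open>- n\<close> on. The value
  \<open>2 * n + 1\<close> exceeds the width of the staircase by one, but the recursion for the full
  width of the next staircase refers to it.\<close>

lemma card_staircase_antichains:
  "c \<le> 2 * n + 1 \<Longrightarrow> int (card (staircase_antichains n (int c - int n))) = staircase_count n c"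
proof (induction n arbitrary: c)
  case 0
  have "staircase_antichains 0 b = {{}}" for b
    unfolding staircase_antichains_def by auto
  moreover have "c = 0 \<or> c = 1"
    using 0 by auto
  ultimately show ?case
    by (auto simp: staircase_count_def binomial_prefix_def)
next
  case (Suc n)
  have main: "int (card (staircase_antichains (Suc n) (int c - int (Suc n)))) = staircase_count (Suc n) c"
    if c: "c \<le> 2 * n + 2" for c
  proof (cases c)
    case 0
    then show ?thesis
      by (simp add: staircase_antichains_trivial staircase_count_zero)
  next
    case (Suc d)
    have "{- int (Suc n)..<int d - int n} = insert (- int (Suc n)) ((\<lambda>i. int i - int n) ` {..<d})"
    proof (intro Set.set_eqI iffI)
      fix j assume j: "j \<in> {- int (Suc n)..<int d - int n}"
      show "j \<in> insert (- int (Suc n)) ((\<lambda>i. int i - int n) ` {..<d})"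
      proof (cases "j = - int (Suc n)")
        case False
        then have "j = int (nat (j + int n)) - int n" "nat (j + int n) < d"
          using j by auto
        then show ?thesis by blast
      qed simp
    qed auto
    then have sum: "(\<Sum>j\<in>{- int (Suc n)..<int d - int n}. card (staircase_antichains n j)) =
        1 + (\<Sum>i<d. card (staircase_antichains n (int i - int n)))"
      by (simp add: sum.insert_if sum.reindex inj_on_def image_iff staircase_antichains_trivial)
    have eq: "int c - int (Suc n) = int d - int n" and le: "int d - int n \<le> int (Suc n)"
      using Suc c by auto
    have "int (card (staircase_antichains (Suc n) (int c - int (Suc n)))) =
        int (card (staircase_antichains n (int d - int n))) + 1 +
        (\<Sum>i<d. int (card (staircase_antichains n (int i - int n))))"
      unfolding eq card_staircase_antichains_Suc[OF le] sum by simp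
    also have "\<dots> = 1 + (\<Sum>i<c. staircase_count n i)"
      using Suc c Suc.IH by simp
    finally show ?thesis
      by (simp add: staircase_count_sum)
  qed
  show ?case
  proof (cases "c = 2 * n + 3")
    case True
    \<comment> \<open>The bound is one past the last column and is capped;
      \<open>staircase_count_reflection\<close> gives the same equality for the formula.\<close>
    have "staircase_antichains (Suc n) (int c - int (Suc n)) =
        staircase_antichains (Suc n) (int (2 * n + 2) - int (Suc n))"
      unfolding True using staircase_antichains_cap[of "Suc n" "int (2 * n + 3) - int (Suc n)"] by simp
    then show ?thesis
      using main[of "2 * n + 2"] staircase_count_Suc[of n "2 * n + 2"] staircase_count_reflection[of n] True
      by (simp add: numeral_eq_Suc)
  next
    case False
    then show ?thesis
      using main Suc.prems by simp
  qed
qed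

lemma card_full_staircase_antichains: "card (staircase_antichains n (int n)) = 2 * n + 1 choose n"
proof -
  have "int (card (staircase_antichains n (int n))) = int (2 * n + 1 choose n)"
    unfolding staircase_count_last[symmetric]
    using card_staircase_antichains[of "2 * n + 1" n] staircase_antichains_cap[of n "int n + 1"] by simp
  then show ?thesis
    by (simp only: of_nat_eq_iff)
qed

section \<open>The short roots and the highest root of type C\<close>

locale type_C = laced_path +
  assumes k_C: "k = 1"
begin

text \<open>The orthogonal coordinates of type C: \<open>f 0\<close> is twice \<open>e 0\<close>,
  and each later \<open>f j\<close> is \<open>e j - e (j - 1)\<close>.\<close>

definition e :: "nat \<Rightarrow> 'a" where
  "e j = (1 / 2) *\<^sub>R f 0 + (\<Sum>t=1..j. f t)"

lemma e_0: "2 *\<^sub>R e 0 = f 0" and e_Suc: "e (Suc j) = e j + f (Suc j)"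
  by (simp_all add: e_def)

lemma e_inner:
  assumes "j < n" "i < n"
  shows "inner (e j) (f i) = (if i = 0 then if j = 0 then s else 0
    else if j = i then s / 2 else if Suc j = i then - (s / 2) else 0)"
  using assms(1)
proof (induction j)
  case 0
  then show ?case
    using assms(2) k_C f_inner[of 0 i] by (auto simp: e_def)
next
  case (Suc j)
  then show ?case
    using assms(2) k_C f_inner[of "Suc j" i] by (auto simp: e_Suc inner_add_left)
qed

lemma reflection_e:
  assumes "j < n" "i < n"
  shows "reflection (f i) (e j) = (if j = i then if i = 0 then - e 0 else e (i - 1)
    else if Suc j = i then e i else e j)"
proof -
  consider "i = 0" "j = 0" | "i = j" "i \<noteq> 0" | "Suc j = i" | "j \<noteq> i" "Suc j \<noteq> i"
    by linarith
  then show ?thesis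
  proof cases
    case 1
    have "e 0 - f 0 = - e 0"
      by (simp flip: e_0 add: scaleR_2)
    then show ?thesis
      using 1 e_inner[OF assms] s_pos k_C f_inner[of 0 0] assms by (simp add: reflection_def)
  next
    case 2
    then have "e j - f i = e (i - 1)"
      using e_Suc[of "i - 1"] by simp
    moreover have inner: "inner (e j) (f i) = s / 2" "inner (f i) (f i) = s"
      using 2 e_inner[OF assms] k_C f_inner[of i i] assms by auto
    have "reflection (f i) (e j) = e j - f i"
      unfolding reflection_def inner using s_pos by simp
    ultimately show ?thesis
      using 2 by simp
  next
    case 3
    then show ?thesis
      using e_inner[OF assms] s_pos k_C f_inner[of i i] assms by (auto simp: reflection_def e_Suc)
  next
    case 4
    then show ?thesis
      using e_inner[OF assms] by (auto simp: reflection_def)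
  qed
qed

text \<open>The weights \<open>e j\<close> and their negatives form a single sequence indexed by the integers, in
  which the simple reflections are the symmetric adjacent transpositions (type C as a folding of
  type A).\<close>

definition E :: "int \<Rightarrow> 'a" where
  "E j = (if j \<ge> 0 then e (nat j) else - e (nat (- 1 - j)))"

definition swap :: "nat \<Rightarrow> int \<Rightarrow> int" where
  "swap i j = (if j = int i then int i - 1 else if j = int i - 1 then int i
     else if j = - 1 - int i then - int i else if j = - int i then - 1 - int i else j)"

lemma E_uminus: "E (- 1 - j) = - E j"
  by (auto simp: E_def)

lemma swap_uminus: "swap i (- 1 - j) = - 1 - swap i j"
  by (simp add: swap_def) presburger

lemma swap_swap: "swap i (swap i j) = j"
  by (auto simp: swap_def)

lemma reflection_E:
  assumes "i < n" "- int n \<le> j" "j < int n"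
  shows "reflection (f i) (E j) = E (swap i j)"
proof -
  have nonneg: "reflection (f i) (E j) = E (swap i j)" if j: "0 \<le> j" "j < int n" for j
  proof -
    define m where "m = nat j"
    have m: "j = int m" "m < n"
      using j by (auto simp: m_def)
    show ?thesis
      using reflection_e[OF m(2) assms(1)] unfolding m(1) swap_def E_def
      by (auto simp: nat_diff_distrib)
  qed
  show ?thesis
  proof (cases "j \<ge> 0")
    case False
    then have "reflection (f i) (E (- 1 - j)) = E (swap i (- 1 - j))"
      using assms by (intro nonneg) auto
    then show ?thesis
      by (simp add: E_uminus swap_uminus reflection_uminus)
  qed (use nonneg assms in auto)
qed

text \<open>The steps at \<open>j\<close> and \<open>- j\<close> of the folded sequence are the same
  simple root, which is where coefficients 2 come from.\<close>

lemma E_step: "E j - E (j - 1) = f (nat \<bar>j\<bar>)"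
proof -
  consider m where "j = int (Suc m)" | "j = 0" | m where "j = - int (Suc m)"
    by (metis int_cases2 not0_implies_Suc of_nat_0 minus_zero)
  then show ?thesis
  proof cases
    case 1
    then show ?thesis
      by (simp add: E_def e_Suc nat_add_distrib)
  next
    case 2
    then show ?thesis
      using e_0 by (simp add: E_def scaleR_2)
  next
    case 3
    then show ?thesis
      by (simp add: E_def e_Suc nat_add_distrib)
  qed
qed

text \<open>A negative \<open>j\<close> encodes a sum of two coordinates, as \<open>E j\<close> is
  then a negated one. The lower bound leaves out \<open>j = - 1 - i\<close>, which would give
  \<open>2 *\<^sub>R e i\<close>, a long root.\<close>

definition short_index :: "(nat \<times> int) set" where
  "short_index = {(i, j). 1 \<le> i \<and> i \<le> n - 1 \<and> - int i \<le> j \<and> j < int i}"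

text \<open>The number of steps \<open>m\<close> with \<open>j < m \<le> i\<close> and
  \<open>\<bar>m\<bar> = t\<close>, one summand for each sign of \<open>m\<close>.\<close>

definition coeff :: "nat \<Rightarrow> int \<Rightarrow> nat \<Rightarrow> int" where
  "coeff i j t = of_bool (j < int t \<and> t \<le> i) + of_bool (0 < t \<and> j < - int t)"

text \<open>The lower index \<open>j\<close> descends from \<open>i - 1\<close>: while
  \<open>- i < j < i\<close>, the reflection in the simple root of index
  \<open>\<bar>j\<bar>\<close> moves \<open>j\<close> to \<open>j - 1\<close> and fixes
  \<open>i\<close>, so being a root and the length are inherited.\<close>

lemma E_diff:
  assumes "1 \<le> i" "i < n" "d < 2 * i"
  shows "E (int i) - E (int i - 1 - int d) \<in> \<Delta> \<and>
    inner (E (int i) - E (int i - 1 - int d)) (E (int i) - E (int i - 1 - int d)) = s \<and>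
    E (int i) - E (int i - 1 - int d) = comb (coeff i (int i - 1 - int d))"
  using assms(3)
proof (induction d)
  case 0
  have "coeff i (int i - 1) = (\<lambda>t. if t = i then 1 else 0)"
    using assms(1) by (auto simp: coeff_def fun_eq_iff)
  then show ?case
    using E_step[of "int i"] f_root[of i] f_inner[of i i] assms k_C comb_unit[of i] by simp
next
  case (Suc d)
  define j where "j = int i - 1 - int d"
  have j: "- int i < j" "j < int i"
    using Suc.prems by (auto simp: j_def)
  define m where "m = nat \<bar>j\<bar>"
  have m: "m < i" "m < n"
    using j assms by (auto simp: m_def)
  have "swap m (int i) = int i" "swap m j = j - 1"
    using j m by (auto simp: swap_def m_def)
  then have refl: "E (int i) - E (j - 1) = reflection (f m) (E (int i) - E j)"
    using reflection_E[of m "int i"] reflection_E[of m j] m j assms by (simp add: reflection_diff)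
  have IH: "E (int i) - E j \<in> \<Delta>" "inner (E (int i) - E j) (E (int i) - E j) = s"
    "E (int i) - E j = comb (coeff i j)"
    using Suc by (auto simp: j_def)
  have "f m \<noteq> 0"
    using f_base[OF m(2)] base_nonzero by auto
  then have "inner (E (int i) - E (j - 1)) (E (int i) - E (j - 1)) = s"
    unfolding refl using IH by (simp add: inner_reflection)
  moreover have "E (int i) - E (j - 1) \<in> \<Delta>"
    unfolding refl using IH f_root m by (intro reflection_root) auto
  moreover have "E (int i) - E (j - 1) = comb (coeff i (j - 1))"
  proof -
    have "E (int i) - E (j - 1) = (E (int i) - E j) + f m"
      using E_step[of j] by (simp add: m_def algebra_simps)
    also have "\<dots> = comb (\<lambda>t. coeff i j t + (if t = m then 1 else 0))"
      using IH(3) comb_unit[OF m(2)] by (simp add: comb_add)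
    also have "(\<lambda>t. coeff i j t + (if t = m then 1 else 0)) = coeff i (j - 1)"
      using j by (auto simp: coeff_def m_def fun_eq_iff)
    finally show ?thesis .
  qed
  ultimately show ?case
    by (simp add: j_def algebra_simps)
qed

lemma short_index_root:
  assumes "(i, j) \<in> short_index"
  shows "E (int i) - E j \<in> \<Delta>" "inner (E (int i) - E j) (E (int i) - E j) = s"
    "E (int i) - E j = comb (coeff i j)"
proof -
  define d where "d = nat (int i - 1 - j)"
  have d: "1 \<le> i" "i < n" "d < 2 * i" "int i - 1 - int d = j"
    using assms k_bounds by (auto simp: short_index_def d_def)
  show "E (int i) - E j \<in> \<Delta>" "inner (E (int i) - E j) (E (int i) - E j) = s"
    "E (int i) - E j = comb (coeff i j)"
    using E_diff[OF d(1-3)] unfolding d(4) by blast+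
qed

lemma coeff_le_iff:
  assumes "(i, j) \<in> short_index" "(i', j') \<in> short_index"
  shows "(\<forall>t<n. coeff i j t \<le> coeff i' j' t) \<longleftrightarrow> i \<le> i' \<and> j' \<le> j"
proof
  assume le: "\<forall>t<n. coeff i j t \<le> coeff i' j' t"
  have "i < n"
    using assms k_bounds by (auto simp: short_index_def)
  then have "coeff i j i \<le> coeff i' j' i"
    using le by blast
  then have 1: "i \<le> i'"
    using assms by (auto simp: coeff_def short_index_def of_bool_def split: if_splits)
  \<comment> \<open>The first step of the segment from \<open>j\<close> to \<open>i\<close>; its
    coefficient drops as soon as the lower end moves above \<open>j\<close>.\<close>
  have "nat \<bar>j + 1\<bar> < n"
    using assms k_bounds by (auto simp: short_index_def)
  then have "coeff i j (nat \<bar>j + 1\<bar>) \<le> coeff i' j' (nat \<bar>j + 1\<bar>)"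
    using le by blast
  then have "j' \<le> j"
    using assms by (auto simp: coeff_def short_index_def of_bool_def abs_if split: if_splits)
  with 1 show "i \<le> i' \<and> j' \<le> j" ..
qed (auto simp: coeff_def)

lemma root_le_short_index:
  assumes "x \<in> short_index" "y \<in> short_index"
  shows "root_le B (E (int (fst x)) - E (snd x)) (E (int (fst y)) - E (snd y)) \<longleftrightarrow>
    fst x \<le> fst y \<and> snd y \<le> snd x"
proof -
  obtain i j i' j' where "x = (i, j)" "y = (i', j')" by (cases x, cases y)
  then show ?thesis
    using assms coeff_le_iff by (simp add: short_index_root root_le_comb)
qed

lemma positive_short_roots:
  "bij_betw (\<lambda>x. E (int (fst x)) - E (snd x)) short_index (positive_roots \<Delta> B \<inter> short_roots \<Delta>)"
  unfolding bij_betw_def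
proof
  show "inj_on (\<lambda>x. E (int (fst x)) - E (snd x)) short_index"
  proof (rule inj_onI)
    fix x y assume xy: "x \<in> short_index" "y \<in> short_index"
      "E (int (fst x)) - E (snd x) = E (int (fst y)) - E (snd y)"
    have "root_le B a a" for a
      by (auto simp: root_le_def intro: exI[of _ "\<lambda>_. 0"])
    then show "x = y"
      using root_le_short_index[OF xy(1,2)] root_le_short_index[OF xy(2,1)] xy(3)
      by (metis order_antisym prod_eqI)
  qed
  have pos: "E (int i) - E j \<in> positive_roots \<Delta> B" if "(i, j) \<in> short_index" for i j
    using short_index_root[OF that] comb_positive_iff[of "coeff i j"] by (auto simp: coeff_def)
  have neg: "- (E (int i) - E j) \<notin> positive_roots \<Delta> B" if "(i, j) \<in> short_index" for i j
    using short_index_root[OF that] comb_positive_iff[of "\<lambda>t. - coeff i j t"] that k_bounds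
    by (auto simp: coeff_def comb_uminus short_index_def intro!: exI[of _ i])
  show "(\<lambda>x. E (int (fst x)) - E (snd x)) ` short_index = positive_roots \<Delta> B \<inter> short_roots \<Delta>"
  proof (intro Set.set_eqI iffI)
    fix a assume "a \<in> (\<lambda>x. E (int (fst x)) - E (snd x)) ` short_index"
    then obtain i j where "(i, j) \<in> short_index" "a = E (int i) - E j" by auto
    then show "a \<in> positive_roots \<Delta> B \<inter> short_roots \<Delta>"
      using short_index_root pos by (simp add: short_roots_eq)
  next
    fix a assume a: "a \<in> positive_roots \<Delta> B \<inter> short_roots \<Delta>"
    \<comment> \<open>Besides zero differences this excludes \<open>i + j = - 1\<close>, where the
      difference is a doubled coordinate.\<close>
    define X where "X = {E i - E j | i j. - int n \<le> i \<and> i < int n \<and> - int n \<le> j \<and> j < int n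
      \<and> i \<noteq> j \<and> i + j \<noteq> - 1}"
    have "a \<in> X"
    proof (rule short_root_in)
      show "a \<in> \<Delta>" "inner a a = s"
        using a by (auto simp: short_roots_eq)
      fix i assume "k \<le> i" "i < n"
      then show "f i \<in> X"
        using E_step[of "int i"] k_C unfolding X_def
        by (intro CollectI exI[of _ "int i"] exI[of _ "int i - 1"]) auto
    next
      fix m v assume m: "m < n" "v \<in> X"
      then obtain i j where ij: "v = E i - E j" "- int n \<le> i" "i < int n" "- int n \<le> j" "j < int n"
        "i \<noteq> j" "i + j \<noteq> - 1"
        by (auto simp: X_def)
      have "reflection (f m) v = E (swap m i) - E (swap m j)"
        using ij m reflection_E by (simp add: reflection_diff)
      moreover have "- int n \<le> swap m l \<and> swap m l < int n" if "- int n \<le> l" "l < int n" for l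
        using that m by (auto simp: swap_def)
      moreover have "swap m i \<noteq> swap m j" "swap m i + swap m j \<noteq> - 1"
        using ij(6,7) swap_swap[of m i] swap_swap[of m j] swap_uminus[of m "swap m j"]
        by (metis, smt (verit))
      ultimately show "reflection (f m) v \<in> X"
        using ij unfolding X_def by blast
    qed
    \<comment> \<open>The pair \<open>(- 1 - j, - 1 - i)\<close> gives the same vector and turns an
      index sum below -1 into a nonnegative one.\<close>
    then obtain i j where ij: "a = E i - E j" "- int n \<le> i" "i < int n" "- int n \<le> j" "j < int n"
        "i \<noteq> j" "i + j \<ge> 0"
    proof -
      obtain i j where ij: "a = E i - E j" "- int n \<le> i" "i < int n" "- int n \<le> j" "j < int n"
        "i \<noteq> j" "i + j \<noteq> - 1"
        using \<open>a \<in> X\<close> by (auto simp: X_def)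
      moreover have "a = E (- 1 - j) - E (- 1 - i)"
        unfolding E_uminus ij(1) by simp
      ultimately show thesis
        by (cases "i + j \<ge> 0") (rule that[of i j] that[of "- 1 - j" "- 1 - i"]; simp; fail)+
    qed
    show "a \<in> (\<lambda>x. E (int (fst x)) - E (snd x)) ` short_index"
    proof (cases "i > j")
      case True
      then have "(nat i, j) \<in> short_index" "int (nat i) = i"
        using ij by (auto simp: short_index_def)
      then show ?thesis
        using ij(1) by (intro image_eqI[of _ _ "(nat i, j)"]) auto
    next
      case False
      then have "(nat j, i) \<in> short_index" "int (nat j) = j"
        using ij by (auto simp: short_index_def)
      then have "- (E j - E i) \<notin> positive_roots \<Delta> B"
        using neg by metis
      then show ?thesis
        using a ij(1) by simp
    qed
  qed
qed

lemma card_short_antichains_C: "card (short_antichains \<Delta> B) = 2 * (n - 1) + 1 choose (n - 1)"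
proof -
  have "{A. A \<subseteq> short_index \<and> (\<forall>x\<in>A. \<forall>y\<in>A. x \<noteq> y \<longrightarrow> \<not> (fst x \<le> fst y \<and> snd y \<le> snd x))} =
      staircase_antichains (n - 1) (int (n - 1))"
    unfolding staircase_antichains_def short_index_def by (intro Collect_cong conj_cong) auto
  then show ?thesis
    using card_short_antichains[OF positive_short_roots root_le_short_index]
    by (simp add: card_full_staircase_antichains)
qed

text \<open>Twice the last coordinate is dominant, and it is reached from \<open>f 0\<close> by
  reflecting in \<open>f 1\<close>, \<open>f 2\<close> and so on.\<close>

lemma highest_root_C:
  assumes "highest_root \<Delta> B \<theta>"
  shows "\<theta> = comb (\<lambda>t. int (if t = 0 then 1 else 2))"
proof -
  have e: "2 *\<^sub>R e j \<in> \<Delta> \<and> inner (2 *\<^sub>R e j) (2 *\<^sub>R e j) = 2 * s \<and>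
      2 *\<^sub>R e j = comb (\<lambda>t. if t = 0 then 1 else if t \<le> j then 2 else 0)" if "j < n" for j
    using that
  proof (induction j)
    case 0
    moreover have "(\<lambda>t::nat. if t = 0 then 1 else if t \<le> 0 then 2 else 0) = (\<lambda>t. if t = 0 then 1 else 0 :: int)"
      by (auto simp: fun_eq_iff)
    ultimately show ?case
      unfolding e_0 using f_root[of 0] f_inner[of 0 0] k_bounds comb_unit[of 0] by simp
  next
    case (Suc j)
    have refl: "2 *\<^sub>R e (Suc j) = reflection (f (Suc j)) (2 *\<^sub>R e j)"
      using reflection_e[of j "Suc j"] Suc.prems by (simp add: reflection_scaleR)
    have IH: "2 *\<^sub>R e j \<in> \<Delta>" "inner (2 *\<^sub>R e j) (2 *\<^sub>R e j) = 2 * s"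
        "2 *\<^sub>R e j = comb (\<lambda>t. if t = 0 then 1 else if t \<le> j then 2 else 0)"
      using Suc.IH[OF Suc_lessD[OF Suc.prems]] by blast+
    have "f (Suc j) \<noteq> 0"
      using f_base[OF Suc.prems] base_nonzero by auto
    have "inner (2 *\<^sub>R e (Suc j)) (2 *\<^sub>R e (Suc j)) = 2 * s"
      unfolding refl inner_reflection[OF \<open>f (Suc j) \<noteq> 0\<close>] by (rule IH(2))
    moreover have "2 *\<^sub>R e (Suc j) \<in> \<Delta>"
      unfolding refl using IH f_root Suc.prems by (intro reflection_root) auto
    moreover have "2 *\<^sub>R e (Suc j) = comb (\<lambda>t. if t = 0 then 1 else if t \<le> Suc j then 2 else 0)"
    proof -
      have "2 *\<^sub>R e (Suc j) = 2 *\<^sub>R e j + (f (Suc j) + f (Suc j))"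
        by (simp add: e_Suc scaleR_add_right scaleR_2)
      also have "\<dots> = comb (\<lambda>t. (if t = 0 then 1 else if t \<le> j then 2 else 0) +
          ((if t = Suc j then 1 else 0) + (if t = Suc j then 1 else 0)))"
        using IH(3) comb_unit[OF Suc.prems] by (simp add: comb_add)
      also have "\<dots> = comb (\<lambda>t. if t = 0 then 1 else if t \<le> Suc j then 2 else 0)"
        by (rule arg_cong[of _ _ comb]) auto
      finally show ?thesis .
    qed
    ultimately show ?case by blast
  qed
  have n: "n - 1 < n"
    using k_bounds by simp
  have comb: "2 *\<^sub>R e (n - 1) = comb (\<lambda>t. int (if t = 0 then 1 else 2))"
    using e[OF n] by (auto simp: comb_def intro!: sum.cong)
  have "\<theta> = 2 *\<^sub>R e (n - 1)"
  proof (rule highest_root_eqI[OF assms])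
    show "2 *\<^sub>R e (n - 1) \<in> positive_roots \<Delta> B"
      using e[OF n] comb_positive_iff[of "\<lambda>t. int (if t = 0 then 1 else 2)"] unfolding comb by auto
    show "inner (2 *\<^sub>R e (n - 1)) (2 *\<^sub>R e (n - 1)) = 2 * s"
      using e[OF n] by blast
    fix i assume "i < n"
    then show "inner (2 *\<^sub>R e (n - 1)) (f i) \<ge> 0"
      using e_inner[OF n] s_pos n by auto
  qed
  then show ?thesis
    using comb by simp
qed

end

subsection \<open>Type \<open>F\<^sub>4\<close>\<close>

locale type_F4 = laced_path +
  assumes k_F: "k = 2" and n_F: "n = 4"
begin

definition v :: "int \<times> int \<times> int \<times> int \<Rightarrow> 'a" where
  "v = (\<lambda>(a, b, c, d). comb ((\<lambda>_. 0)(0 := a, 1 := b, 2 := c, 3 := d)))"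

lemma v_eq: "v (a, b, c, d) = real_of_int a *\<^sub>R f 0 + real_of_int b *\<^sub>R f 1 + real_of_int c *\<^sub>R f 2 + real_of_int d *\<^sub>R f 3"
  unfolding v_def unfolding comb_def unfolding n_F by (simp add: numeral_eq_Suc add.assoc)

lemma less_n_iff: "i < n \<longleftrightarrow> i = 0 \<or> i = 1 \<or> i = 2 \<or> i = 3"
  unfolding n_F by auto

lemma all_less_n: "(\<forall>i<n. P i) \<longleftrightarrow> P 0 \<and> P 1 \<and> P 2 \<and> P 3"
  by (auto simp only: less_n_iff)

lemma v_uminus: "- v (a, b, c, d) = v (- a, - b, - c, - d)"
  by (simp add: v_eq)

lemma root_le_v: "root_le B (v (a, b, c, d)) (v (a', b', c', d')) \<longleftrightarrow> a \<le> a' \<and> b \<le> b' \<and> c \<le> c' \<and> d \<le> d'"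
  unfolding v_def prod.case root_le_comb all_less_n by simp

lemma v_positive_iff: "v (a, b, c, d) \<in> positive_roots \<Delta> B \<longleftrightarrow>
    v (a, b, c, d) \<in> \<Delta> \<and> 0 \<le> a \<and> 0 \<le> b \<and> 0 \<le> c \<and> 0 \<le> d"
  unfolding v_def prod.case comb_positive_iff all_less_n by simp

lemma f_v: "f 0 = v (1, 0, 0, 0)" "f 1 = v (0, 1, 0, 0)" "f 2 = v (0, 0, 1, 0)" "f 3 = v (0, 0, 0, 1)"
  by (simp_all add: v_eq)

lemma gram:
  "inner (f 0) (f 0) = 2 * s" "inner (f 0) (f 1) = - s" "inner (f 0) (f 2) = 0" "inner (f 0) (f 3) = 0"
  "inner (f 1) (f 0) = - s" "inner (f 1) (f 1) = 2 * s" "inner (f 1) (f 2) = - s" "inner (f 1) (f 3) = 0"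
  "inner (f 2) (f 0) = 0" "inner (f 2) (f 1) = - s" "inner (f 2) (f 2) = s" "inner (f 2) (f 3) = - (s / 2)"
  "inner (f 3) (f 0) = 0" "inner (f 3) (f 1) = 0" "inner (f 3) (f 2) = - (s / 2)" "inner (f 3) (f 3) = s"
  using f_inner by (simp_all add: n_F k_F)

lemma inner_v_f:
  "inner (v (a, b, c, d)) (f 0) = s * (2 * a - b)"
  "inner (v (a, b, c, d)) (f 1) = s * (2 * b - a - c)"
  "inner (v (a, b, c, d)) (f 2) = s * (c - b - d / 2)"
  "inner (v (a, b, c, d)) (f 3) = s * (d - c / 2)"
  unfolding v_eq inner_add_left inner_scaleR_left gram by (simp_all add: algebra_simps)

lemma reflection_v:
  "reflection (f 0) (v (a, b, c, d)) = v (b - a, b, c, d)"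
  "reflection (f 1) (v (a, b, c, d)) = v (a, a + c - b, c, d)"
  "reflection (f 2) (v (a, b, c, d)) = v (a, b, 2 * b + d - c, d)"
  "reflection (f 3) (v (a, b, c, d)) = v (a, b, c, c - d)"
proof -
  have coefficients: "2 * inner (v (a, b, c, d)) (f 0) / inner (f 0) (f 0) = real_of_int (2 * a - b)"
    "2 * inner (v (a, b, c, d)) (f 1) / inner (f 1) (f 1) = real_of_int (2 * b - a - c)"
    "2 * inner (v (a, b, c, d)) (f 2) / inner (f 2) (f 2) = real_of_int (2 * c - 2 * b - d)"
    "2 * inner (v (a, b, c, d)) (f 3) / inner (f 3) (f 3) = real_of_int (2 * d - c)"
    unfolding inner_v_f gram using s_pos by (simp_all add: field_simps)
  show "reflection (f 0) (v (a, b, c, d)) = v (b - a, b, c, d)"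
    "reflection (f 1) (v (a, b, c, d)) = v (a, a + c - b, c, d)"
    "reflection (f 2) (v (a, b, c, d)) = v (a, b, 2 * b + d - c, d)"
    "reflection (f 3) (v (a, b, c, d)) = v (a, b, c, c - d)"
    unfolding reflection_def coefficients unfolding v_eq
    by (simp_all add: algebra_simps scaleR_left_distrib[symmetric] del: scaleR_left_distrib)
qed

lemma v_reflect:
  assumes "v (a, b, c, d) \<in> \<Delta>" "inner (v (a, b, c, d)) (v (a, b, c, d)) = r"
  shows "v (b - a, b, c, d) \<in> \<Delta> \<and> inner (v (b - a, b, c, d)) (v (b - a, b, c, d)) = r"
    "v (a, a + c - b, c, d) \<in> \<Delta> \<and> inner (v (a, a + c - b, c, d)) (v (a, a + c - b, c, d)) = r"
    "v (a, b, 2 * b + d - c, d) \<in> \<Delta> \<and> inner (v (a, b, 2 * b + d - c, d)) (v (a, b, 2 * b + d - c, d)) = r"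
    "v (a, b, c, c - d) \<in> \<Delta> \<and> inner (v (a, b, c, c - d)) (v (a, b, c, c - d)) = r"
proof -
  have *: "reflection (f i) (v (a, b, c, d)) \<in> \<Delta> \<and>
      inner (reflection (f i) (v (a, b, c, d))) (reflection (f i) (v (a, b, c, d))) = r" if "i < n" for i
    using that assms f_root[of i] f_base[of i] base_nonzero[of "f i"] reflection_root less_n_iff
    by (auto simp: inner_reflection)
  show "v (b - a, b, c, d) \<in> \<Delta> \<and> inner (v (b - a, b, c, d)) (v (b - a, b, c, d)) = r"
    "v (a, a + c - b, c, d) \<in> \<Delta> \<and> inner (v (a, a + c - b, c, d)) (v (a, a + c - b, c, d)) = r"
    "v (a, b, 2 * b + d - c, d) \<in> \<Delta> \<and> inner (v (a, b, 2 * b + d - c, d)) (v (a, b, 2 * b + d - c, d)) = r"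
    "v (a, b, c, c - d) \<in> \<Delta> \<and> inner (v (a, b, c, c - d)) (v (a, b, c, c - d)) = r"
    using *[of 0, unfolded reflection_v] *[of 1, unfolded reflection_v]
      *[of 2, unfolded reflection_v] *[of 3, unfolded reflection_v] by (simp_all add: less_n_iff)
qed

text \<open>The nonnegative part of the closure of the two short simple roots under simple
  reflections; each later entry arises from an earlier one by a single reflection.\<close>

definition short_list :: "(int \<times> int \<times> int \<times> int) list" where
  "short_list = [(0,0,0,1), (0,0,1,0), (0,0,1,1), (0,1,1,0), (0,1,1,1), (1,1,1,0), (1,1,1,1),
     (0,1,2,1), (1,1,2,1), (1,2,2,1), (1,2,3,1), (1,2,3,2)]"

lemma short_list_root:
  assumes "x \<in> set short_list"
  shows "v x \<in> \<Delta> \<and> inner (v x) (v x) = s"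
proof -
  let ?R = "\<lambda>x. v x \<in> \<Delta> \<and> inner (v x) (v x) = s"
  have step: "?R (b - a, b, c, d)" "?R (a, a + c - b, c, d)" "?R (a, b, 2 * b + d - c, d)" "?R (a, b, c, c - d)"
    if "?R (a, b, c, d)" for a b c d
    using v_reflect[of a b c d s] that by auto
  have 1: "?R (0,0,0,1)" and 2: "?R (0,0,1,0)"
    using f_root[of 3] f_root[of 2] f_inner[of 2 2] f_inner[of 3 3] f_v less_n_iff k_F by simp_all
  have 3: "?R (0,0,1,1)" using step(4)[OF 2] by simp
  have 4: "?R (0,1,1,0)" using step(2)[OF 2] by simp
  have 5: "?R (0,1,1,1)" using step(4)[OF 4] by simp
  have 6: "?R (1,1,1,0)" using step(1)[OF 4] by simp
  have 7: "?R (1,1,1,1)" using step(1)[OF 5] by simp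
  have 8: "?R (0,1,2,1)" using step(3)[OF 5] by simp
  have 9: "?R (1,1,2,1)" using step(1)[OF 8] by simp
  have 10: "?R (1,2,2,1)" using step(2)[OF 9] by simp
  have 11: "?R (1,2,3,1)" using step(3)[OF 10] by simp
  have 12: "?R (1,2,3,2)" using step(4)[OF 11] by simp
  show ?thesis
    using assms 1 2 3 4 5 6 7 8 9 10 11 12 by (auto simp: short_list_def)
qed

lemma positive_short_roots: "bij_betw v (set short_list) (positive_roots \<Delta> B \<inter> short_roots \<Delta>)"
  unfolding bij_betw_def
proof
  have refl: "root_le B a a" for a
    by (auto simp: root_le_def intro: exI[of _ "\<lambda>_. 0"])
  show "inj_on v (set short_list)"
  proof (rule inj_onI)
    fix x y assume eq: "v x = v y"
    obtain a b c d a' b' c' d' where "x = (a, b, c, d)" "y = (a', b', c', d')"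
      by (cases x, cases y)
    then show "x = y"
      using refl[of "v x"] root_le_v[of a b c d a' b' c' d'] root_le_v[of a' b' c' d' a b c d] eq by auto
  qed
  show "v ` set short_list = positive_roots \<Delta> B \<inter> short_roots \<Delta>"
  proof (intro Set.set_eqI iffI)
    fix a assume "a \<in> v ` set short_list"
    then obtain x where x: "x \<in> set short_list" "a = v x" by blast
    obtain a\<^sub>0 a\<^sub>1 a\<^sub>2 a\<^sub>3 where x_eq: "x = (a\<^sub>0, a\<^sub>1, a\<^sub>2, a\<^sub>3)"
      by (cases x)
    have "0 \<le> a\<^sub>0 \<and> 0 \<le> a\<^sub>1 \<and> 0 \<le> a\<^sub>2 \<and> 0 \<le> a\<^sub>3"
      using x(1) unfolding x_eq short_list_def by auto
    then have "a \<in> positive_roots \<Delta> B"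
      using short_list_root[OF x(1)] unfolding x(2) x_eq v_positive_iff by blast
    then show "a \<in> positive_roots \<Delta> B \<inter> short_roots \<Delta>"
      using short_list_root[OF x(1)] x(2) by (simp add: short_roots_eq)
  next
    fix a assume a: "a \<in> positive_roots \<Delta> B \<inter> short_roots \<Delta>"
    define X where "X = v ` set short_list \<union> uminus ` v ` set short_list"
    have "a \<in> X"
    proof (rule short_root_in)
      show "a \<in> \<Delta>" "inner a a = s"
        using a by (auto simp: short_roots_eq)
      fix i assume "k \<le> i" "i < n"
      then have "i = 2 \<or> i = 3"
        using k_F less_n_iff[of i] by auto
      then show "f i \<in> X"
        by (auto simp: X_def short_list_def f_v)
    next
      fix i w assume i: "i < n" and w: "w \<in> X"
      then consider "i = 0" | "i = 1" | "i = 2" | "i = 3"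
        using less_n_iff[of i] by blast
      then have "reflection (f i) (v x) \<in> X \<and> - reflection (f i) (v x) \<in> X" if "x \<in> set short_list" for x
      proof cases
        case 1
        show ?thesis
          using that unfolding 1 X_def short_list_def by (auto simp: reflection_v v_uminus simp del: One_nat_def)
      next
        case 2
        show ?thesis
          using that unfolding 2 X_def short_list_def by (auto simp: reflection_v v_uminus simp del: One_nat_def)
      next
        case 3
        show ?thesis
          using that unfolding 3 X_def short_list_def by (auto simp: reflection_v v_uminus simp del: One_nat_def)
      next
        case 4
        show ?thesis
          using that unfolding 4 X_def short_list_def by (auto simp: reflection_v v_uminus simp del: One_nat_def)
      qed
      moreover obtain x where "x \<in> set short_list" "w = v x \<or> w = - v x"
        using w unfolding X_def by blast
      ultimately show "reflection (f i) w \<in> X"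
        by (metis reflection_uminus)
    qed
    moreover have "- v x \<notin> positive_roots \<Delta> B" if "x \<in> set short_list" for x
      using that unfolding short_list_def by (auto simp: v_uminus v_positive_iff)
    ultimately show "a \<in> v ` set short_list"
      using a by (auto simp: X_def)
  qed
qed

end

section \<open>Enumerating the antichains of a finite list\<close>

definition antichain_extend :: "('b \<Rightarrow> 'b \<Rightarrow> bool) \<Rightarrow> 'b \<Rightarrow> 'b list list \<Rightarrow> 'b list list" where
  "antichain_extend R x L = L @ map ((#) x) (filter (list_all (\<lambda>y. \<not> R x y \<and> \<not> R y x)) L)"

text \<open>The extension is a separate function so that the recursive result, which it uses twice,
  is passed as one argument.\<close>

fun antichain_lists :: "('b \<Rightarrow> 'b \<Rightarrow> bool) \<Rightarrow> 'b list \<Rightarrow> 'b list list" where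
  "antichain_lists R [] = [[]]"
| "antichain_lists R (x # xs) = antichain_extend R x (antichain_lists R xs)"

lemma antichain_lists_subset: "ys \<in> set (antichain_lists R xs) \<Longrightarrow> set ys \<subseteq> set xs"
  by (induction R xs arbitrary: ys rule: antichain_lists.induct)
    (auto simp: antichain_extend_def, blast+)

text \<open>Each antichain is represented by exactly one list, so the number of antichains becomes a
  length that can be evaluated.\<close>

lemma antichain_lists_correct:
  assumes "distinct xs"
  shows "card {A. A \<subseteq> set xs \<and> (\<forall>x\<in>A. \<forall>y\<in>A. x \<noteq> y \<longrightarrow> \<not> R x y)} = length (antichain_lists R xs)"
proof -
  have "distinct (map set (antichain_lists R xs)) \<and>
      set ` set (antichain_lists R xs) = {A. A \<subseteq> set xs \<and> (\<forall>x\<in>A. \<forall>y\<in>A. x \<noteq> y \<longrightarrow> \<not> R x y)}"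
    using assms
  proof (induction xs)
    case Nil
    then show ?case by auto
  next
    case (Cons x xs)
    let ?L = "antichain_lists R xs" and ?C = "\<lambda>ys. list_all (\<lambda>y. \<not> R x y \<and> \<not> R y x) ys"
    have IH: "distinct (map set ?L)"
      "set ` set ?L = {A. A \<subseteq> set xs \<and> (\<forall>x\<in>A. \<forall>y\<in>A. x \<noteq> y \<longrightarrow> \<not> R x y)}" and x: "x \<notin> set xs"
      using Cons by auto
    have notin: "x \<notin> set ys" if "ys \<in> set ?L" for ys
      using antichain_lists_subset[OF that] x by auto
    have "inj_on (\<lambda>ys. insert x (set ys)) (set ?L)"
    proof (rule inj_onI)
      fix ys zs assume "ys \<in> set ?L" "zs \<in> set ?L" "insert x (set ys) = insert x (set zs)"
      moreover from this have "set ys = set zs"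
        using notin by (metis insert_ident)
      moreover have "inj_on set (set ?L)"
        using IH(1) by (simp add: distinct_map)
      ultimately show "ys = zs"
        by (auto dest: inj_onD)
    qed
    then have "distinct (map (\<lambda>ys. insert x (set ys)) (filter ?C ?L))"
      using IH(1) by (auto simp: distinct_map intro: inj_on_subset)
    then have 1: "distinct (map set (antichain_lists R (x # xs)))"
      using IH(1) notin by (auto simp: comp_def antichain_extend_def)
    have 2: "set ` set (antichain_lists R (x # xs)) =
        set ` set ?L \<union> insert x ` (set ` {ys \<in> set ?L. ?C ys})"
      by (auto simp: image_Un image_image antichain_extend_def)
    have 3: "set ` {ys \<in> set ?L. ?C ys} = {A \<in> set ` set ?L. \<forall>y\<in>A. \<not> R x y \<and> \<not> R y x}"
      by (auto simp: list_all_iff)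
    have 4: "{A. A \<subseteq> set (x # xs) \<and> (\<forall>x\<in>A. \<forall>y\<in>A. x \<noteq> y \<longrightarrow> \<not> R x y)} = set ` set ?L \<union>
        insert x ` {A \<in> set ` set ?L. \<forall>y\<in>A. \<not> R x y \<and> \<not> R y x}" (is "?P = ?Q")
    proof (intro Set.set_eqI iffI)
      fix A assume A: "A \<in> ?P"
      show "A \<in> ?Q"
      proof (cases "x \<in> A")
        case True
        then have "A - {x} \<in> {A \<in> set ` set ?L. \<forall>y\<in>A. \<not> R x y \<and> \<not> R y x}"
          using A unfolding IH(2) by auto
        moreover have "A = insert x (A - {x})"
          using True by auto
        ultimately show ?thesis by blast
      next
        case False
        then show ?thesis
          using A unfolding IH(2) by auto
      qed
    next
      fix A assume "A \<in> ?Q"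
      then show "A \<in> ?P"
        unfolding IH(2) using x by auto
    qed
    show ?case
      using 1 2 3 4 by simp
  qed
  then show ?thesis
    by (metis distinct_card length_map set_map)
qed

context type_F4
begin

lemma card_short_antichains_F4: "card (short_antichains \<Delta> B) = 21"
proof -
  let ?R = "\<lambda>(a, b, c, d) (a', b', c', d'). a \<le> a' \<and> b \<le> b' \<and> c \<le> c' \<and> d \<le> (d' :: int)"
  have "card (short_antichains \<Delta> B) = length (antichain_lists ?R short_list)"
    using card_short_antichains[OF positive_short_roots, of ?R]
      antichain_lists_correct[of short_list ?R] by (auto simp: root_le_v short_list_def)
  also have "\<dots> = 21"
    unfolding short_list_def by code_simp
  finally show ?thesis .
qed

lemma highest_root_F4:
  assumes "highest_root \<Delta> B \<theta>"
  shows "\<theta> = comb ((\<lambda>_. 0)(0 := 2, 1 := 3, 2 := 4, 3 := 2))"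
proof -
  let ?R = "\<lambda>x. v x \<in> \<Delta> \<and> inner (v x) (v x) = 2 * s"
  have step: "?R (b - a, b, c, d)" "?R (a, a + c - b, c, d)" "?R (a, b, 2 * b + d - c, d)" "?R (a, b, c, c - d)"
    if "?R (a, b, c, d)" for a b c d
    using v_reflect[of a b c d "2 * s"] that by auto
  \<comment> \<open>A chain of reflections that raises the long simple root \<open>f 1\<close> to
    the dominant long root.\<close>
  have "?R (0,1,0,0)"
    using f_root[of 1] f_inner[of 1 1] f_v less_n_iff k_F by simp
  from step(1)[OF this] have "?R (1,1,0,0)" by simp
  from step(3)[OF this] have "?R (1,1,2,0)" by simp
  from step(2)[OF this] have "?R (1,2,2,0)" by simp
  from step(4)[OF this] have "?R (1,2,2,2)" by simp
  from step(3)[OF this] have "?R (1,2,4,2)" by simp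
  from step(2)[OF this] have "?R (1,3,4,2)" by simp
  from step(1)[OF this] have R: "?R (2,3,4,2)" by simp
  have "\<theta> = v (2,3,4,2)"
  proof (rule highest_root_eqI[OF assms])
    fix i assume "i < n"
    then have "i = 0 \<or> i = 1 \<or> i = 2 \<or> i = 3"
      using less_n_iff[of i] by blast
    then show "inner (v (2,3,4,2)) (f i) \<ge> 0"
      using s_pos inner_v_f[of 2 3 4 2] by auto
  qed (use R v_positive_iff in auto)
  then show ?thesis
    by (simp add: v_def)
qed

end

subsection \<open>The Coxeter element\<close>

lemma cis_eqD:
  assumes "cis a = cis b" "0 \<le> a" "a < 2 * pi" "0 \<le> b" "b < 2 * pi"
  shows "a = b"
proof -
  have "sin a = sin b \<and> cos a = cos b"
    using assms(1) by (simp add: complex_eq_iff)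
  then obtain m :: int where m: "a = b + 2 * pi * of_int m"
    by (auto simp: sin_cos_eq_iff)
  have "\<not> 1 \<le> m"
  proof
    assume "1 \<le> m"
    then have "2 * pi * 1 \<le> 2 * pi * real_of_int m"
      by (intro mult_left_mono) auto
    then show False
      using assms m by linarith
  qed
  moreover have "\<not> m \<le> - 1"
  proof
    assume "m \<le> - 1"
    then have "2 * pi * real_of_int m \<le> 2 * pi * (- 1)"
      by (intro mult_left_mono) auto
    then show False
      using assms m by linarith
  qed
  ultimately have "m = 0" by linarith
  then show ?thesis
    using m by simp
qed

lemma cis_fraction_eqD:
  fixes a b h k :: nat
  assumes "cis (2 * pi * real a / real h) = cis (2 * pi * real b / real k)" "a < h" "b < k"
  shows "a * k = b * h"
proof -
  have "2 * pi * real a / real h = 2 * pi * real b / real k"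
    using assms by (intro cis_eqD) (auto simp: divide_simps mult.assoc)
  then have "real a * real k = real b * real h"
    using assms(2,3) by (simp add: field_simps)
  then show ?thesis
    by (metis of_nat_eq_iff of_nat_mult)
qed

lemma cis_power_eq_1: "h > 0 \<Longrightarrow> cis (2 * pi * real a / real h) ^ h = 1"
proof -
  assume "h > 0"
  then have "real h * (2 * pi * real a / real h) = 2 * pi * real a"
    by simp
  then show ?thesis
    unfolding Complex.DeMoivre using cis_multiple_2pi[of "real a"] by simp
qed

text \<open>Distinct eigenvalues force Jordan blocks of size 1, so the matrix is diagonalisable and
  its power is determined by the powers of the eigenvalues.\<close>

lemma pow_mat_eq_one:
  fixes A :: "complex Matrix.mat"
  assumes A: "A \<in> carrier_mat n n" and factor: "char_poly A = (\<Prod>j<n. [:- z j, 1:])"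
    and inj: "inj_on z {..<n}" and roots: "\<And>j. j < n \<Longrightarrow> z j ^ h = 1"
  shows "A ^\<^sub>m h = 1\<^sub>m n"
proof -
  have factor': "char_poly A = (\<Prod>a\<leftarrow>map z [0..<n]. [:- a, 1:])"
    using factor by (simp add: prod.list_conv_set_nth atLeast0LessThan comp_def)
  obtain bs where jnf: "jordan_nf A bs"
    using jordan_nf_exists[OF A factor'] by blast
  have block: "m = 1 \<and> a ^ h = 1" if "(m, a) \<in> set bs" for m a
  proof -
    have "m \<noteq> 0"
      using jnf that by (force simp: jordan_nf_def)
    have "char_poly A \<noteq> 0"
      unfolding factor by simp
    moreover have m_le: "m \<le> Polynomial.order a (char_poly A)"
      using jordan_nf_block_size_order_bound[OF jnf that] .
    ultimately have "poly (char_poly A) a = 0"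
      using \<open>m \<noteq> 0\<close> by (metis order_root le_0_eq)
    then obtain j where j: "j < n" "a = z j"
      unfolding factor poly_prod by auto
    have "char_poly A = [:- z j, 1:] * (\<Prod>i\<in>{..<n} - {j}. [:- z i, 1:])"
      unfolding factor using j by (simp add: prod.remove)
    moreover have "poly (\<Prod>i\<in>{..<n} - {j}. [:- z i, 1:]) (z j) \<noteq> 0"
      unfolding poly_prod using inj j by (auto simp: inj_on_def)
    ultimately have "Polynomial.order a (char_poly A) = 1"
      using \<open>char_poly A \<noteq> 0\<close> j order_mult[of "[:- z j, 1:]" "\<Prod>i\<in>{..<n} - {j}. [:- z i, 1:]" a]
        order_0I[of "\<Prod>i\<in>{..<n} - {j}. [:- z i, 1:]" a] order_power_n_n[of a 1] by simp
    then show ?thesis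
      using m_le \<open>m \<noteq> 0\<close> roots j by auto
  qed
  have J: "jordan_matrix bs ^\<^sub>m h = 1\<^sub>m (dim_row (jordan_matrix bs))"
  proof -
    have "jordan_block m a ^\<^sub>m h = 1\<^sub>m m" if "(m, a) \<in> set bs" for m a
      using block[OF that] by (intro eq_matI) (auto simp: jordan_block_pow)
    then have "map (\<lambda>(m, a). jordan_block m a ^\<^sub>m h) bs =
        map (\<lambda>A. 1\<^sub>m (dim_row A)) (map (\<lambda>(m, a). jordan_block m a) bs)"
      by (auto simp: jordan_block_def)
    moreover have "map dim_row (map (\<lambda>(m, a). jordan_block m a) bs) = map fst bs"
      by (auto simp: jordan_block_def)
    ultimately show ?thesis
      unfolding jordan_matrix_pow by (simp only: diag_block_one_mat jordan_matrix_dim)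
  qed
  obtain P Q where sim: "similar_mat_wit A (jordan_matrix bs) P Q"
    using jnf by (auto simp: jordan_nf_def similar_mat_def)
  note P = similar_mat_witD2(6)[OF A sim] and PQ = similar_mat_witD2(1)[OF A sim]
    and n = carrier_matD(1)[OF similar_mat_witD2(5)[OF A sim]]
  have "A ^\<^sub>m h = P * 1\<^sub>m n * Q"
    unfolding similar_mat_wit_pow_id[OF sim] J n ..
  then show ?thesis
    unfolding right_mult_one_mat[OF P] PQ .
qed

section \<open>The Coxeter element in coordinates\<close>

locale ordered_basis =
  fixes \<alpha> :: "nat \<Rightarrow> 'a::euclidean_space" and p :: nat
  assumes inj: "inj_on \<alpha> {..<p}" and indep: "independent (\<alpha> ` {..<p})" and span: "span (\<alpha> ` {..<p}) = UNIV"
begin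

definition coord :: "'a \<Rightarrow> nat \<Rightarrow> real" where
  "coord v i = representation (\<alpha> ` {..<p}) v (\<alpha> i)"

lemma coord_sum: "v = (\<Sum>i<p. coord v i *\<^sub>R \<alpha> i)"
proof -
  have "v = (\<Sum>b\<in>\<alpha> ` {..<p}. representation (\<alpha> ` {..<p}) v b *\<^sub>R b)"
    using sum_representation_eq[OF indep, of v "\<alpha> ` {..<p}"] span by simp
  then show ?thesis
    using inj by (simp add: sum.reindex coord_def)
qed

lemma coord_unit: "i < p \<Longrightarrow> j < p \<Longrightarrow> coord (\<alpha> j) i = (if i = j then 1 else 0)"
  using representation_basis[OF indep, of "\<alpha> j"] inj by (auto simp: coord_def inj_on_def)

lemma coord_add: "coord (v + w) i = coord v i + coord w i"
  and coord_diff: "coord (v - w) i = coord v i - coord w i"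
  and coord_scaleR: "coord (r *\<^sub>R v) i = r * coord v i"
  using indep span by (simp_all add: coord_def representation_add representation_diff representation_scale)

lemma linear_coord: "linear (\<lambda>v. coord v i)"
  by (rule linearI) (simp_all add: coord_add coord_scaleR)

lemma coord_eqI: "(\<And>i. i < p \<Longrightarrow> coord v i = coord w i) \<Longrightarrow> v = w"
  by (subst coord_sum, subst (2) coord_sum) simp

definition cartan :: "nat \<Rightarrow> nat \<Rightarrow> real" where
  "cartan i j = 2 * inner (\<alpha> j) (\<alpha> i) / inner (\<alpha> i) (\<alpha> i)"

lemma coord_reflection:
  assumes "i < p" "l < p"
  shows "coord (reflection (\<alpha> i) v) l = coord v l - (if l = i then \<Sum>j<p. cartan i j * coord v j else 0)"
proof -
  have "inner v (\<alpha> i) = (\<Sum>j<p. coord v j * inner (\<alpha> j) (\<alpha> i))"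
    by (subst coord_sum) (simp add: inner_sum_left)
  then have "2 * inner v (\<alpha> i) / inner (\<alpha> i) (\<alpha> i) = (\<Sum>j<p. cartan i j * coord v j)"
    by (simp add: cartan_def sum_distrib_left sum_divide_distrib mult_ac)
  then show ?thesis
    using assms by (simp add: reflection_def coord_diff coord_scaleR coord_unit)
qed

lemma cartan_diag: "i < p \<Longrightarrow> cartan i i = 2"
  using indep dependent_zero[of "\<alpha> ` {..<p}"] by (auto simp: cartan_def image_iff)

text \<open>For the image \<open>y\<close> of \<open>v\<close> this is \<open>U y = - L v\<close>,
  where the Cartan matrix is split into unitriangular parts \<open>U\<close> and \<open>L\<close>.
  Each reflection changes one coordinate; when the one of index \<open>i\<close> acts, the
  coordinates above \<open>i\<close> are final and the others are still those of
  \<open>v\<close>.\<close>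

lemma coord_coxeter:
  assumes "i < p"
  shows "coord (coxeter_element \<alpha> p v) i + (\<Sum>j\<in>{i<..<p}. cartan i j * coord (coxeter_element \<alpha> p v) j) =
    - (coord v i + (\<Sum>j<i. cartan i j * coord v j))"
proof -
  \<comment> \<open>The reflections of index at least \<open>m\<close>; the one of highest index
    acts first.\<close>
  define T where "T m = foldr (\<circ>) (map (\<lambda>i. reflection (\<alpha> i)) [m..<p]) id" for m
  have T_Suc: "T m v = reflection (\<alpha> m) (T (Suc m) v)" if "m < p" for m v
    using that by (simp add: T_def upt_conv_Cons)
  have below: "coord (T m v) l = coord v l" if "m \<le> p" "l < m" for m l v
    using that
  proof (induction rule: inc_induct)
    case base
    then show ?case by (simp add: T_def)
  next
    case (step m)
    then show ?case by (simp add: T_Suc coord_reflection)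
  qed
  have above: "coord (T 0 v) l = coord (T m v) l" if "m \<le> l" "l < p" for m l v
    using that
  proof (induction m)
    case (Suc m)
    then show ?case by (simp add: T_Suc coord_reflection)
  qed simp
  define y where "y = coxeter_element \<alpha> p v"
  have y: "y = T 0 v"
    by (simp add: y_def T_def coxeter_element_def)
  have w: "coord (T (Suc i) v) j = (if j \<le> i then coord v j else coord y j)" if "j < p" for j
    using below[of "Suc i" j v] above[of "Suc i" j v] that assms y by auto
  have "coord y i = coord (T i v) i"
    using above[of i i v] assms y by simp
  also have "\<dots> = coord v i - (\<Sum>j<p. cartan i j * coord (T (Suc i) v) j)"
    using assms w[of i] by (simp add: T_Suc coord_reflection)
  also have "(\<Sum>j<p. cartan i j * coord (T (Suc i) v) j) =
      (\<Sum>j<p. cartan i j * (if j \<le> i then coord v j else coord y j))"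
    using w by (intro sum.cong) auto
  also have "{..<p} = {..<i} \<union> ({i} \<union> {i<..<p})"
    using assms by auto
  also have "(\<Sum>j\<in>{..<i} \<union> ({i} \<union> {i<..<p}). cartan i j * (if j \<le> i then coord v j else coord y j)) =
      (\<Sum>j<i. cartan i j * coord v j) + (2 * coord v i + (\<Sum>j\<in>{i<..<p}. cartan i j * coord y j))"
    using cartan_diag[OF assms] by (subst sum.union_disjoint) (auto simp: sum.insert_if intro!: arg_cong2[of _ _ _ _ "(+)"] sum.cong)
  finally show ?thesis
    unfolding y_def by simp
qed

lemma linear_coxeter: "linear (coxeter_element \<alpha> p)"
proof -
  have "linear (foldr (\<circ>) (map (\<lambda>i. reflection (\<alpha> i)) xs) id)" for xs
  proof (induction xs)
    case Nil
    show ?case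
      unfolding list.map foldr.simps by (rule linearI) simp_all
  next
    case (Cons x xs)
    have "foldr (\<circ>) (map (\<lambda>i. reflection (\<alpha> i)) (x # xs)) id =
        reflection (\<alpha> x) \<circ> foldr (\<circ>) (map (\<lambda>i. reflection (\<alpha> i)) xs) id"
      by simp
    moreover have "linear \<dots>"
      by (rule linear_compose[OF Cons linear_reflection])
    ultimately show ?case
      by (simp only:)
  qed
  then show ?thesis
    by (simp add: coxeter_element_def)
qed

lemma linear_coxeter_pow: "linear (coxeter_element \<alpha> p ^^ m)"
proof (induction m)
  case 0
  show ?case
    unfolding funpow.simps by (rule linearI) simp_all
next
  case (Suc m)
  then show ?case
    unfolding funpow.simps by (intro linear_compose linear_coxeter)
qed

lemma coxeter_mat_carrier [simp]: "coxeter_mat \<alpha> p \<in> carrier_mat p p"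
  by (simp add: coxeter_mat_def)

lemma coxeter_mat_index: "i < p \<Longrightarrow> j < p \<Longrightarrow> coxeter_mat \<alpha> p $$ (i, j) = coord (coxeter_element \<alpha> p (\<alpha> j)) i"
  by (simp add: coxeter_mat_def coord_def)

lemma coxeter_mat_pow:
  assumes "i < p" "j < p"
  shows "(coxeter_mat \<alpha> p ^\<^sub>m m) $$ (i, j) = coord ((coxeter_element \<alpha> p ^^ m) (\<alpha> j)) i"
  using assms
proof (induction m arbitrary: i j)
  case 0
  then show ?case by (simp add: coord_unit coxeter_mat_def)
next
  case (Suc m)
  let ?c = "coxeter_element \<alpha> p"
  note lin = linear_coxeter_pow[of m]
  have "(coxeter_mat \<alpha> p ^\<^sub>m Suc m) $$ (i, j) =
      (\<Sum>l<p. coord ((?c ^^ m) (\<alpha> l)) i * coord (?c (\<alpha> j)) l)"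
    using Suc by (simp add: scalar_prod_def atLeast0LessThan coxeter_mat_index
        pow_mat_dim[of "coxeter_mat \<alpha> p"] carrier_matD[OF coxeter_mat_carrier])
  also have "\<dots> = coord ((?c ^^ m) (\<Sum>l<p. coord (?c (\<alpha> j)) l *\<^sub>R \<alpha> l)) i"
    by (simp add: linear_sum[OF lin] linear_sum[OF linear_coord] linear_scale[OF lin] coord_scaleR mult.commute)
  also have "\<dots> = coord ((?c ^^ Suc m) (\<alpha> j)) i"
    unfolding coord_sum[symmetric] by (simp add: funpow_swap1)
  finally show ?case .
qed

lemma coxeter_pow_eq_id:
  assumes "coxeter_mat \<alpha> p ^\<^sub>m m = 1\<^sub>m p"
  shows "coxeter_element \<alpha> p ^^ m = id"
proof -
  let ?c = "coxeter_element \<alpha> p"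
  note lin = linear_coxeter_pow[of m]
  have "(?c ^^ m) (\<alpha> j) = id (\<alpha> j)" if "j < p" for j
    using coxeter_mat_pow[of _ j m] assms that by (intro coord_eqI) (simp add: coord_unit)
  then show ?thesis
    using linear_eq_on_span[OF lin linear_id, of "\<alpha> ` {..<p}"] span by fastforce
qed

text \<open>The eigenvalues determine the Coxeter number and the exponents: if the \<open>p\<close> distinct numbers
  \<open>cis (2 \<pi> x / h)\<close> with \<open>x\<close> in \<open>S\<close> are eigenvalues, then they are all the eigenvalues, the
  Coxeter element is diagonalisable with \<open>h\<close>-th power 1, and a primitive \<open>h\<close>-th root of unity
  occurs.\<close>

lemma exponents_eqI:
  assumes weyl: "weyl_exponents \<alpha> p e" and S: "finite S" "card S = p" "\<And>x. x \<in> S \<Longrightarrow> x < h" "1 \<in> S"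
    and roots: "\<And>x. x \<in> S \<Longrightarrow>
      poly (map_poly complex_of_real (char_poly (coxeter_mat \<alpha> p))) (cis (2 * pi * real x / real h)) = 0"
  shows "bij_betw e {..<p} S"
proof -
  define h\<^sub>0 where "h\<^sub>0 = coxeter_number \<alpha> p"
  define z where "z = (\<lambda>j. cis (2 * pi * real (e j) / real h\<^sub>0))"
  define r where "r = (\<lambda>x. cis (2 * pi * real x / real h))"
  have e: "e j < h\<^sub>0" if "j < p" for j
    using weyl that by (simp add: weyl_exponents_def h\<^sub>0_def)
  have factor: "map_poly complex_of_real (char_poly (coxeter_mat \<alpha> p)) = (\<Prod>j<p. [:- z j, 1:])"
    using weyl by (simp add: weyl_exponents_def h\<^sub>0_def z_def)
  have h: "h > 0"
    using S by fastforce
  have "inj_on r S"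
  proof (rule inj_onI)
    fix x y assume "x \<in> S" "y \<in> S" "r x = r y"
    then have "x * h = y * h"
      using cis_fraction_eqD[of x h y h] S(3) by (simp add: r_def)
    then show "x = y"
      using h by simp
  qed
  \<comment> \<open>These are \<open>p\<close> distinct eigenvalues among at most \<open>p\<close>
    values of \<open>z\<close>, so the two sets agree and \<open>z\<close> has no
    repetition.\<close>
  have "r ` S \<subseteq> z ` {..<p}"
    using roots unfolding factor poly_prod by (fastforce simp: r_def)
  moreover have "card (r ` S) = p"
    using \<open>inj_on r S\<close> S(2) by (simp add: card_image)
  moreover have "card (z ` {..<p}) \<le> p"
    using card_image_le[of "{..<p}" z] by simp
  ultimately have image: "r ` S = z ` {..<p}"
    by (intro card_seteq) auto
  then have "card (z ` {..<p}) = card {..<p}"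
    using \<open>card (r ` S) = p\<close> by simp
  then have inj_z: "inj_on z {..<p}"
    by (simp add: eq_card_imp_inj_on)
  have "z j ^ h = 1" if "j < p" for j
  proof -
    have "z j \<in> r ` S"
      unfolding image using that by blast
    then show ?thesis
      using cis_power_eq_1[OF h] by (auto simp: r_def)
  qed
  moreover have "char_poly (map_mat complex_of_real (coxeter_mat \<alpha> p)) = (\<Prod>j<p. [:- z j, 1:])"
    using factor by (simp add: of_real_hom.char_poly_hom[OF coxeter_mat_carrier])
  ultimately have "map_mat complex_of_real (coxeter_mat \<alpha> p) ^\<^sub>m h = 1\<^sub>m p"
    using inj_z by (intro pow_mat_eq_one) auto
  then have "map_mat complex_of_real (coxeter_mat \<alpha> p ^\<^sub>m h) = map_mat complex_of_real (1\<^sub>m p)"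
    by (simp add: of_real_hom.mat_hom_pow[OF coxeter_mat_carrier] of_real_hom.mat_hom_one)
  then have "coxeter_mat \<alpha> p ^\<^sub>m h = 1\<^sub>m p"
    by (rule of_real_hom.mat_hom_inj)
  then have "coxeter_element \<alpha> p ^^ h = id"
    by (rule coxeter_pow_eq_id)
  then have h\<^sub>0_le: "h\<^sub>0 \<le> h"
    unfolding h\<^sub>0_def coxeter_number_def using h by (intro Least_le) auto
  have match: "x * h\<^sub>0 = e j * h" if "x \<in> S" "j < p" "r x = z j" for x j
    using cis_fraction_eqD[of x h "e j" h\<^sub>0] that S(3) e by (simp add: r_def z_def)
  \<comment> \<open>Matching the element 1 of \<open>S\<close> makes \<open>h\<^sub>0\<close> a
    positive multiple of \<open>h\<close>.\<close>
  obtain j where "j < p" "r 1 = z j"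
    using image S(4) by (metis (no_types, lifting) imageE imageI lessThan_iff)
  then have "h\<^sub>0 = e j * h"
    using match[OF S(4)] by simp
  moreover have "h\<^sub>0 > 0"
    using e[OF \<open>j < p\<close>] by simp
  ultimately have "h \<le> h\<^sub>0"
    by simp
  with h\<^sub>0_le have "h\<^sub>0 = h" by simp
  have e_S: "e j \<in> S" "z j = r (e j)" if "j < p" for j
  proof -
    have "z j \<in> r ` S"
      unfolding image using that by blast
    then obtain x where x: "x \<in> S" "r x = z j" by auto
    then have "x = e j"
      using match[of x j] that h \<open>h\<^sub>0 = h\<close> by simp
    then show "e j \<in> S" "z j = r (e j)"
      using x by auto
  qed
  have "inj_on e {..<p}"
    using inj_z e_S by (auto simp: inj_on_def)
  moreover have "e ` {..<p} = S"
    using e_S S calculation by (intro card_subset_eq) (auto simp: card_image)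
  ultimately show ?thesis
    by (simp add: bij_betw_def)
qed

end

section \<open>Tridiagonal determinants and the characteristic polynomial\<close>

lemma det_tridiagonal_step:
  fixes F :: "nat \<Rightarrow> nat \<Rightarrow> 'a::comm_ring_1"
  assumes zero: "\<And>j. j < m \<Longrightarrow> F (Suc m) j = 0" "\<And>i. i < m \<Longrightarrow> F i (Suc m) = 0"
  defines "D \<equiv> \<lambda>m. Determinant.det (Matrix.mat m m (\<lambda>(i, j). F i j))"
  shows "D (Suc (Suc m)) = F (Suc m) (Suc m) * D (Suc m) - F (Suc m) m * F m (Suc m) * D m"
proof -
  define A where "A = Matrix.mat (Suc (Suc m)) (Suc (Suc m)) (\<lambda>(i, j). F i j)"
  \<comment> \<open>The minor belonging to the entry \<open>(Suc m, m)\<close> in the expansion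
    along the last row; in its own last column only one entry survives.\<close>
  define A' where "A' = Matrix.mat (Suc m) (Suc m) (\<lambda>(i, j). F i (if j < m then j else Suc j))"
  have A: "A \<in> carrier_mat (Suc (Suc m)) (Suc (Suc m))" and A': "A' \<in> carrier_mat (Suc m) (Suc m)"
    by (simp_all add: A_def A'_def)
  have "mat_delete A (Suc m) (Suc m) = Matrix.mat (Suc m) (Suc m) (\<lambda>(i, j). F i j)"
    by (rule eq_matI) (auto simp: mat_delete_def A_def)
  then have 1: "cofactor A (Suc m) (Suc m) = D (Suc m)"
    by (simp add: cofactor_def D_def)
  have "mat_delete A' m m = Matrix.mat m m (\<lambda>(i, j). F i j)"
    by (rule eq_matI) (auto simp: mat_delete_def A'_def)
  then have 2: "cofactor A' m m = D m"
    by (simp add: cofactor_def D_def)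
  have "Determinant.det A' = (\<Sum>i<Suc m. A' $$ (i, m) * cofactor A' i m)"
    by (rule laplace_expansion_column[OF A']) simp
  also have "(\<Sum>i<m. A' $$ (i, m) * cofactor A' i m) = 0"
    using zero(2) by (intro sum.neutral) (auto simp: A'_def)
  then have "(\<Sum>i<Suc m. A' $$ (i, m) * cofactor A' i m) = F m (Suc m) * D m"
    using 2 by (simp add: A'_def)
  finally have det_A': "Determinant.det A' = F m (Suc m) * D m" .
  have "mat_delete A (Suc m) m = A'"
    by (rule eq_matI) (auto simp: mat_delete_def A_def A'_def)
  then have 3: "cofactor A (Suc m) m = - (F m (Suc m) * D m)"
    by (simp add: cofactor_def det_A')
  have "Determinant.det A = (\<Sum>j<Suc (Suc m). A $$ (Suc m, j) * cofactor A (Suc m) j)"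
    by (rule laplace_expansion_row[OF A]) simp
  also have "(\<Sum>j<m. A $$ (Suc m, j) * cofactor A (Suc m) j) = 0"
    using zero(1) by (intro sum.neutral) (auto simp: A_def)
  then have "(\<Sum>j<Suc (Suc m). A $$ (Suc m, j) * cofactor A (Suc m) j) =
      F (Suc m) m * cofactor A (Suc m) m + F (Suc m) (Suc m) * cofactor A (Suc m) (Suc m)"
    by (simp add: A_def)
  finally show ?thesis
    unfolding 1 3 by (simp add: D_def A_def algebra_simps)
qed

text \<open>Rows and columns are permuted in turn, with a transposition in between, and the two
  signs cancel.\<close>

lemma det_simultaneous_permutation:
  fixes F :: "nat \<Rightarrow> nat \<Rightarrow> 'a::comm_ring_1"
  assumes \<tau>: "\<tau> permutes {0..<n}"
  shows "Determinant.det (Matrix.mat n n (\<lambda>(i, j). F (\<tau> i) (\<tau> j))) =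
    Determinant.det (Matrix.mat n n (\<lambda>(i, j). F i j))"
proof -
  define A where "A = Matrix.mat n n (\<lambda>(i, j). F i j)"
  define A' where "A' = Matrix.mat n n (\<lambda>(i, j). F (\<tau> j) i)"
  have A: "A \<in> carrier_mat n n" "A' \<in> carrier_mat n n"
    by (simp_all add: A_def A'_def)
  have \<tau>_less: "\<tau> i < n" if "i < n" for i
    using permutes_in_image[OF \<tau>, of i] that by simp
  have "Matrix.mat n n (\<lambda>(i, j). A $$ (\<tau> i, j)) = transpose_mat A'"
    by (rule eq_matI) (auto simp: A_def A'_def \<tau>_less)
  with det_permute_rows[OF A(1) \<tau>] have 1: "Determinant.det A' = signof \<tau> * Determinant.det A"
    by (simp add: det_transpose[OF A(2)])
  have "Matrix.mat n n (\<lambda>(i, j). A' $$ (\<tau> i, j)) = transpose_mat (Matrix.mat n n (\<lambda>(i, j). F (\<tau> i) (\<tau> j)))"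
    by (rule eq_matI) (auto simp: A'_def \<tau>_less)
  with det_permute_rows[OF A(2) \<tau>]
  have "Determinant.det (Matrix.mat n n (\<lambda>(i, j). F (\<tau> i) (\<tau> j))) = signof \<tau> * Determinant.det A'"
    by (simp add: det_transpose[of _ n])
  moreover have "signof \<tau> * (signof \<tau> * Determinant.det A) = Determinant.det A"
    by (simp add: sign_def)
  ultimately show ?thesis
    by (simp add: 1 A_def)
qed

lemma sum_const_poly: "(\<Sum>l\<in>S. [:c l:]) = [:\<Sum>l\<in>S. c l:]"
  by (induction S rule: infinite_finite_induct) auto

context ordered_basis
begin

definition coxeter_pencil :: "nat \<Rightarrow> nat \<Rightarrow> real poly" where
  "coxeter_pencil i j = (if i = j then [:1, 1:] else if i < j then [:0, cartan i j:] else [:cartan i j:])"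

text \<open>Writing the Cartan matrix as \<open>U + L\<close> with \<open>U\<close> upper and \<open>L\<close> lower unitriangular, the matrix
  of the Coxeter element is \<open>- U\<^sup>-\<^sup>1 L\<close>, so its characteristic polynomial is \<open>det (x U + L)\<close>.\<close>

lemma char_poly_coxeter:
  "char_poly (coxeter_mat \<alpha> p) = Determinant.det (Matrix.mat p p (\<lambda>(i, j). coxeter_pencil i j))"
proof -
  let ?M = "coxeter_mat \<alpha> p"
  define u where "u = (\<lambda>i j. if i = j then 1 else if i < j then cartan i j else 0)"
  define U where "U = Matrix.mat p p (\<lambda>(i, j). [:u i j:])"
  have U: "U \<in> carrier_mat p p"
    by (simp add: U_def)
  have "Determinant.det U = prod_list (diag_mat U)"
    by (rule det_upper_triangular[OF _ U]) (auto simp: U_def u_def)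
  also have "\<dots> = 1"
    by (rule prod_list_neutral) (auto simp: diag_mat_def U_def u_def)
  finally have det_U: "Determinant.det U = 1" .
  \<comment> \<open>Entrywise \<open>U M = - L\<close>, from \<open>coord_coxeter\<close> on the
    basis vectors.\<close>
  have UM: "(\<Sum>l<p. u i l * ?M $$ (l, j)) = - (if i = j then 1 else if j < i then cartan i j else 0)"
    if ij: "i < p" "j < p" for i j
  proof -
    have "(\<Sum>l<p. u i l * ?M $$ (l, j)) = (\<Sum>l\<in>insert i {i<..<p}. u i l * ?M $$ (l, j))"
      using ij by (intro sum.mono_neutral_right) (auto simp: u_def)
    also have "\<dots> = coord (coxeter_element \<alpha> p (\<alpha> j)) i +
        (\<Sum>l\<in>{i<..<p}. cartan i l * coord (coxeter_element \<alpha> p (\<alpha> j)) l)"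
      using ij by (simp add: coxeter_mat_index u_def)
    also have "\<dots> = - (coord (\<alpha> j) i + (\<Sum>l<i. cartan i l * coord (\<alpha> j) l))"
      by (rule coord_coxeter[OF ij(1)])
    also have "(\<Sum>l<i. cartan i l * coord (\<alpha> j) l) = (\<Sum>l<i. if l = j then cartan i j else 0)"
      using ij by (intro sum.cong) (auto simp: coord_unit)
    finally show ?thesis
      using ij by (auto simp: coord_unit)
  qed
  have "U * char_poly_matrix ?M = Matrix.mat p p (\<lambda>(i, j). coxeter_pencil i j)"
  proof (rule eq_matI)
    fix i j assume "i < dim_row (Matrix.mat p p (\<lambda>(i, j). coxeter_pencil i j))"
      "j < dim_col (Matrix.mat p p (\<lambda>(i, j). coxeter_pencil i j))"
    then have ij: "i < p" "j < p" by auto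
    have X: "char_poly_matrix ?M $$ (l, j) = (if l = j then [:0, 1:] else 0) + [:- ?M $$ (l, j):]" if "l < p" for l
      using that ij carrier_matD[OF coxeter_mat_carrier] by (simp add: char_poly_matrix_def)
    have "(U * char_poly_matrix ?M) $$ (i, j) = (\<Sum>l<p. [:u i l:] * char_poly_matrix ?M $$ (l, j))"
      using ij carrier_matD[OF char_poly_matrix_closed[OF coxeter_mat_carrier]]
      by (simp add: U_def scalar_prod_def atLeast0LessThan)
    also have "\<dots> = (\<Sum>l<p. (if l = j then [:0, u i j:] else 0) + [:- (u i l * ?M $$ (l, j)):])"
      using X by (intro sum.cong) (auto simp: algebra_simps)
    also have "\<dots> = [:0, u i j:] + [:- (\<Sum>l<p. u i l * ?M $$ (l, j)):]"
      using ij by (simp add: sum.distrib sum_const_poly sum_negf)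
    finally show "(U * char_poly_matrix ?M) $$ (i, j) = Matrix.mat p p (\<lambda>(i, j). coxeter_pencil i j) $$ (i, j)"
      using ij UM[OF ij] by (auto simp: u_def coxeter_pencil_def)
  qed (use U carrier_matD[OF char_poly_matrix_closed[OF coxeter_mat_carrier]] in auto)
  moreover have "Determinant.det (U * char_poly_matrix ?M) = char_poly ?M"
    using det_mult[OF U char_poly_matrix_closed[OF coxeter_mat_carrier]] det_U by (simp add: char_poly_def)
  ultimately show ?thesis by simp
qed

text \<open>The order of the simple roots only decides which of two mirror-image entries of the pencil
  carries the factor \<open>x\<close>, and a tridiagonal determinant depends on their product only.\<close>

lemma char_poly_coxeter_path:
  assumes f: "bij_betw f {..<p} (\<alpha> ` {..<p})"
    and orth: "\<And>i j. Suc i < j \<Longrightarrow> j < p \<Longrightarrow> inner (f i) (f j) = 0"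
    and edge: "\<And>i. Suc i < p \<Longrightarrow>
      4 * (inner (f i) (f (Suc i)))\<^sup>2 = w i * (inner (f i) (f i) * inner (f (Suc i)) (f (Suc i)))"
  obtains D :: "nat \<Rightarrow> real poly"
  where "char_poly (coxeter_mat \<alpha> p) = D p" "D 0 = 1" "D 1 = [:1, 1:]"
    "\<And>m. Suc m < p \<Longrightarrow> D (Suc (Suc m)) = [:1, 1:] * D (Suc m) - [:0, w m:] * D m"
proof -
  \<comment> \<open>The position of \<open>f i\<close> in the list \<open>\<alpha>\<close>, extended
    by the identity so that it is a permutation.\<close>
  define \<tau> where "\<tau> = (\<lambda>i. if i < p then the_inv_into {..<p} \<alpha> (f i) else i)"
  have bij: "bij_betw (the_inv_into {..<p} \<alpha> \<circ> f) {..<p} {..<p}"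
    using f inj by (intro bij_betw_trans[of f _ "\<alpha> ` {..<p}"] bij_betw_the_inv_into) (simp_all add: bij_betw_def)
  then have "bij_betw \<tau> {..<p} {..<p}"
    by (rule bij_betw_cong[THEN iffD1, rotated]) (simp add: \<tau>_def)
  then have \<tau>: "\<tau> permutes {0..<p}"
    by (intro bij_imp_permutes) (auto simp: \<tau>_def atLeast0LessThan)
  have \<tau>_less: "\<tau> i < p" if "i < p" for i
    using permutes_in_image[OF \<tau>, of i] that by simp
  have \<alpha>\<tau>: "\<alpha> (\<tau> i) = f i" if "i < p" for i
  proof -
    have "f i \<in> \<alpha> ` {..<p}"
      using f that by (auto simp: bij_betw_def)
    then show ?thesis
      using f_the_inv_into_f[OF inj] that by (simp add: \<tau>_def)
  qed
  have \<tau>_eq: "\<tau> i = \<tau> j \<longleftrightarrow> i = j" for i j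
    using permutes_inj[OF \<tau>] by (auto dest: injD)
  define G where "G i j = coxeter_pencil (\<tau> i) (\<tau> j)" for i j
  define D where "D m = Determinant.det (Matrix.mat m m (\<lambda>(i, j). G i j))" for m
  have zero: "G i j = 0" if "i < p" "j < p" "Suc i < j \<or> Suc j < i" for i j
  proof -
    have "inner (f j) (f i) = 0"
      using that orth[of i j] orth[of j i] by (auto simp: inner_commute)
    then have "cartan (\<tau> i) (\<tau> j) = 0"
      using that by (simp add: cartan_def \<alpha>\<tau>)
    then show ?thesis
      using that by (auto simp: G_def coxeter_pencil_def \<tau>_eq)
  qed
  have diag: "G i i = [:1, 1:]" for i
    by (simp add: G_def coxeter_pencil_def)
  have prod: "G (Suc m) m * G m (Suc m) = [:0, w m:]" if "Suc m < p" for m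
  proof -
    have m: "m < p" using that by simp
    have "f i \<noteq> 0" if "i < p" for i
      using \<alpha>\<tau>[OF that] \<tau>_less[OF that] indep dependent_zero[of "\<alpha> ` {..<p}"] by (metis imageI lessThan_iff)
    then have nz: "inner (f m) (f m) \<noteq> 0" "inner (f (Suc m)) (f (Suc m)) \<noteq> 0"
      using that m by auto
    have "cartan (\<tau> (Suc m)) (\<tau> m) * cartan (\<tau> m) (\<tau> (Suc m)) =
        4 * (inner (f m) (f (Suc m)))\<^sup>2 / (inner (f m) (f m) * inner (f (Suc m)) (f (Suc m)))"
      using that m by (simp add: cartan_def \<alpha>\<tau> inner_commute power2_eq_square)
    also have "\<dots> = w m"
      unfolding edge[OF that] using nz by simp
    finally have "cartan (\<tau> (Suc m)) (\<tau> m) * cartan (\<tau> m) (\<tau> (Suc m)) = w m" .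
    \<comment> \<open>Whichever order holds, exactly one of the two mirror entries carries the
      factor \<open>x\<close>.\<close>
    moreover have "\<tau> m < \<tau> (Suc m) \<or> \<tau> (Suc m) < \<tau> m"
      using \<tau>_eq[of m "Suc m"] by linarith
    ultimately show ?thesis
      by (auto simp: G_def coxeter_pencil_def mult.commute)
  qed
  show thesis
  proof (rule that[of D])
    show "char_poly (coxeter_mat \<alpha> p) = D p"
      unfolding char_poly_coxeter D_def G_def det_simultaneous_permutation[OF \<tau>, of coxeter_pencil] ..
    show "D 0 = 1"
      by (simp add: D_def)
    show "D 1 = [:1, 1:]"
      by (simp add: D_def diag det_single)
    fix m assume m: "Suc m < p"
    have "D (Suc (Suc m)) = G (Suc m) (Suc m) * D (Suc m) - G (Suc m) m * G m (Suc m) * D m"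
      unfolding D_def using m zero by (intro det_tridiagonal_step) auto
    then show "D (Suc (Suc m)) = [:1, 1:] * D (Suc m) - [:0, w m:] * D m"
      by (simp add: diag prod[OF m])
  qed
qed

end

subsection \<open>The product over the exponents\<close>

lemma prod_shifted_quotient: "(\<Prod>i<p. (real m + real i + 1) / (real i + 1)) = real (m + p choose p)"
proof (induction p)
  case (Suc p)
  have "real (Suc p) * real (Suc (m + p) choose Suc p) = real (Suc (m + p)) * real (m + p choose p)"
    using Suc_times_binomial[of p "m + p"] by (metis of_nat_mult)
  then have "real (m + Suc p choose Suc p) = real (m + p choose p) * ((real m + real p + 1) / (real p + 1))"
    by (simp add: field_simps del: binomial_Suc_Suc)
  then show ?case
    using Suc by simp
qed simp

section \<open>Exponents of the three types\<close>

locale laced_path_order = laced_path \<Delta> B s f k n + ordered_basis \<alpha> n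
  for \<Delta> B :: "'a::euclidean_space set" and s f k n and \<alpha> :: "nat \<Rightarrow> 'a" +
  assumes \<alpha>_base: "\<alpha> ` {..<n} = B"
begin

text \<open>The weight is the multiplicity of the bond: 2 between \<open>f (k - 1)\<close> and
  \<open>f k\<close>, otherwise 1.\<close>

lemma char_poly_path:
  obtains D :: "nat \<Rightarrow> real poly"
  where "char_poly (coxeter_mat \<alpha> n) = D n" "D 0 = 1" "D 1 = [:1, 1:]"
    "\<And>m. Suc m < n \<Longrightarrow> D (Suc (Suc m)) = [:1, 1:] * D (Suc m) - [:0, if Suc m = k then 2 else 1:] * D m"
proof (rule char_poly_coxeter_path[of f "\<lambda>m. if Suc m = k then 2 else 1"])
  show "bij_betw f {..<n} (\<alpha> ` {..<n})"
    using bij \<alpha>_base by simp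
  fix i j assume "Suc i < j" "j < n"
  then show "inner (f i) (f j) = 0"
    by (simp add: f_inner)
next
  fix i assume "Suc i < n"
  then show "4 * (inner (f i) (f (Suc i)))\<^sup>2 =
      (if Suc i = k then 2 else 1) * (inner (f i) (f i) * inner (f (Suc i)) (f (Suc i)))"
    using s_pos by (auto simp: f_inner power2_eq_square)
qed (use that in blast)

lemma char_poly_classical:
  assumes "k = 1 \<or> k = n - 1"
  shows "char_poly (coxeter_mat \<alpha> n) = monom 1 n + 1"
proof -
  obtain D :: "nat \<Rightarrow> real poly" where D: "char_poly (coxeter_mat \<alpha> n) = D n" "D 0 = 1" "D 1 = [:1, 1:]"
    "\<And>m. Suc m < n \<Longrightarrow> D (Suc (Suc m)) = [:1, 1:] * D (Suc m) - [:0, if Suc m = k then 2 else 1:] * D m"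
    by (rule char_poly_path) blast
  define x :: "real poly" where "x = [:0, 1:]"
  have lin: "[:1, 1:] = 1 + x" "[:0, 2:] = 2 * x" "[:0, 1:] = x"
    by (simp_all add: x_def numeral_poly one_pCons)
  have "D n = x ^ n + 1"
    using assms
  proof
    assume k: "k = 1"
    \<comment> \<open>The formula fails at index 0, where \<open>D\<close> is 1 and not 2; the
      weight 2 of the first bond makes up for it.\<close>
    have "D (Suc m) = x ^ Suc m + 1 \<and> (Suc m < n \<longrightarrow> D (Suc (Suc m)) = x ^ Suc (Suc m) + 1)" if "m < n" for m
      using that
    proof (induction m)
      case 0
      then show ?case
        using D(2,3) D(4)[of 0] k by (simp add: lin algebra_simps)
    next
      case (Suc m)
      then show ?case
        using D(4)[of "Suc m"] k by (auto simp: lin algebra_simps)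
    qed
    from this[of "n - 1"] show ?thesis
      using k_bounds by simp
  next
    assume k: "k = n - 1"
    \<comment> \<open>The double bond enters only at the last step; before it the determinants are
      the geometric sums of type A.\<close>
    have S: "D m = (\<Sum>i\<le>m. x ^ i) \<and> (Suc m < n \<longrightarrow> D (Suc m) = (\<Sum>i\<le>Suc m. x ^ i))" if "m < n" for m
      using that
    proof (induction m)
      case 0
      then show ?case
        using D(2,3) by (simp add: lin)
    next
      case (Suc m)
      then have IH: "D m = (\<Sum>i\<le>m. x ^ i)" "D (Suc m) = (\<Sum>i\<le>Suc m. x ^ i)"
        by auto
      have "D (Suc (Suc m)) = (\<Sum>i\<le>Suc (Suc m). x ^ i)" if "Suc (Suc m) < n"
      proof -
        have "Suc m \<noteq> k"
          using that k by simp
        then have "D (Suc (Suc m)) = (1 + x) * D (Suc m) - x * D m"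
          using D(4)[OF Suc_lessD[OF that]] by (simp add: lin)
        then show ?thesis
          by (simp add: IH algebra_simps)
      qed
      then show ?case
        using IH by auto
    qed
    obtain m where m: "n = Suc (Suc m)"
      using k_bounds k by (metis Suc_pred diff_is_0_eq' less_Suc_eq_le less_nat_zero_code not_gr0 zero_less_diff)
    have shift: "(\<Sum>i\<le>Suc m. x ^ i) = 1 + x * (\<Sum>i\<le>m. x ^ i)"
      by (simp only: sum.atMost_Suc_shift power_0 power_Suc sum_distrib_left)
    have "D n = (1 + x) * (\<Sum>i\<le>Suc m. x ^ i) - 2 * x * (\<Sum>i\<le>m. x ^ i)"
      using D(4)[of m] S[of m] k m by (simp add: lin del: sum.atMost_Suc)
    also have "\<dots> = (\<Sum>i\<le>Suc m. x ^ i) + x * ((\<Sum>i\<le>m. x ^ i) + x ^ Suc m) - 2 * x * (\<Sum>i\<le>m. x ^ i)"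
      by (simp add: algebra_simps)
    also have "\<dots> = x ^ n + 1"
      unfolding shift by (simp add: m algebra_simps)
    finally show ?thesis .
  qed
  then show ?thesis
    using D(1) by (simp add: x_def monom_altdef)
qed

text \<open>This is the twelfth cyclotomic polynomial, which explains the Coxeter number 12 and
  exponents prime to 12.\<close>

lemma char_poly_F4:
  assumes "k = 2" "n = 4"
  shows "char_poly (coxeter_mat \<alpha> n) = [:1, 0, - 1, 0, 1:]"
proof -
  obtain D :: "nat \<Rightarrow> real poly" where D: "char_poly (coxeter_mat \<alpha> n) = D n" "D 0 = 1" "D 1 = [:1, 1:]"
    "\<And>m. Suc m < n \<Longrightarrow> D (Suc (Suc m)) = [:1, 1:] * D (Suc m) - [:0, if Suc m = k then 2 else 1:] * D m"
    by (rule char_poly_path) blast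
  have "D 2 = [:1, 1, 1:]"
    using D(4)[of 0] D(2,3) assms by (simp add: numeral_2_eq_2 one_pCons)
  moreover from this have "D 3 = [:1, 0, 0, 1:]"
    using D(4)[of 1] D(2,3) assms by (simp add: numeral_2_eq_2 numeral_3_eq_3 one_pCons)
  ultimately have "D 4 = [:1, 0, - 1, 0, 1:]"
    using D(4)[of 2] assms by (simp add: numeral_eq_Suc)
  then show ?thesis
    using D(1) assms by simp
qed

text \<open>The solutions of \<open>x ^ n = - 1\<close> are the odd powers of a primitive root of
  unity of order \<open>2 * n\<close>.\<close>

lemma exponents_classical:
  assumes "k = 1 \<or> k = n - 1" and weyl: "weyl_exponents \<alpha> n e"
  shows "bij_betw e {..<n} ((\<lambda>i. 2 * i + 1) ` {..<n})"
proof (rule exponents_eqI[OF weyl, of _ "2 * n"])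
  fix x assume "x \<in> (\<lambda>i. 2 * i + 1) ` {..<n}"
  then obtain i where i: "x = 2 * i + 1" "i < n" by blast
  have "real n * (2 * pi * real x / real (2 * n)) = pi * real x"
    using i by simp
  then have "cis (2 * pi * real x / real (2 * n)) ^ n = cis (pi * real x)"
    unfolding Complex.DeMoivre by simp
  also have "\<dots> = cis (2 * pi * real i) * cis pi"
    unfolding cis_mult by (simp add: i algebra_simps)
  also have "\<dots> = - 1"
    using cis_multiple_2pi[of "real i"] by simp
  finally show "poly (map_poly complex_of_real (char_poly (coxeter_mat \<alpha> n))) (cis (2 * pi * real x / real (2 * n))) = 0"
    unfolding char_poly_classical[OF assms(1)]
    by (simp add: of_real_hom.map_poly_hom_add poly_monom)
qed (use k_bounds in \<open>auto simp: card_image inj_on_def intro: image_eqI[of _ _ 0]\<close>)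

lemma exponents_F4:
  assumes "k = 2" "n = 4" and weyl: "weyl_exponents \<alpha> n e"
  shows "bij_betw e {..<n} {1, 5, 7, 11}"
proof (rule exponents_eqI[OF weyl, of _ 12])
  fix x :: nat assume x: "x \<in> {1, 5, 7, 11}"
  define z where "z = cis (2 * pi * real x / real 12)"
  have "z ^ 6 = cis (pi * real x)"
    unfolding z_def Complex.DeMoivre by simp
  also have "\<dots> = cis (2 * pi * real (x div 2)) * cis pi"
    unfolding cis_mult using x by (auto simp: algebra_simps)
  also have "\<dots> = - 1"
    using cis_multiple_2pi[of "real (x div 2)"] by simp
  \<comment> \<open>The factorisation of \<open>z ^ 6 + 1\<close>. The first factor vanishes only at
    3/12 and 9/12 of a full turn, and neither 3 nor 9 is among the values of
    \<open>x\<close>.\<close>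
  finally have "(z\<^sup>2 + 1) * (z ^ 4 - z\<^sup>2 + 1) = 0"
    by (simp add: algebra_simps flip: power_add)
  moreover have "z\<^sup>2 + 1 \<noteq> 0"
  proof
    assume "z\<^sup>2 + 1 = 0"
    then have "(z - \<i>) * (z + \<i>) = 0"
      by (simp add: algebra_simps power2_eq_square)
    moreover have "cis (2 * pi * real 3 / real 12) = \<i>"
      proof -
      have "2 * pi * real 3 / real 12 = pi / 2"
        by simp
      then show ?thesis
        by (simp only: cis_pi_half)
    qed
    moreover have "cis (2 * pi * real 9 / real 12) = - \<i>"
    proof -
      have "2 * pi * real 9 / real 12 = pi / 2 + pi"
        by (simp add: field_simps)
      then have "cis (2 * pi * real 9 / real 12) = cis (pi / 2) * cis pi"
        unfolding cis_mult by simp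
      then show ?thesis by simp
    qed
    ultimately have "z = cis (2 * pi * real 3 / real 12) \<or> z = cis (2 * pi * real 9 / real 12)"
      by (metis add_eq_0_iff2 eq_iff_diff_eq_0 mult_eq_0_iff)
    then have "x * 12 = 3 * 12 \<or> x * 12 = 9 * 12"
      unfolding z_def using x cis_fraction_eqD[of x 12 3 12] cis_fraction_eqD[of x 12 9 12] by auto
    then show False
      using x by auto
  qed
  ultimately have "z ^ 4 - z\<^sup>2 + 1 = 0"
    by simp
  then show "poly (map_poly complex_of_real (char_poly (coxeter_mat \<alpha> n))) (cis (2 * pi * real x / real 12)) = 0"
    unfolding char_poly_F4[OF assms(1,2)] z_def[symmetric]
    by (simp add: map_poly_pCons algebra_simps power2_eq_square power4_eq_xxxx)
qed (use assms in auto)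

end

theorem theorem5p5:
  fixes \<Delta> B :: "'a::euclidean_space set"
    and \<alpha> :: "nat \<Rightarrow> 'a" and p :: nat
    and \<theta> \<theta>\<^sub>s :: 'a
    and c e :: "nat \<Rightarrow> nat" and g :: nat
  assumes "root_system \<Delta>" and "reduced_roots \<Delta>" and "crystallographic \<Delta>"
    and "irreducible_roots \<Delta>" and "two_root_lengths \<Delta>"
    and "simple_roots \<Delta> B" and "bij_betw \<alpha> {..<p} B"
    and "highest_root \<Delta> B \<theta>" and "highest_short_root \<Delta> B \<theta>\<^sub>s"
    and "(norm \<theta>)\<^sup>2 / (norm \<theta>\<^sub>s)\<^sup>2 = 2"
    and "weyl_exponents \<alpha> p e"
    and "\<theta> = (\<Sum>i<p. real (c i) *\<^sub>R \<alpha> i)"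
    and "g = (\<Sum>i | i < p \<and> \<alpha> i \<in> short_roots \<Delta>. c i)"
  shows "real (card (short_antichains \<Delta> B)) =
    (\<Prod>i<p. (real g + real (e i) + 1) / (real (e i) + 1))"
proof -
  interpret root_base \<Delta> B
    using assms(1-4,6) by unfold_locales
  define s where "s = inner \<theta>\<^sub>s \<theta>\<^sub>s"
  have roots: "\<theta> \<in> \<Delta>" "\<theta>\<^sub>s \<in> \<Delta>"
    using assms(8,9) by (auto simp: highest_root_def highest_short_root_def positive_roots_def)
  then have s: "s > 0"
    using zero_not_root by (auto simp: s_def)
  have long: "inner \<theta> \<theta> = 2 * s"
    using assms(10) s by (simp add: s_def power2_norm_eq_inner field_simps)
  then have "norm \<theta> \<noteq> norm \<theta>\<^sub>s"
    using s by (auto simp: s_def norm_eq)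
  \<comment> \<open>There are exactly two root lengths, so those of \<open>\<theta>\<close> and
    \<open>\<theta>\<^sub>s\<close> are all of them.\<close>
  then have "card {norm \<theta>, norm \<theta>\<^sub>s} = card (norm ` \<Delta>)"
    using assms(5) by (simp add: two_root_lengths_def)
  then have norms: "{norm \<theta>, norm \<theta>\<^sub>s} = norm ` \<Delta>"
    using roots finite_roots by (intro card_subset_eq) auto
  interpret doubly_laced_base \<Delta> B s
  proof
    fix a assume "a \<in> \<Delta>"
    then have "norm a \<in> {norm \<theta>, norm \<theta>\<^sub>s}"
      unfolding norms by simp
    then show "inner a a = s \<or> inner a a = 2 * s"
      using long by (auto simp: norm_eq s_def)
  qed (use s roots long in \<open>auto simp: s_def\<close>)
  obtain f k n where f: "dynkin_path f k n" "bij_betw f {..<n} B"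
    by (rule classification)
  have "p = n"
    using bij_betw_same_card[OF assms(7)] bij_betw_same_card[OF f(2)] by simp
  note \<alpha> = assms(7)[unfolded \<open>p = n\<close>]
  interpret laced_path_order \<Delta> B s f k n \<alpha>
    using f \<alpha> independent_base span_base by unfold_locales (auto simp: bij_betw_def)
  note weyl = assms(11)[unfolded \<open>p = n\<close>]
  have g: "g = (\<Sum>i=k..<n. d i)" if "\<theta> = comb (\<lambda>i. int (d i))" for d
    using sum_short_coefficients[OF assms(7)] that assms(12,13) by simp
  \<comment> \<open>For the exponent \<open>2 * i + 1\<close> the factor is
    \<open>2 * m + 2 * i + 2\<close> over \<open>2 * i + 2\<close>, and the 2 cancels.\<close>
  have odd_prod: "(\<Prod>i<n. (real g + real (e i) + 1) / (real (e i) + 1)) = real (m + n choose n)"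
    if "k = 1 \<or> k = n - 1" "g = 2 * m" for m
  proof -
    have "(\<Prod>i<n. (real g + real (e i) + 1) / (real (e i) + 1)) =
        (\<Prod>x\<in>(\<lambda>i. 2 * i + 1) ` {..<n}. (real g + real x + 1) / (real x + 1))"
      by (rule prod.reindex_bij_betw[OF exponents_classical[OF that(1) weyl]])
    also have "\<dots> = (\<Prod>i<n. (real m + real i + 1) / (real i + 1))"
      by (subst prod.reindex) (auto simp: inj_on_def that(2) field_simps intro!: prod.cong)
    finally show ?thesis
      by (simp only: prod_shifted_quotient)
  qed
  \<comment> \<open>Types B, C and F4; in rank 2 the first two overlap.\<close>
  consider "k = n - 1" | "k = 1" | "k = 2" "n = 4"
    using path_lengths[OF f(1)] by blast
  then show ?thesis
  proof cases
    case 1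
    interpret type_B \<Delta> B s f k n
      using 1 by unfold_locales
    have "{k..<n} = {n - 1}" "n - 1 \<noteq> 0"
      using k_bounds 1 by auto
    \<comment> \<open>Only the last simple root is short, with coefficient 2.\<close>
    then have "g = 2 * 1"
      using g[OF highest_root_B[OF assms(8)]] by simp
    then show ?thesis
      using odd_prod[of 1] 1 card_short_antichains_B \<open>p = n\<close> by simp
  next
    case 2
    interpret type_C \<Delta> B s f k n
      using 2 by unfold_locales
    \<comment> \<open>All simple roots but the first are short, each with coefficient 2.\<close>
    have "g = 2 * (n - 1)"
      using g[OF highest_root_C[OF assms(8)]] 2 by simp
    moreover have "2 * (n - 1) + 1 choose (n - 1) = n - 1 + n choose n"
    proof -
      have "2 * (n - 1) + 1 = n - 1 + n"
        using k_bounds by simp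
      moreover have "n - 1 + n choose n = n - 1 + n choose (n - 1)"
        using binomial_symmetric[of n "n - 1 + n"] by simp
      ultimately show ?thesis
        by (simp only:)
    qed
    ultimately show ?thesis
      using odd_prod[of "n - 1"] 2 card_short_antichains_C \<open>p = n\<close> by simp
  next
    case 3
    interpret type_F4 \<Delta> B s f k n
      using 3 by unfold_locales
    define d :: "nat \<Rightarrow> nat" where "d = (\<lambda>_. 0)(0 := 2, 1 := 3, 2 := 4, 3 := 2)"
    have "\<theta> = comb (\<lambda>i. int (d i))"
      unfolding highest_root_F4[OF assms(8)] by (rule arg_cong[of _ _ comb]) (auto simp: d_def)
    \<comment> \<open>The two short simple roots have coefficients 4 and 2.\<close>
    from g[OF this] have "g = 6"
      using 3 by (simp add: d_def numeral_eq_Suc)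
    have "(\<Prod>i<n. (real g + real (e i) + 1) / (real (e i) + 1)) =
        (\<Prod>x\<in>{1, 5, 7, 11}. (real g + real x + 1) / (real x + 1))"
      by (rule prod.reindex_bij_betw[OF exponents_F4[OF 3 weyl]])
    \<comment> \<open>The factors are 8/2, 12/6, 14/8 and 18/12.\<close>
    also have "\<dots> = 21"
      by (simp add: \<open>g = 6\<close>)
    finally show ?thesis
      using card_short_antichains_F4 \<open>p = n\<close> by simp
  qed
qed

end
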